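(* Let $1\to\mathbf A\xrightarrow{i}\mathbf B\xrightarrow{j}\mathbf C\to1$ be a short exact sequence of real algebraic groups (not necessarily linear or connected), and let $\delta\colon\mathbf C(\mathbb R)\to\mathrm H^1\mathbf A$ be the connecting map. Then: (i) The map $\delta\colon\mathbf C(\mathbb R)\to\mathrm H^1\mathbf A$ induces a map $\delta^0\colon\pi_0\mathbf C(\mathbb R)\to\mathrm H^1\mathbf A$. (ii) The following sequence is exact: $$\pi_0\mathbf A(\mathbb R)\xrightarrow{i_*^0}\pi_0\mathbf B(\mathbb R)\xrightarrow{j_*^0}\pi_0\mathbf C(\mathbb R)\xrightarrow{\delta^0}\mathrm H^1\mathbf A\xrightarrow{i_*^1}\mathrm H^1\mathbf B\xrightarrow{j_*^1}\mathrm H^1\mathbf C.$$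
   Context: $\Gamma=\mathrm{Gal}(\mathbb C/\mathbb R)=\{1,\gamma\}$. For an algebraic $\mathbb R$-group $\mathbf G$ (not necessarily abelian), $\mathrm H^1\mathbf G=\mathrm H^1(\Gamma,\mathbf G(\mathbb C))$ is the pointed set $\{g\in\mathbf G(\mathbb C):g\cdot{}^\gamma g=1\}/\!\sim$, where $g\sim g'g({}^\gamma g')^{-1}$ for $g'\in\mathbf G(\mathbb C)$, with neutral element $[1]$. $\pi_0\mathbf G(\mathbb R)=\mathbf G(\mathbb R)/\mathbf G(\mathbb R)^0$, where $\mathbf G(\mathbb R)^0$ is the identity component of the real Lie group $\mathbf G(\mathbb R)$. The connecting map is defined as follows: for $c\in\mathbf C(\mathbb R)$ choose $b\in\mathbf B(\mathbb C)$ with $j(b)=c$; then $\delta(c)=[b^{-1}\cdot{}^\gamma b]\in\mathrm H^1\mathbf A$ (identifying $\mathbf A$ with $i(\mathbf A)$). The maps with $*$ are induced by $i$ and $j$; exactness is as pointed sets. *)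

theory Defs
  imports "HOL-Analysis.Analysis" "HOL-Algebra.Coset"
begin

section \<open>Real algebraic varieties\<close>

text \<open>
  A real algebraic variety \<open>X\<close> is represented by its set \<open>X(\<complex>)\<close> of complex points together with the
  Zariski topology of \<open>X\<^sub>\<complex>\<close>, the sheaf of regular functions, and the action of complex conjugation
  \<open>\<gamma>\<close> (Serre's definition of an algebraic variety as a space with functions, plus a real structure).
  Each point has to have a \<open>\<gamma>\<close>-stable affine open neighbourhood that is defined over \<open>\<real>\<close>, so these
  are the reduced separated schemes of finite type over \<open>\<real>\<close>.  Algebraic groups over a field of
  characteristic 0 are reduced (Cartier) and separated.

  \<open>reg X U\<close> is only meaningful for Zariski-open \<open>U\<close>, and membership of \<open>f\<close> in it depends only on
  the values of \<open>f\<close> on \<open>U\<close>.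
\<close>

record 'a rspace =
  zariski :: "'a topology"
  reg :: "'a set \<Rightarrow> ('a \<Rightarrow> complex) set"
  gal :: "'a \<Rightarrow> 'a"

definition function_sheaf :: "'a rspace \<Rightarrow> bool" where
  "function_sheaf X \<longleftrightarrow>
     (\<forall>U f g. openin (zariski X) U \<and> f \<in> reg X U \<and> (\<forall>x\<in>U. f x = g x) \<longrightarrow> g \<in> reg X U) \<and>
     (\<forall>U W f. openin (zariski X) U \<and> openin (zariski X) W \<and> W \<subseteq> U \<and> f \<in> reg X U \<longrightarrow> f \<in> reg X W) \<and>
     (\<forall>U f. openin (zariski X) U \<and>
        (\<forall>x\<in>U. \<exists>W. openin (zariski X) W \<and> x \<in> W \<and> W \<subseteq> U \<and> f \<in> reg X W) \<longrightarrow> f \<in> reg X U)"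

definition real_map :: "'a rspace \<Rightarrow> 'b rspace \<Rightarrow> ('a \<Rightarrow> 'b) \<Rightarrow> bool" where
  "real_map X Y \<phi> \<longleftrightarrow>
     continuous_map (zariski X) (zariski Y) \<phi> \<and>
     (\<forall>V f. openin (zariski Y) V \<and> f \<in> reg Y V \<longrightarrow>
        (\<lambda>x. f (\<phi> x)) \<in> reg X {x \<in> topspace (zariski X). \<phi> x \<in> V}) \<and>
     (\<forall>x\<in>topspace (zariski X). \<phi> (gal X x) = gal Y (\<phi> x))"

definition real_iso :: "'a rspace \<Rightarrow> 'b rspace \<Rightarrow> ('a \<Rightarrow> 'b) \<Rightarrow> bool" where
  "real_iso X Y \<phi> \<longleftrightarrow> real_map X Y \<phi> \<and>
     (\<exists>\<psi>. real_map Y X \<psi> \<and>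
        (\<forall>x\<in>topspace (zariski X). \<psi> (\<phi> x) = x) \<and> (\<forall>y\<in>topspace (zariski Y). \<phi> (\<psi> y) = y))"

definition open_subspace :: "'a rspace \<Rightarrow> 'a set \<Rightarrow> 'a rspace" where
  "open_subspace X U = X\<lparr>zariski := subtopology (zariski X) U\<rparr>"


subsection \<open>Affine real varieties\<close>

text \<open>Points of \<open>\<complex>\<^sup>n\<close> are sequences vanishing from index \<open>n\<close> on; \<open>poly_funs K n\<close> is \<open>K[x\<^sub>0,\<dots>,x\<^sub>n\<^sub>-\<^sub>1]\<close>,
  for \<open>K = \<real>\<close> or \<open>K = \<complex>\<close>, regarded as functions.\<close>

definition affine_space :: "nat \<Rightarrow> (nat \<Rightarrow> complex) set" where
  "affine_space n = {x. \<forall>k\<ge>n. x k = 0}"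

inductive_set poly_funs :: "complex set \<Rightarrow> nat \<Rightarrow> ((nat \<Rightarrow> complex) \<Rightarrow> complex) set"
  for K :: "complex set" and n :: nat where
  const: "c \<in> K \<Longrightarrow> (\<lambda>x. c) \<in> poly_funs K n"
| coord: "k < n \<Longrightarrow> (\<lambda>x. x k) \<in> poly_funs K n"
| add: "p \<in> poly_funs K n \<Longrightarrow> q \<in> poly_funs K n \<Longrightarrow> (\<lambda>x. p x + q x) \<in> poly_funs K n"
| mult: "p \<in> poly_funs K n \<Longrightarrow> q \<in> poly_funs K n \<Longrightarrow> (\<lambda>x. p x * q x) \<in> poly_funs K n"

definition real_affine_set :: "nat \<Rightarrow> (nat \<Rightarrow> complex) set \<Rightarrow> bool" where
  "real_affine_set n V \<longleftrightarrow>
     (\<exists>S \<subseteq> poly_funs \<real> n. V = {x \<in> affine_space n. \<forall>p\<in>S. p x = 0})"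

definition affine_variety :: "nat \<Rightarrow> (nat \<Rightarrow> complex) set \<Rightarrow> (nat \<Rightarrow> complex) rspace" where
  "affine_variety n V =
     (let T = topology_generated_by {{x \<in> V. p x \<noteq> 0} | p. p \<in> poly_funs UNIV n}
      in \<lparr>zariski = T,
          reg = (\<lambda>U. {f. \<forall>x\<in>U. \<exists>W. openin T W \<and> x \<in> W \<and> W \<subseteq> U \<and>
                   (\<exists>p\<in>poly_funs UNIV n. \<exists>q\<in>poly_funs UNIV n.
                      \<forall>y\<in>W. q y \<noteq> 0 \<and> f y = p y / q y)}),
          gal = (\<lambda>x k. cnj (x k))\<rparr>)"


subsection \<open>Products\<close>

text \<open>Locally, the regular functions on \<open>X \<times> Y\<close> are quotients of elements of
  \<open>\<O>\<^sub>X(U) \<otimes> \<O>\<^sub>Y(V)\<close>, which \<open>tensor_funs\<close> regards as functions on \<open>U \<times> V\<close>.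
  For affine varieties this is the product variety, whose Zariski topology is finer than the
  product topology.\<close>

definition tensor_funs :: "'a rspace \<Rightarrow> 'b rspace \<Rightarrow> 'a set \<Rightarrow> 'b set \<Rightarrow> ('a \<times> 'b \<Rightarrow> complex) set" where
  "tensor_funs X Y U V =
     {F. \<exists>(m::nat) f g. (\<forall>k<m. f k \<in> reg X U \<and> g k \<in> reg Y V) \<and>
           F = (\<lambda>(x, y). \<Sum>k<m. f k x * g k y)}"

definition prod_rspace :: "'a rspace \<Rightarrow> 'b rspace \<Rightarrow> ('a \<times> 'b) rspace" where
  "prod_rspace X Y =
     \<lparr>zariski = topology_generated_by
        {{z \<in> U \<times> V. F z \<noteq> 0} | U V F.
           openin (zariski X) U \<and> openin (zariski Y) V \<and> F \<in> tensor_funs X Y U V},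
      reg = (\<lambda>W. {h. \<forall>z\<in>W. \<exists>U V. openin (zariski X) U \<and> openin (zariski Y) V \<and> z \<in> U \<times> V \<and>
               (\<exists>P\<in>tensor_funs X Y U V. \<exists>Q\<in>tensor_funs X Y U V.
                  Q z \<noteq> 0 \<and> (\<forall>w \<in> W \<inter> (U \<times> V). Q w \<noteq> 0 \<longrightarrow> h w = P w / Q w))}),
      gal = map_prod (gal X) (gal Y)\<rparr>"


subsection \<open>Varieties and their real points\<close>

text \<open>That \<open>gal X\<close> is an anti-regular involution and that the regular functions on an open set
  form a \<open>\<complex>\<close>-algebra follow from the existence of the charts.\<close>

definition real_variety :: "'a rspace \<Rightarrow> bool" where
  "real_variety X \<longleftrightarrow>
     function_sheaf X \<and>
     (\<exists>\<U>. finite \<U> \<and> \<Union>\<U> = topspace (zariski X) \<and>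
        (\<forall>U\<in>\<U>. openin (zariski X) U \<and> gal X ` U = U \<and>
           (\<exists>n V \<phi>. real_affine_set n V \<and> real_iso (open_subspace X U) (affine_variety n V) \<phi>))) \<and>
     closedin (zariski (prod_rspace X X)) {(x, x) | x. x \<in> topspace (zariski X)}"

text \<open>The classical topology on \<open>X(\<complex>)\<close>: the coarsest one in which Zariski-open sets are open and
  regular functions are continuous.\<close>

definition strong_topology :: "'a rspace \<Rightarrow> 'a topology" where
  "strong_topology X =
     topology_generated_by
       {{x \<in> U. f x \<in> D} | U f D. openin (zariski X) U \<and> f \<in> reg X U \<and> open D}"


section \<open>Real algebraic groups\<close>

record 'a ralg_group = "'a monoid" +
  var :: "'a rspace"

definition real_algebraic_group :: "'a ralg_group \<Rightarrow> bool" where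
  "real_algebraic_group G \<longleftrightarrow>
     group G \<and> real_variety (var G) \<and> topspace (zariski (var G)) = carrier G \<and>
     real_map (prod_rspace (var G) (var G)) (var G) (\<lambda>(x, y). x \<otimes>\<^bsub>G\<^esub> y) \<and>
     real_map (var G) (var G) (\<lambda>x. inv\<^bsub>G\<^esub> x)"

definition real_alg_hom :: "'a ralg_group \<Rightarrow> 'b ralg_group \<Rightarrow> ('a \<Rightarrow> 'b) set" where
  "real_alg_hom G H = {\<phi> \<in> hom G H. real_map (var G) (var H) \<phi>}"

text \<open>Exactness of \<open>1 \<rightarrow> A \<rightarrow> B \<rightarrow> C \<rightarrow> 1\<close> is tested on complex points; in characteristic 0 this already
  makes \<open>i\<close> an isomorphism onto the algebraic subgroup \<open>ker j\<close> and \<open>j\<close> faithfully flat.\<close>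

definition short_exact ::
  "'a ralg_group \<Rightarrow> ('a \<Rightarrow> 'b) \<Rightarrow> 'b ralg_group \<Rightarrow> ('b \<Rightarrow> 'c) \<Rightarrow> 'c ralg_group \<Rightarrow> bool" where
  "short_exact A i B j C \<longleftrightarrow>
     i \<in> real_alg_hom A B \<and> j \<in> real_alg_hom B C \<and>
     inj_on i (carrier A) \<and> i ` carrier A = kernel B C j \<and> j ` carrier B = carrier C"


subsection \<open>The component group of the real points\<close>

definition real_points :: "'a ralg_group \<Rightarrow> 'a ralg_group" where
  "real_points G = G\<lparr>carrier := {x \<in> carrier G. gal (var G) x = x}\<rparr>"

definition identity_component :: "'a ralg_group \<Rightarrow> 'a set" where
  "identity_component G =
     connected_component_of_set
       (subtopology (strong_topology (var G)) (carrier (real_points G))) \<one>\<^bsub>G\<^esub>"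

definition pi0 :: "'a ralg_group \<Rightarrow> 'a set monoid" where
  "pi0 G = real_points G Mod identity_component G"

definition pi0_class :: "'a ralg_group \<Rightarrow> 'a \<Rightarrow> 'a set" where
  "pi0_class G x = identity_component G #>\<^bsub>real_points G\<^esub> x"

text \<open>Here and below, a map induced on classes is the union of the classes obtained from all
  representatives.  That union is a class exactly when the choices do not matter.\<close>

definition pi0_map :: "'b ralg_group \<Rightarrow> ('a \<Rightarrow> 'b) \<Rightarrow> 'a set \<Rightarrow> 'b set" where
  "pi0_map H \<phi> K = (\<Union>x\<in>K. pi0_class H (\<phi> x))"


subsection \<open>Galois cohomology\<close>

definition cocycles :: "'a ralg_group \<Rightarrow> 'a set" where
  "cocycles G = {g \<in> carrier G. g \<otimes>\<^bsub>G\<^esub> gal (var G) g = \<one>\<^bsub>G\<^esub>}"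

definition cohomologous :: "'a ralg_group \<Rightarrow> ('a \<times> 'a) set" where
  "cohomologous G =
     {(g, h). g \<in> cocycles G \<and> h \<in> cocycles G \<and>
        (\<exists>x\<in>carrier G. h = x \<otimes>\<^bsub>G\<^esub> g \<otimes>\<^bsub>G\<^esub> inv\<^bsub>G\<^esub> (gal (var G) x))}"

definition H1 :: "'a ralg_group \<Rightarrow> 'a set set" where
  "H1 G = cocycles G // cohomologous G"

definition H1_class :: "'a ralg_group \<Rightarrow> 'a \<Rightarrow> 'a set" where
  "H1_class G g = cohomologous G `` {g}"

definition H1_map :: "'b ralg_group \<Rightarrow> ('a \<Rightarrow> 'b) \<Rightarrow> 'a set \<Rightarrow> 'b set" where
  "H1_map H \<phi> \<xi> = (\<Union>g\<in>\<xi>. H1_class H (\<phi> g))"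

definition connecting_map ::
  "'a ralg_group \<Rightarrow> ('a \<Rightarrow> 'b) \<Rightarrow> 'b ralg_group \<Rightarrow> ('b \<Rightarrow> 'c) \<Rightarrow> 'c \<Rightarrow> 'a set" where
  "connecting_map A i B j c =
     \<Union>{H1_class A a | a b. a \<in> carrier A \<and> b \<in> carrier B \<and> j b = c \<and>
          i a = inv\<^bsub>B\<^esub> b \<otimes>\<^bsub>B\<^esub> gal (var B) b}"


subsection \<open>Exactness for pointed sets\<close>

type_synonym 'a pointed = "'a set \<times> 'a"

definition pointed_maps :: "'a pointed \<Rightarrow> 'b pointed \<Rightarrow> ('a \<Rightarrow> 'b) set" where
  "pointed_maps P Q = {f \<in> fst P \<rightarrow> fst Q. f (snd P) = snd Q}"

definition exact_at ::
  "'a pointed \<Rightarrow> ('a \<Rightarrow> 'b) \<Rightarrow> 'b pointed \<Rightarrow> ('b \<Rightarrow> 'c) \<Rightarrow> 'c pointed \<Rightarrow> bool" where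
  "exact_at P f Q g R \<longleftrightarrow>
     f \<in> pointed_maps P Q \<and> g \<in> pointed_maps Q R \<and> f ` fst P = {y \<in> fst Q. g y = snd R}"

definition pi0_pointed :: "'a ralg_group \<Rightarrow> 'a set pointed" where
  "pi0_pointed G = (carrier (pi0 G), \<one>\<^bsub>pi0 G\<^esub>)"

definition H1_pointed :: "'a ralg_group \<Rightarrow> 'a set pointed" where
  "H1_pointed G = (H1 G, H1_class G \<one>\<^bsub>G\<^esub>)"

end

theory Submission
  imports Defs "HOL-Complex_Analysis.Complex_Analysis"
begin

text \<open>
  Everything apart from one statement is formal nonabelian cohomology.  The statement is
  \<open>identity_component_lift\<close>: each element of \<open>C(\<real>)\<^sup>0\<close> lifts to \<open>B(\<real>)\<^sup>0\<close>.  Since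
  \<open>\<delta>(j(r) c) = \<delta>(c)\<close> for \<open>r \<in> B(\<real>)\<close> (\<open>connecting_map_translate\<close>), it makes \<open>\<delta>\<close> constant on
  the components of \<open>C(\<real>)\<close>; and it gives exactness at \<open>\<pi>\<^sub>0 B(\<real>)\<close>, because an element \<open>b\<close> of
  \<open>B(\<real>)\<close> with \<open>j(b) \<in> C(\<real>)\<^sup>0\<close> then differs from an element of \<open>i(A(\<real>))\<close> by an element of
  \<open>B(\<real>)\<^sup>0\<close>.

  It suffices to lift the elements \<open>c \<in> C(\<real>)\<close> close to \<open>1\<close>: then the image of \<open>B(\<real>)\<^sup>0\<close> is an open,
  hence also closed, subgroup of \<open>C(\<real>)\<close>.  By Baire's theorem the surjection \<open>B(\<complex>) \<rightarrow> C(\<complex>)\<close> is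
  open (\<open>open_at_one\<close>), so \<open>c\<close> has a lift \<open>b \<in> B(\<complex>)\<close> close to \<open>1\<close>.  Its defect
  \<open>a = b\<^sup>-\<^sup>1 \<gamma>(b)\<close> lies in \<open>ker j\<close> and satisfies \<open>a \<gamma>(a) = 1\<close>; to first order, \<open>a\<close> is therefore
  purely imaginary.  Replacing \<open>b\<close> by \<open>b s\<close>, where \<open>s \<in> ker j\<close> is one half of \<open>a\<close> to first order,
  at least halves the imaginary part of \<open>b\<close>, so a lift whose imaginary part is minimal on a suitable
  compact set is real (\<open>real_lift_near_one\<close>).  By a similar minimisation, a real point close to \<open>1\<close> belongs
  to the identity component (\<open>real_near_one_in_I\<close>).

  Both minimisations need the following: for each small element \<open>h\<close> of an algebraic subgroup there
  is a curve from \<open>1\<close> inside the subgroup whose point at time \<open>t\<close> is \<open>t h\<close> up to an error that is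
  small compared with \<open>h\<close>, and which is real if \<open>h\<close> is (\<open>curve_in_subgroup\<close>).  This is the
  smoothness of algebraic groups in characteristic \<open>0\<close>.  It is proved in coordinates (locale
  \<open>local_group\<close>).  Let \<open>V \<subseteq> \<complex>\<^sup>n\<close> be the subgroup near its identity element \<open>0\<close>, and \<open>w\<close> a vector of its Zariski tangent space.
  If a rational function vanishes on \<open>V\<close>, then so does its derivative along the left-invariant field
  of \<open>w\<close>, and this can be iterated (\<open>lvf_derivative_vanishing\<close>).  Hence all derivatives at \<open>0\<close> of the
  equations of \<open>V\<close> along the holomorphic integral curve of the field are zero, and the
  curve stays in \<open>V\<close> (\<open>curve_in_V\<close>).  A compactness argument shows that small points of \<open>V\<close> are close
  to tangent vectors (\<open>tangent_approx\<close>).  As only rational functions are differentiated,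
  the required calculus in several complex variables reduces to one complex variable.
\<close>

section \<open>Germs of rational functions\<close>

text \<open>
  Points of \<open>\<complex>\<^sup>n\<close> are sequences of which only the first \<open>n\<close> entries
  matter, as in \<open>affine_space\<close>, because \<open>n\<close> comes from a chart and cannot be the
  cardinality of a type.
\<close>

definition csize :: "nat \<Rightarrow> (nat \<Rightarrow> complex) \<Rightarrow> real" where
  "csize n x = (\<Sum>k<n. cmod (x k))"

abbreviation cdist :: "nat \<Rightarrow> (nat \<Rightarrow> complex) \<Rightarrow> (nat \<Rightarrow> complex) \<Rightarrow> real" where
  "cdist n x y \<equiv> csize n (\<lambda>k. x k - y k)"

definition near0 :: "nat \<Rightarrow> (nat \<Rightarrow> complex) filter" where
  "near0 n = filtercomap (csize n) (nhds 0)"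

text \<open>
  Rational functions of the first \<open>n\<close> coordinates without a pole at the origin, together with their
  partial derivatives. Generating the two in parallel keeps the class visibly closed under differentiation;
  denominators only have to be nonzero at the origin, so each function is meaningful on a neighbourhood that
  depends on it.
\<close>

inductive rat_germ :: "nat \<Rightarrow> ((nat \<Rightarrow> complex) \<Rightarrow> complex) \<Rightarrow> (nat \<Rightarrow> (nat \<Rightarrow> complex) \<Rightarrow> complex) \<Rightarrow> bool"
  for n :: nat where
  const: "rat_germ n (\<lambda>x. c) (\<lambda>l x. 0)"
| coord: "k < n \<Longrightarrow> rat_germ n (\<lambda>x. x k) (\<lambda>l x. if l = k then 1 else 0)"
| add: "rat_germ n f f' \<Longrightarrow> rat_germ n g g' \<Longrightarrow> rat_germ n (\<lambda>x. f x + g x) (\<lambda>l x. f' l x + g' l x)"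
| mult: "rat_germ n f f' \<Longrightarrow> rat_germ n g g' \<Longrightarrow>
    rat_germ n (\<lambda>x. f x * g x) (\<lambda>l x. f' l x * g x + f x * g' l x)"
| inverse: "rat_germ n f f' \<Longrightarrow> f (\<lambda>_. 0) \<noteq> 0 \<Longrightarrow>
    rat_germ n (\<lambda>x. inverse (f x)) (\<lambda>l x. - 1 * (f' l x * (inverse (f x) * inverse (f x))))"

definition rat :: "nat \<Rightarrow> ((nat \<Rightarrow> complex) \<Rightarrow> complex) \<Rightarrow> bool" where
  "rat n f \<longleftrightarrow> (\<exists>f'. rat_germ n f f')"

lemma csize_nonneg [simp]: "0 \<le> csize n x"
  by (simp add: csize_def sum_nonneg)

lemma csize_zero [simp]: "csize n (\<lambda>_. 0) = 0"
  by (simp add: csize_def)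

lemma cmod_le_csize: "k < n \<Longrightarrow> cmod (x k) \<le> csize n x"
  unfolding csize_def by (rule member_le_sum) auto

lemma csize_triangle: "csize n (\<lambda>k. x k + y k) \<le> csize n x + csize n y"
  unfolding csize_def sum.distrib[symmetric] by (intro sum_mono norm_triangle_ineq)

lemma csize_triangle_diff: "csize n (\<lambda>k. x k - y k) \<le> csize n x + csize n y"
  unfolding csize_def sum.distrib[symmetric] by (intro sum_mono norm_triangle_ineq4)

lemma cdist_triangle: "cdist n x z \<le> cdist n x y + cdist n y z"
  using csize_triangle[of n "\<lambda>k. x k - y k" "\<lambda>k. y k - z k"] by simp

lemma csize_le_cdist: "csize n x \<le> cdist n x y + csize n y"
  using csize_triangle[of n "\<lambda>k. x k - y k" y] by simp

lemma cdist_commute: "cdist n x y = cdist n y x"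
  unfolding csize_def by (simp add: norm_minus_commute)

lemma csize_scale: "csize n (\<lambda>k. c * x k) = cmod c * csize n x"
  unfolding csize_def by (simp add: norm_mult sum_distrib_left)

lemma csize_cnj [simp]: "csize n (\<lambda>k. cnj (x k)) = csize n x"
  unfolding csize_def by simp

lemma csize_cong: "(\<And>k. k < n \<Longrightarrow> x k = y k) \<Longrightarrow> csize n x = csize n y"
  unfolding csize_def by simp

lemma csize_le_bound: "(\<And>k. k < n \<Longrightarrow> cmod (x k) \<le> b) \<Longrightarrow> csize n x \<le> real n * b"
  unfolding csize_def using sum_bounded_above[of "{..<n}" "\<lambda>k. cmod (x k)" b] by simp

lemma eventually_near0: "eventually P (near0 n) \<longleftrightarrow> (\<exists>d>0. \<forall>x. csize n x < d \<longrightarrow> P x)"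
proof
  assume "eventually P (near0 n)"
  then obtain Q where Q: "eventually Q (nhds (0::real))" "\<And>x. Q (csize n x) \<Longrightarrow> P x"
    unfolding near0_def eventually_filtercomap by blast
  then obtain d where "d > 0" "\<And>y. dist y 0 < d \<Longrightarrow> Q y"
    unfolding eventually_nhds_metric by blast
  then show "\<exists>d>0. \<forall>x. csize n x < d \<longrightarrow> P x"
    using Q(2) by (intro exI[of _ d]) auto
next
  assume "\<exists>d>0. \<forall>x. csize n x < d \<longrightarrow> P x"
  then obtain d where d: "d > 0" "\<And>x. csize n x < d \<Longrightarrow> P x" by blast
  have "eventually (\<lambda>y. y < d) (nhds (0::real))"
    using d(1) by (intro eventually_nhds_in_open[of "{..<d}", simplified]) auto
  then show "eventually P (near0 n)"
    unfolding near0_def eventually_filtercomap using d(2) by blast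
qed

lemma near0E:
  assumes "eventually P (near0 n)"
  obtains d where "d > 0" "\<And>x. csize n x < d \<Longrightarrow> P x"
  using assms unfolding eventually_near0 by auto

lemma eventually_near0_zero: "eventually P (near0 n) \<Longrightarrow> P (\<lambda>_. 0)"
  unfolding eventually_near0 by auto

lemma rat_const: "rat n (\<lambda>x. c)"
  and rat_coord: "k < n \<Longrightarrow> rat n (\<lambda>x. x k)"
  and rat_add: "rat n f \<Longrightarrow> rat n g \<Longrightarrow> rat n (\<lambda>x. f x + g x)"
  and rat_mult: "rat n f \<Longrightarrow> rat n g \<Longrightarrow> rat n (\<lambda>x. f x * g x)"
  and rat_inverse: "rat n f \<Longrightarrow> f (\<lambda>_. 0) \<noteq> 0 \<Longrightarrow> rat n (\<lambda>x. inverse (f x))"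
  unfolding rat_def
  by (blast intro: rat_germ.const rat_germ.coord rat_germ.add rat_germ.mult rat_germ.inverse)+

lemma rat_divide: "rat n f \<Longrightarrow> rat n g \<Longrightarrow> g (\<lambda>_. 0) \<noteq> 0 \<Longrightarrow> rat n (\<lambda>x. f x / g x)"
  using rat_mult[of n f "\<lambda>x. inverse (g x)"] rat_inverse[of n g] by (simp add: divide_inverse)

lemma rat_diff: "rat n f \<Longrightarrow> rat n g \<Longrightarrow> rat n (\<lambda>x. f x - g x)"
  using rat_add[of n f "\<lambda>x. -1 * g x"] rat_mult[of n "\<lambda>x. -1" g] by (simp add: rat_const)

lemma rat_sum: "(\<And>k. k \<in> K \<Longrightarrow> rat n (f k)) \<Longrightarrow> rat n (\<lambda>x. \<Sum>k\<in>K. f k x)"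
  by (induction K rule: infinite_finite_induct) (simp_all add: rat_const rat_add)

lemma rat_germ_imp_rat: "rat_germ n f f' \<Longrightarrow> rat n f"
  unfolding rat_def by blast

lemma rat_germ_partial: "rat_germ n f f' \<Longrightarrow> rat n (f' l)"
proof (induction rule: rat_germ.induct)
  case (coord k) show ?case by (cases "l = k") (simp_all add: rat_const)
next
  case (mult f f' g g')
  then show ?case by (intro rat_add rat_mult) (auto dest: rat_germ_imp_rat)
next
  case (inverse f f')
  then show ?case by (intro rat_mult rat_const rat_inverse) (auto dest: rat_germ_imp_rat)
qed (auto intro: rat_const rat_add)

lemma rat_continuous: "rat n f \<Longrightarrow> (f \<longlongrightarrow> f (\<lambda>_. 0)) (near0 n)"
  unfolding rat_def
proof (elim exE)
  fix f' assume "rat_germ n f f'"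
  then show ?thesis
  proof (induction rule: rat_germ.induct)
    case (coord k)
    show ?case
      unfolding tendsto_iff eventually_near0
    proof (intro allI impI)
      fix e :: real assume "e > 0"
      then show "\<exists>d>0. \<forall>x. csize n x < d \<longrightarrow> dist (x k) 0 < e"
        using cmod_le_csize[OF coord] by (intro exI[of _ e]) (auto intro: le_less_trans)
    qed
  next
    case (inverse f f')
    then show ?case by (intro tendsto_inverse)
  qed (simp_all add: tendsto_add tendsto_mult)
qed

lemma rat_eventually_nonzero: "rat n f \<Longrightarrow> f (\<lambda>_. 0) \<noteq> 0 \<Longrightarrow> eventually (\<lambda>x. f x \<noteq> 0) (near0 n)"
  using rat_continuous tendsto_imp_eventually_ne by blast

text \<open>
  Differentiability tested on curves in one complex variable, the only form in which it is used.
\<close>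

definition has_gradient :: "nat \<Rightarrow> ((nat \<Rightarrow> complex) \<Rightarrow> complex) \<Rightarrow> (nat \<Rightarrow> complex) \<Rightarrow> (nat \<Rightarrow> complex) \<Rightarrow> bool" where
  "has_gradient n f d x \<longleftrightarrow> (\<forall>c c' z. (\<forall>k. c z k = x k) \<longrightarrow>
     (\<forall>k<n. ((\<lambda>z. c z k) has_field_derivative c' k) (at z)) \<longrightarrow>
     ((\<lambda>z. f (c z)) has_field_derivative (\<Sum>k<n. d k * c' k)) (at z))"

lemma has_gradientD:
  assumes "has_gradient n f d x" "\<And>k. c z k = x k"
    and "\<And>k. k < n \<Longrightarrow> ((\<lambda>z. c z k) has_field_derivative c' k) (at z)"
  shows "((\<lambda>z. f (c z)) has_field_derivative (\<Sum>k<n. d k * c' k)) (at z)"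
  using assms unfolding has_gradient_def by simp

text \<open>
  The partial derivatives deserve their name. The neighbourhood comes from the denominators.
\<close>

lemma rat_germ_chain:
  "rat_germ n f f' \<Longrightarrow> eventually (\<lambda>x. has_gradient n f (\<lambda>k. f' k x) x) (near0 n)"
  unfolding has_gradient_def
proof (induction rule: rat_germ.induct)
  case (const c)
  show ?case by (simp add: always_eventually)
next
  case (coord k)
  have "(\<Sum>l<n. (if l = k then 1 else 0) * c' l) = (c' k :: complex)" for c'
    using coord by (simp add: if_distrib[of "\<lambda>x. x * _"] cong: if_cong)
  then show ?case using coord by (simp add: always_eventually)
next
  case (add f f' g g')
  from add.IH show ?case
  proof (rule eventually_elim2, intro allI impI, goal_cases)
    case (1 x c c' z)
    have "((\<lambda>z. f (c z) + g (c z)) has_field_derivative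
        (\<Sum>k<n. f' k x * c' k) + (\<Sum>k<n. g' k x * c' k)) (at z)"
      using 1 by (intro DERIV_add) auto
    then show ?case by (simp add: sum.distrib algebra_simps)
  qed
next
  case (mult f f' g g')
  from mult.IH show ?case
  proof (rule eventually_elim2, intro allI impI, goal_cases)
    case (1 x c c' z)
    have [simp]: "c z = x" using 1 by auto
    have "((\<lambda>z. f (c z) * g (c z)) has_field_derivative
        (\<Sum>k<n. f' k x * c' k) * g (c z) + (\<Sum>k<n. g' k x * c' k) * f (c z)) (at z)"
      using 1 by (intro DERIV_mult) auto
    then show ?case by (simp add: sum.distrib sum_distrib_left sum_distrib_right algebra_simps)
  qed
next
  case (inverse f f')
  have "eventually (\<lambda>x. f x \<noteq> 0) (near0 n)"
    using inverse rat_eventually_nonzero rat_germ_imp_rat by blast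
  with inverse.IH show ?case
  proof (rule eventually_elim2, intro allI impI, goal_cases)
    case (1 x c c' z)
    have [simp]: "c z = x" using 1 by auto
    have "((\<lambda>z. inverse (f (c z))) has_field_derivative
        - (inverse (f (c z)) * (\<Sum>k<n. f' k x * c' k) * inverse (f (c z)))) (at z)"
      using 1 by (intro DERIV_inverse') auto
    then show ?case by (simp add: sum_distrib_left sum_distrib_right sum_negf algebra_simps)
  qed
qed

lemma rat_local:
  assumes "rat n f" "\<And>k. k < n \<Longrightarrow> x k = y k"
  shows "f x = f y"
proof -
  from assms(1) obtain f' where "rat_germ n f f'" unfolding rat_def by blast
  then show ?thesis using assms(2) by (induction rule: rat_germ.induct) auto
qed

lemma rat_cnj:
  assumes "rat n f"
  shows "rat n (\<lambda>x. cnj (f (\<lambda>k. cnj (x k))))"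
proof -
  from assms obtain f' where "rat_germ n f f'" unfolding rat_def by blast
  then show ?thesis
  proof (induction rule: rat_germ.induct)
    case (inverse f f')
    then show ?case
      unfolding complex_cnj_inverse by (intro rat_inverse) simp_all
  qed (simp_all add: rat_const rat_coord rat_add rat_mult)
qed

text \<open>
  The functions \<open>s k\<close> need not vanish at the origin, only take a small value \<open>y\<close>
  there. This covers the right multiplication \<open>y \<mapsto> x y\<close> by points near a fixed small
  \<open>x\<close>.
\<close>

lemma rat_subst:
  assumes "rat m f"
  shows "eventually (\<lambda>y. \<forall>n s. (\<forall>k<m. rat n (\<lambda>x. s x k)) \<longrightarrow> (\<forall>k. s (\<lambda>_. 0) k = y k) \<longrightarrow>
           rat n (\<lambda>x. f (s x))) (near0 m)"
proof -
  from assms obtain f' where "rat_germ m f f'" unfolding rat_def by blast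
  then show ?thesis
  proof (induction rule: rat_germ.induct)
    case (add f f' g g')
    from add.IH show ?case by (rule eventually_elim2) (intro allI impI rat_add, blast+)
  next
    case (mult f f' g g')
    from mult.IH show ?case by (rule eventually_elim2) (intro allI impI rat_mult, blast+)
  next
    case (inverse f f')
    have "eventually (\<lambda>x. f x \<noteq> 0) (near0 m)"
      using inverse rat_eventually_nonzero rat_germ_imp_rat by blast
    with inverse.IH show ?case
    proof (rule eventually_elim2, intro allI impI, goal_cases)
      case (1 y n s)
      have "s (\<lambda>_. 0) = y" using 1 by auto
      then show ?case using 1 by (intro rat_inverse) simp_all
    qed
  qed (simp_all add: always_eventually rat_const)
qed

text \<open>
  The mean value inequality on the segment from \<open>y\<close> to \<open>x\<close> for \<open>f\<close> minus
  its linear part at the origin; the gradient of the difference is small there by continuity of the partial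
  derivatives.
\<close>

lemma rat_germ_strict:
  assumes "rat_germ n f f'" "e > 0"
  shows "\<exists>d>0. \<forall>x y. csize n x < d \<longrightarrow> csize n y < d \<longrightarrow>
    cmod (f x - f y - (\<Sum>k<n. f' k (\<lambda>_. 0) * (x k - y k))) \<le> e * cdist n x y"
proof -
  have "eventually (\<lambda>x. cmod (f' k x - f' k (\<lambda>_. 0)) < e) (near0 n)" for k
    using rat_continuous[OF rat_germ_partial[OF assms(1), of k]] assms(2)
    by (simp add: tendsto_iff dist_norm)
  then have "eventually (\<lambda>x. \<forall>k\<in>{..<n}. cmod (f' k x - f' k (\<lambda>_. 0)) < e) (near0 n)"
    by (simp add: eventually_ball_finite)
  then obtain d1 where d1: "d1 > 0"
    "\<And>x. csize n x < d1 \<Longrightarrow> \<forall>k\<in>{..<n}. cmod (f' k x - f' k (\<lambda>_. 0)) < e"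
    by (rule near0E) (rule that)
  obtain d2 where d2: "d2 > 0"
    "\<And>x. csize n x < d2 \<Longrightarrow> has_gradient n f (\<lambda>k. f' k x) x"
    using rat_germ_chain[OF assms(1)] by (rule near0E) (rule that)
  define d where "d = min d1 d2"
  have d: "d > 0" using d1(1) d2(1) by (simp add: d_def)
  have d_partial: "cmod (f' k x - f' k (\<lambda>_. 0)) < e" if "csize n x < d" "k < n" for x k
    using d1(2)[of x] that by (simp add: d_def)
  have d_chain: "((\<lambda>z. f (c z)) has_field_derivative (\<Sum>k<n. f' k (c z) * c' k)) (at z)"
    if "csize n (c z) < d" "\<And>k. k < n \<Longrightarrow> ((\<lambda>z. c z k) has_field_derivative c' k) (at z)" for c c' z
    by (rule has_gradientD[OF d2(2)]) (use that in \<open>auto simp: d_def\<close>)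
  show ?thesis
  proof (intro exI[of _ d] conjI allI impI d)
    fix x y assume xy: "csize n x < d" "csize n y < d"
    define c where "c = (\<lambda>z::complex. \<lambda>k. y k + z * (x k - y k))"
    define L where "L = (\<lambda>k. f' k (\<lambda>_. 0))"
    define h where "h = (\<lambda>z. f (c z) - z * (\<Sum>k<n. L k * (x k - y k)))"
    have small: "csize n (c z) < d" if z: "z \<in> closed_segment 0 1" for z :: complex
    proof -
      obtain u where u: "0 \<le> u" "u \<le> 1" "z = of_real u"
        using z unfolding closed_segment_def by (auto simp: scaleR_conv_of_real)
      have "csize n (c z) = csize n (\<lambda>k. of_real (1-u) * y k + of_real u * x k)"
        unfolding c_def u by (intro csize_cong) (simp add: algebra_simps)
      also have "\<dots> \<le> (1-u) * csize n y + u * csize n x"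
        using csize_triangle[of n "\<lambda>k. of_real (1-u) * y k" "\<lambda>k. of_real u * x k"] u
        unfolding csize_scale by (simp del: of_real_diff)
      also have "\<dots> \<le> (1-u) * max (csize n x) (csize n y) + u * max (csize n x) (csize n y)"
        using u by (intro add_mono mult_left_mono) auto
      also have "\<dots> < d" using xy by (simp add: algebra_simps)
      finally show ?thesis .
    qed
    have der: "(h has_field_derivative (\<Sum>k<n. (f' k (c z) - L k) * (x k - y k))) (at z within closed_segment 0 1)"
      if z: "z \<in> closed_segment 0 1" for z
    proof -
      have "((\<lambda>z. f (c z)) has_field_derivative (\<Sum>k<n. f' k (c z) * (x k - y k))) (at z)"
        using small[OF z] by (rule d_chain) (auto simp: c_def intro!: derivative_eq_intros)
      then have "(h has_field_derivative (\<Sum>k<n. f' k (c z) * (x k - y k)) - (\<Sum>k<n. L k * (x k - y k))) (at z)"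
        unfolding h_def by (auto intro!: derivative_eq_intros)
      then show ?thesis
        by (simp add: left_diff_distrib sum_subtractf has_field_derivative_at_within)
    qed
    have bound: "cmod (\<Sum>k<n. (f' k (c z) - L k) * (x k - y k)) \<le> e * cdist n x y"
      if z: "z \<in> closed_segment 0 1" for z
    proof -
      have "cmod (\<Sum>k<n. (f' k (c z) - L k) * (x k - y k)) \<le> (\<Sum>k<n. e * cmod (x k - y k))"
        using less_imp_le[OF d_partial[OF small[OF z]]] unfolding L_def
        by (intro sum_norm_le) (auto simp: norm_mult intro!: mult_right_mono)
      then show ?thesis by (simp add: csize_def sum_distrib_left)
    qed
    have "cmod (h 1 - h 0) \<le> e * cdist n x y * cmod (1 - 0)"
      using der bound by (intro field_differentiable_bound[where S = "closed_segment 0 1"]) auto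
    then show "cmod (f x - f y - (\<Sum>k<n. f' k (\<lambda>_. 0) * (x k - y k))) \<le> e * cdist n x y"
      by (simp add: h_def c_def L_def algebra_simps)
  qed
qed

lemma rat_lipschitz:
  assumes "rat n f"
  shows "\<exists>K\<ge>0. \<exists>d>0. \<forall>x y. csize n x < d \<longrightarrow> csize n y < d \<longrightarrow> cmod (f x - f y) \<le> K * cdist n x y"
proof -
  obtain f' where f': "rat_germ n f f'" using assms unfolding rat_def by blast
  obtain d where d: "d > 0" "\<And>x y. csize n x < d \<Longrightarrow> csize n y < d \<Longrightarrow>
    cmod (f x - f y - (\<Sum>k<n. f' k (\<lambda>_. 0) * (x k - y k))) \<le> 1 * cdist n x y"
    using rat_germ_strict[OF f', of 1] by auto
  define K where "K = (\<Sum>k<n. cmod (f' k (\<lambda>_. 0)))"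
  have "cmod (f x - f y) \<le> (1 + K) * cdist n x y" if "csize n x < d" "csize n y < d" for x y
  proof -
    have "cmod (\<Sum>k<n. f' k (\<lambda>_. 0) * (x k - y k)) \<le> (\<Sum>k<n. cmod (f' k (\<lambda>_. 0)) * cdist n x y)"
      using cmod_le_csize[of _ n "\<lambda>k. x k - y k"]
      by (intro sum_norm_le) (auto simp: norm_mult intro!: mult_left_mono)
    then have "cmod (\<Sum>k<n. f' k (\<lambda>_. 0) * (x k - y k)) \<le> K * cdist n x y"
      by (simp add: K_def sum_distrib_right)
    then show ?thesis
      using d(2)[OF that] norm_triangle_sub[of "f x - f y" "\<Sum>k<n. f' k (\<lambda>_. 0) * (x k - y k)"]
      by (simp add: algebra_simps)
  qed
  moreover have "K \<ge> 0" unfolding K_def by (intro sum_nonneg) auto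
  ultimately show ?thesis using d(1) by (intro exI[of _ "1+K"]) auto
qed

section \<open>Holomorphic integral curves\<close>

abbreviation disc2 :: "complex set" where "disc2 \<equiv> ball 0 2"

text \<open>
  The properties of a rational germ used by Picard iteration, on a radius common to all coefficients of a vector
  field.
\<close>

definition tame :: "nat \<Rightarrow> ((nat \<Rightarrow> complex) \<Rightarrow> complex) \<Rightarrow> real \<Rightarrow> real \<Rightarrow> bool" where
  "tame n f K d \<longleftrightarrow> (\<forall>x. csize n x < d \<longrightarrow> cmod (f x) \<le> K) \<and>
    (\<forall>x y. csize n x < d \<longrightarrow> csize n y < d \<longrightarrow> cmod (f x - f y) \<le> K * cdist n x y) \<and>
    (\<forall>c z. csize n (c z) < d \<longrightarrow> (\<forall>k<n. (\<lambda>z. c z k) field_differentiable at z) \<longrightarrow>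
       (\<lambda>z. f (c z)) field_differentiable at z)"

lemma tame_mono:
  assumes "tame n f K d" "K \<le> K'" "d' \<le> d"
  shows "tame n f K' d'"
proof -
  have "cmod (f x - f y) \<le> K' * cdist n x y" if "csize n x < d'" "csize n y < d'" for x y
  proof -
    have "cmod (f x - f y) \<le> K * cdist n x y" using assms that unfolding tame_def by auto
    also have "\<dots> \<le> K' * cdist n x y" using assms by (intro mult_right_mono) auto
    finally show ?thesis .
  qed
  moreover have "cmod (f x) \<le> K'" if "csize n x < d'" for x
    using assms that unfolding tame_def by (meson less_le_trans order_trans)
  moreover have "(\<lambda>z. f (c z)) field_differentiable at z"
    if "csize n (c z) < d'" "\<forall>k<n. (\<lambda>z. c z k) field_differentiable at z" for c z
    using assms that unfolding tame_def by (meson less_le_trans)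
  ultimately show ?thesis unfolding tame_def by simp
qed

lemma rat_tame:
  assumes "rat n f"
  shows "\<exists>K>0. \<exists>d>0. tame n f K d"
proof -
  obtain f' where f': "rat_germ n f f'" using assms unfolding rat_def by blast
  obtain K2 d2 where 2: "K2 \<ge> 0" "d2 > 0"
    "\<And>x y. csize n x < d2 \<Longrightarrow> csize n y < d2 \<Longrightarrow> cmod (f x - f y) \<le> K2 * cdist n x y"
    using rat_lipschitz[OF assms] by blast
  obtain d3 where 3: "d3 > 0"
    "\<And>x. csize n x < d3 \<Longrightarrow> has_gradient n f (\<lambda>k. f' k x) x"
    using rat_germ_chain[OF f'] by (rule near0E) (rule that)
  define K where "K = 1 + K2 + K2 * d2 + cmod (f (\<lambda>_. 0))"
  define d where "d = min d2 d3"
  have K: "K > 0" "K2 \<le> K" using 2 by (auto simp: K_def add_pos_nonneg)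
  have d: "d > 0" "d \<le> d2" "d \<le> d3" using 2 3 by (auto simp: d_def)
  have lip: "cmod (f x - f y) \<le> K * cdist n x y" if "csize n x < d" "csize n y < d" for x y
  proof -
    have "cmod (f x - f y) \<le> K2 * cdist n x y" using that d by (intro 2(3)) auto
    also have "\<dots> \<le> K * cdist n x y" using K by (intro mult_right_mono) auto
    finally show ?thesis .
  qed
  have bound: "cmod (f x) \<le> K" if "csize n x < d" for x
  proof -
    have "cmod (f x - f (\<lambda>_. 0)) \<le> K2 * cdist n x (\<lambda>_. 0)"
      using that d 2 by (intro 2(3)) auto
    also have "\<dots> \<le> K2 * d2"
      using that d 2(1) by (intro mult_left_mono) auto
    finally show ?thesis
      using norm_triangle_sub[of "f x" "f (\<lambda>_. 0)"] 2(1) by (simp add: K_def)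
  qed
  have diffble: "(\<lambda>z. f (c z)) field_differentiable at z"
    if "csize n (c z) < d" "\<forall>k<n. (\<lambda>z. c z k) field_differentiable at z" for c z
  proof -
    from that(2) obtain c' where "\<forall>k<n. ((\<lambda>z. c z k) has_field_derivative c' k) (at z)"
      unfolding field_differentiable_def by metis
    moreover have "csize n (c z) < d3" using that(1) d(3) by simp
    ultimately have "((\<lambda>z. f (c z)) has_field_derivative (\<Sum>k<n. f' k (c z) * c' k)) (at z)"
      using has_gradientD[OF 3(2)[of "c z"], of c z c'] by simp
    then show ?thesis unfolding field_differentiable_def by blast
  qed
  have "tame n f K d" unfolding tame_def using lip bound diffble by auto
  then show ?thesis using K d by blast
qed

lemma rat_family_tame:
  assumes "finite I" "\<And>i. i \<in> I \<Longrightarrow> rat n (f i)"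
  shows "\<exists>K>0. \<exists>d>0. \<forall>i\<in>I. tame n (f i) K d"
  using assms
proof (induction I rule: finite_induct)
  case empty
  show ?case by (simp add: exI[of _ "1::real"])
next
  case (insert i I)
  then obtain K1 d1 where 1: "K1 > 0" "d1 > 0" "\<forall>i\<in>I. tame n (f i) K1 d1" by auto
  obtain K2 d2 where 2: "K2 > 0" "d2 > 0" "tame n (f i) K2 d2"
    using rat_tame[of n "f i"] insert.prems by auto
  show ?case
    using 1 2 tame_mono[of n _ _ _ "max K1 K2" "min d1 d2"]
    by (intro exI[of _ "max K1 K2"] conjI exI[of _ "min d1 d2"]) auto
qed

lemma bounded_derivative_disc2:
  assumes "\<And>z. z \<in> disc2 \<Longrightarrow> (h has_field_derivative h' z) (at z)"
    and "\<And>z. z \<in> disc2 \<Longrightarrow> cmod (h' z) \<le> B" "h 0 = 0" "z \<in> disc2"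
  shows "cmod (h z) \<le> B * cmod z"
proof -
  have "cmod (h z - h 0) \<le> B * cmod (z - 0)"
    using assms
    by (intro field_differentiable_bound[where S = disc2 and f' = h']) (auto intro: has_field_derivative_at_within)
  then show ?thesis using assms(3) by simp
qed

lemma bounded_derivative_csize:
  assumes "\<And>k z. k < n \<Longrightarrow> z \<in> disc2 \<Longrightarrow> ((\<lambda>z. h z k) has_field_derivative h' k z) (at z)"
    and "\<And>k z. k < n \<Longrightarrow> z \<in> disc2 \<Longrightarrow> cmod (h' k z) \<le> B" "\<And>k. k < n \<Longrightarrow> h 0 k = 0" "z \<in> disc2"
    "B \<ge> 0"
  shows "csize n (h z) \<le> real n * (2 * B)"
proof (rule csize_le_bound)
  fix k assume k: "k < n"
  have "cmod (h z k) \<le> B * cmod z"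
    using bounded_derivative_disc2[of "\<lambda>z. h z k" "h' k" B z] assms k by blast
  also have "\<dots> \<le> B * 2"
    using assms by (intro mult_left_mono) auto
  finally show "cmod (h z k) \<le> 2 * B" by simp
qed

lemma disc2_primitive:
  assumes "f holomorphic_on disc2"
  shows "\<exists>h. h 0 = 0 \<and> (\<forall>z\<in>disc2. (h has_field_derivative f z) (at z))"
proof -
  obtain h where h: "\<forall>z\<in>disc2. (h has_field_derivative f z) (at z within disc2)"
    using assms by (metis holomorphic_convex_primitive'[of disc2 f] convex_ball open_ball)
  have "((\<lambda>z. h z - h 0) has_field_derivative f z) (at z)" if "z \<in> disc2" for z
  proof -
    have "(h has_field_derivative f z) (at z)"
      using h that at_within_open[OF that open_ball] by metis
    from DERIV_diff[OF this DERIV_const[of "h 0"]] show ?thesis by simp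
  qed
  then show ?thesis by (intro exI[of _ "\<lambda>z. h z - h 0"]) auto
qed

text \<open>
  The vector fields \<open>x \<mapsto> \<Sum>\<^sub>l w\<^sub>l g\<^sub>k\<^sub>l(x)\<close> depend linearly on
  the parameter \<open>w\<close>. For small \<open>w\<close> they have integral curves from the origin for all
  times in a fixed disc. Its radius \<open>2\<close> leaves the unit interval in the interior.
\<close>

locale rat_field =
  fixes n :: nat and g :: "nat \<Rightarrow> nat \<Rightarrow> (nat \<Rightarrow> complex) \<Rightarrow> complex" and K \<eta> :: real
  assumes K_pos: "K > 0" and eta_pos: "\<eta> > 0"
    and g_bound: "k < n \<Longrightarrow> l < n \<Longrightarrow> csize n x < \<eta> \<Longrightarrow> cmod (g k l x) \<le> K"
    and g_lip: "k < n \<Longrightarrow> l < n \<Longrightarrow> csize n x < \<eta> \<Longrightarrow> csize n y < \<eta> \<Longrightarrow>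
      cmod (g k l x - g k l y) \<le> K * cdist n x y"
    and g_diff: "k < n \<Longrightarrow> l < n \<Longrightarrow> csize n (c z) < \<eta> \<Longrightarrow>
      (\<And>k. k < n \<Longrightarrow> (\<lambda>z. c z k) field_differentiable at z) \<Longrightarrow>
      (\<lambda>z. g k l (c z)) field_differentiable at z"
begin

definition vf :: "(nat \<Rightarrow> complex) \<Rightarrow> (nat \<Rightarrow> complex) \<Rightarrow> nat \<Rightarrow> complex" where
  "vf w x k = (\<Sum>l<n. w l * g k l x)"

definition integral_curve :: "(nat \<Rightarrow> complex) \<Rightarrow> (complex \<Rightarrow> nat \<Rightarrow> complex) \<Rightarrow> bool" where
  "integral_curve w c \<longleftrightarrow> (\<forall>k<n. c 0 k = 0) \<and>
     (\<forall>z\<in>disc2. csize n (c z) < \<eta> \<and> (\<forall>k<n. ((\<lambda>z. c z k) has_field_derivative vf w (c z) k) (at z)))"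

text \<open>
  Below this size of \<open>w\<close>, the Picard map sends curves in the ball of radius \<open>\<eta>\<close>
  to such curves and halves their distances.
\<close>

definition small_radius :: real where
  "small_radius = min 1 \<eta> / (4 * real n * K + 4 * K + 4)"

lemma small_radius:
  assumes "csize n w < small_radius"
  shows "real n * (2 * (csize n w * K)) < \<eta>" "real n * (2 * (csize n w * K)) \<le> 1/2"
proof -
  have pos: "4 * real n * K + 4 * K + 4 > 0" using K_pos by (simp add: add_nonneg_pos)
  have "csize n w * (4 * real n * K + 4 * K + 4) < min 1 \<eta>"
    using assms pos unfolding small_radius_def by (simp add: pos_less_divide_eq)
  then have "csize n w * (4 * real n * K) < min 1 \<eta> - csize n w * (4 * K + 4)"
    by (simp add: algebra_simps)
  moreover have "0 \<le> csize n w * (4 * K + 4)" using K_pos by simp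
  ultimately have "2 * (real n * (2 * (csize n w * K))) < min 1 \<eta>"
    by (simp add: algebra_simps)
  moreover have "0 \<le> real n * (2 * (csize n w * K))" using K_pos by simp
  ultimately show "real n * (2 * (csize n w * K)) < \<eta>" "real n * (2 * (csize n w * K)) \<le> 1/2"
    by linarith+
qed

lemma small_radius_pos: "small_radius > 0"
  using K_pos eta_pos unfolding small_radius_def by (intro divide_pos_pos) (auto simp: add_nonneg_pos)

lemma vf_bound: "k < n \<Longrightarrow> csize n x < \<eta> \<Longrightarrow> cmod (vf w x k) \<le> csize n w * K"
  unfolding vf_def csize_def[of n w] sum_distrib_right
  by (intro sum_norm_le) (auto simp: norm_mult intro!: mult_left_mono g_bound)

lemma vf_lip:
  assumes "k < n" "csize n x < \<eta>" "csize n y < \<eta>"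
  shows "cmod (vf w x k - vf w y k) \<le> csize n w * K * cdist n x y"
proof -
  have "cmod (\<Sum>l<n. w l * (g k l x - g k l y)) \<le> (\<Sum>l<n. cmod (w l) * (K * cdist n x y))"
    using assms by (intro sum_norm_le) (auto simp: norm_mult intro!: mult_left_mono g_lip)
  then show ?thesis
    by (simp add: vf_def csize_def[of n w] sum_distrib_right sum_subtractf right_diff_distrib mult.assoc)
qed

text \<open>
  On the disc, the distance of two solutions is at most half of itself. Uniqueness is what makes the curves of
  real parameters real.
\<close>

lemma integral_curve_unique:
  assumes w: "csize n w < small_radius"
    and c: "integral_curve w c" "integral_curve w c'" and "z \<in> disc2" "k < n"
  shows "c z k = c' z k"
proof -
  have step: "\<forall>z\<in>disc2. cdist n (c z) (c' z) \<le> B / 2"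
    if B: "\<forall>z\<in>disc2. cdist n (c z) (c' z) \<le> B" for B
  proof
    fix z assume z: "z \<in> disc2"
    have B0: "B \<ge> 0" using B z csize_nonneg order_trans by blast
    have "csize n ((\<lambda>z k. c z k - c' z k) z) \<le> real n * (2 * (csize n w * K * B))"
    proof (rule bounded_derivative_csize[OF _ _ _ z])
      fix k z assume k: "k < n" and z: "z \<in> disc2"
      show "((\<lambda>z. c z k - c' z k) has_field_derivative vf w (c z) k - vf w (c' z) k) (at z)"
        using c k z unfolding integral_curve_def by (intro DERIV_diff) auto
      have "cmod (vf w (c z) k - vf w (c' z) k) \<le> csize n w * K * cdist n (c z) (c' z)"
        using c k z unfolding integral_curve_def by (intro vf_lip) auto
      also have "\<dots> \<le> csize n w * K * B"
        using B z K_pos by (intro mult_left_mono) auto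
      finally show "cmod (vf w (c z) k - vf w (c' z) k) \<le> csize n w * K * B" .
    qed (use c B0 K_pos in \<open>auto simp: integral_curve_def\<close>)
    also have "\<dots> = real n * (2 * (csize n w * K)) * B" by simp
    also have "\<dots> \<le> 1/2 * B" using small_radius(2)[OF w] B0 by (rule mult_right_mono)
    finally show "cdist n (c z) (c' z) \<le> B / 2" by simp
  qed
  have iter: "\<forall>z\<in>disc2. cdist n (c z) (c' z) \<le> 2 * \<eta> / 2 ^ m" for m
  proof (induction m)
    case 0
    have "cdist n (c z) (c' z) \<le> 2 * \<eta>" if "z \<in> disc2" for z
    proof -
      have "csize n (c z) < \<eta>" "csize n (c' z) < \<eta>" using c that by (auto simp: integral_curve_def)
      then show ?thesis using csize_triangle_diff[of n "c z" "c' z"] by linarith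
    qed
    then show ?case by simp
  next
    case (Suc m)
    from step[OF Suc] show ?case by (simp add: field_simps)
  qed
  have "(\<lambda>m. 2 * \<eta> / 2 ^ m) \<longlonglongrightarrow> 0"
    using LIMSEQ_divide_realpow_zero[of 2 "2 * \<eta>"] by simp
  then have "cdist n (c z) (c' z) \<le> 0"
    using iter assms(4) by (intro LIMSEQ_le_const[of _ 0 "cdist n (c z) (c' z)"]) auto
  then have "cmod (c z k - c' z k) \<le> 0"
    using cmod_le_csize[OF \<open>k < n\<close>, of "\<lambda>k. c z k - c' z k"] by linarith
  then show ?thesis by simp
qed

definition picard :: "(nat \<Rightarrow> complex) \<Rightarrow> (complex \<Rightarrow> nat \<Rightarrow> complex) \<Rightarrow> complex \<Rightarrow> nat \<Rightarrow> complex" where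
  "picard w c z k = (if k < n then (SOME h. h 0 = 0 \<and>
     (\<forall>z\<in>disc2. (h has_field_derivative vf w (c z) k) (at z))) z else 0)"

definition admissible :: "(complex \<Rightarrow> nat \<Rightarrow> complex) \<Rightarrow> bool" where
  "admissible c \<longleftrightarrow> (\<forall>z\<in>disc2. csize n (c z) < \<eta> \<and> (\<forall>k<n. (\<lambda>z. c z k) field_differentiable at z))"

lemma picard:
  assumes "admissible c" "k < n"
  shows "picard w c 0 k = 0"
    and "z \<in> disc2 \<Longrightarrow> ((\<lambda>z. picard w c z k) has_field_derivative vf w (c z) k) (at z)"
proof -
  have "(\<lambda>z. vf w (c z) k) field_differentiable at z" if "z \<in> disc2" for z
    unfolding vf_def using assms that unfolding admissible_def
    by (intro derivative_intros g_diff) auto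
  then have "(\<lambda>z. vf w (c z) k) holomorphic_on disc2"
    by (auto simp: holomorphic_on_def intro: field_differentiable_at_within)
  from someI_ex[OF disc2_primitive[OF this]] assms(2)
  show "picard w c 0 k = 0"
    and "z \<in> disc2 \<Longrightarrow> ((\<lambda>z. picard w c z k) has_field_derivative vf w (c z) k) (at z)"
    unfolding picard_def by auto
qed

lemma picard_admissible:
  assumes "admissible c" "csize n w < small_radius"
  shows "admissible (picard w c)" and "z \<in> disc2 \<Longrightarrow> csize n (picard w c z) \<le> real n * (2 * (csize n w * K))"
proof -
  show b: "csize n (picard w c z) \<le> real n * (2 * (csize n w * K))" if "z \<in> disc2" for z
    by (rule bounded_derivative_csize[OF picard(2)[OF assms(1)]])
       (use assms(1) that K_pos in \<open>auto simp: picard(1)[OF assms(1)] admissible_def intro!: vf_bound\<close>)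
  show "admissible (picard w c)"
    unfolding admissible_def
  proof (intro ballI conjI allI impI)
    fix z k assume z: "z \<in> disc2"
    show "csize n (picard w c z) < \<eta>"
      using b[OF z] small_radius(1)[OF assms(2)] by linarith
    assume "k < n"
    then show "(\<lambda>z. picard w c z k) field_differentiable at z"
      using picard(2)[OF assms(1) _ z] unfolding field_differentiable_def by blast
  qed
qed

lemma picard_contract:
  assumes c: "admissible c" "admissible c'" and w: "csize n w < small_radius"
    and B: "\<And>z. z \<in> disc2 \<Longrightarrow> cdist n (c z) (c' z) \<le> B" and z: "z \<in> disc2"
  shows "cdist n (picard w c z) (picard w c' z) \<le> B / 2"
proof -
  have B0: "B \<ge> 0" using B[OF z] csize_nonneg order_trans by blast
  have "csize n ((\<lambda>z k. picard w c z k - picard w c' z k) z) \<le> real n * (2 * (csize n w * K * B))"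
  proof (rule bounded_derivative_csize[OF _ _ _ z])
    fix k z assume k: "k < n" and z: "z \<in> disc2"
    show "((\<lambda>z. picard w c z k - picard w c' z k) has_field_derivative vf w (c z) k - vf w (c' z) k) (at z)"
      using c k z by (intro DERIV_diff picard) auto
    have "cmod (vf w (c z) k - vf w (c' z) k) \<le> csize n w * K * cdist n (c z) (c' z)"
      using c k z unfolding admissible_def by (intro vf_lip) auto
    also have "\<dots> \<le> csize n w * K * B"
      using B z K_pos by (intro mult_left_mono) auto
    finally show "cmod (vf w (c z) k - vf w (c' z) k) \<le> csize n w * K * B" .
  qed (use c B0 K_pos in \<open>auto simp: picard\<close>)
  also have "\<dots> = real n * (2 * (csize n w * K)) * B" by simp
  also have "\<dots> \<le> 1/2 * B" using small_radius(2)[OF w] B0 by (rule mult_right_mono)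
  finally show ?thesis by simp
qed

text \<open>
  All Picard iterates are holomorphic and converge uniformly by the contraction estimate, so the limit is
  holomorphic and the derivatives converge too.
\<close>

lemma integral_curve_exists:
  assumes w: "csize n w < small_radius"
  shows "\<exists>c. integral_curve w c \<and> (\<forall>z\<in>disc2. csize n (c z) \<le> real n * (2 * (csize n w * K))) \<and>
    (\<forall>z. \<forall>k\<ge>n. c z k = 0)"
proof -
  define C where "C = (\<lambda>m. (picard w ^^ m) (\<lambda>z k. 0))"
  have C0: "C 0 = (\<lambda>z k. 0)" and CS: "C (Suc m) = picard w (C m)" for m
    by (auto simp: C_def)
  have adm: "admissible (C m)" for m
  proof (induction m)
    case 0 show ?case using eta_pos by (auto simp: admissible_def C0)
  next
    case (Suc m) then show ?case using picard_admissible(1)[OF _ w] by (simp add: CS)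
  qed
  have size: "csize n (C m z) \<le> real n * (2 * (csize n w * K))" if "z \<in> disc2" for m z
  proof (cases m)
    case 0 then show ?thesis using K_pos by (simp add: C0)
  next
    case (Suc m') then show ?thesis using picard_admissible(2)[OF adm w that] by (simp add: CS)
  qed
  have diff: "cdist n (C (Suc m) z) (C m z) \<le> \<eta> * (1/2) ^ m" if "z \<in> disc2" for m z
    using that
  proof (induction m arbitrary: z)
    case 0
    then show ?case using adm[of 1] by (auto simp: C0 admissible_def less_imp_le)
  next
    case (Suc m)
    have "cdist n (picard w (C (Suc m)) z) (picard w (C m) z) \<le> \<eta> * (1/2) ^ m / 2"
      by (rule picard_contract[OF adm adm w]) (use Suc in auto)
    then show ?case by (simp add: CS)
  qed
  define c where "c = (\<lambda>z k. if k < n then (\<Sum>m. C (Suc m) z k - C m z k) else 0)"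
  have tele: "(\<Sum>m<N. C (Suc m) z k - C m z k) = C N z k" for N z k
    by (subst sum_lessThan_telescope) (simp add: C0)
  have lim: "uniform_limit disc2 (\<lambda>N z. C N z k) (\<lambda>z. c z k) sequentially" if k: "k < n" for k
  proof -
    have "uniform_limit disc2 (\<lambda>N z. \<Sum>m<N. C (Suc m) z k - C m z k) (\<lambda>z. \<Sum>m. C (Suc m) z k - C m z k) sequentially"
    proof (rule Weierstrass_m_test)
      fix m z assume "z \<in> disc2"
      then show "norm (C (Suc m) z k - C m z k) \<le> \<eta> * (1/2) ^ m"
        using diff[of z m] cmod_le_csize[OF k, of "\<lambda>k. C (Suc m) z k - C m z k"] by linarith
    qed (auto intro!: summable_mult summable_geometric)
    then show ?thesis using k by (simp add: tele c_def)
  qed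
  have ptlim: "(\<lambda>N. C N z k) \<longlonglongrightarrow> c z k" if "z \<in> disc2" "k < n" for z k
    using lim that by (intro tendsto_uniform_limitI)
  have cdist_lim: "(\<lambda>N. cdist n (C N z) (c z)) \<longlonglongrightarrow> 0" if "z \<in> disc2" for z
    unfolding csize_def
    by (rule tendsto_null_sum) (use ptlim that in \<open>auto intro!: tendsto_norm_zero simp: LIM_zero_iff\<close>)
  have csize_c: "csize n (c z) \<le> real n * (2 * (csize n w * K))" if "z \<in> disc2" for z
  proof -
    have "(\<lambda>N. csize n (C N z)) \<longlonglongrightarrow> csize n (c z)"
      unfolding csize_def by (intro tendsto_intros ptlim that) auto
    then show ?thesis using size[OF that] by (intro LIMSEQ_le_const2) auto
  qed
  have csize_eta: "csize n (c z) < \<eta>" if "z \<in> disc2" for z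
    using csize_c[OF that] small_radius(1)[OF w] by linarith
  have vf_lim: "(\<lambda>N. vf w (C N z) k) \<longlonglongrightarrow> vf w (c z) k" if z: "z \<in> disc2" and k: "k < n" for z k
  proof -
    have "(\<lambda>N. vf w (C N z) k - vf w (c z) k) \<longlonglongrightarrow> 0"
    proof (rule Lim_null_comparison)
      show "(\<lambda>N. csize n w * K * cdist n (C N z) (c z)) \<longlonglongrightarrow> 0"
        using tendsto_mult_right_zero[OF cdist_lim[OF z]] by simp
      show "eventually (\<lambda>N. norm (vf w (C N z) k - vf w (c z) k) \<le> csize n w * K * cdist n (C N z) (c z)) sequentially"
        using vf_lip[OF k] adm csize_eta[OF z] z by (intro always_eventually) (auto simp: admissible_def)
    qed
    then show ?thesis by (simp add: LIM_zero_iff)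
  qed
  have der: "((\<lambda>z. c z k) has_field_derivative vf w (c z) k) (at z)" if z: "z \<in> disc2" and k: "k < n" for z k
  proof -
    have "\<exists>g'. \<forall>z\<in>disc2. ((\<lambda>z. c z k) has_field_derivative g' z) (at z) \<and>
        ((\<lambda>N. (if N = 0 then 0 else vf w (C (N - 1) z) k)) \<longlongrightarrow> g' z) sequentially"
    proof (rule has_complex_derivative_uniform_sequence[where f = "\<lambda>N z. C N z k"])
      fix N z assume z: "z \<in> disc2"
      show "((\<lambda>z. C N z k) has_field_derivative (if N = 0 then 0 else vf w (C (N - 1) z) k)) (at z)"
      proof (cases N)
        case 0 then show ?thesis by (simp add: C0)
      next
        case (Suc m) then show ?thesis using picard(2)[OF adm k z, of w m] by (simp add: CS)
      qed
    next
      fix z :: complex assume "z \<in> disc2"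
      then obtain d where "d > 0" "cball z d \<subseteq> disc2"
        using open_contains_cball open_ball by metis
      then show "\<exists>d>0. cball z d \<subseteq> disc2 \<and> uniform_limit (cball z d) (\<lambda>N z. C N z k) (\<lambda>z. c z k) sequentially"
        using uniform_limit_on_subset[OF lim[OF k]] by blast
    qed auto
    then obtain g' where g': "((\<lambda>z. c z k) has_field_derivative g' z) (at z)"
      "(\<lambda>N. if N = 0 then 0 else vf w (C (N - 1) z) k) \<longlonglongrightarrow> g' z"
      using z by blast
    from LIMSEQ_Suc[OF g'(2)] have "(\<lambda>N. vf w (C N z) k) \<longlonglongrightarrow> g' z" by simp
    then have "g' z = vf w (c z) k" using vf_lim[OF z k] LIMSEQ_unique by blast
    then show ?thesis using g'(1) by simp
  qed
  have "c 0 k = 0" if "k < n" for k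
  proof -
    have "C N 0 k = 0" for N
      using picard(1)[OF adm that] by (cases N) (auto simp: C0 CS)
    then show ?thesis using that by (simp add: c_def)
  qed
  moreover have "c z k = 0" if "k \<ge> n" for z k
    using that by (simp add: c_def)
  ultimately have "integral_curve w c"
    using der csize_eta unfolding integral_curve_def by simp
  with csize_c \<open>\<And>z k. k \<ge> n \<Longrightarrow> c z k = 0\<close> show ?thesis by (intro exI[of _ c]) simp
qed

end

lemma rat_field_exists:
  assumes "\<And>k l. k < n \<Longrightarrow> l < n \<Longrightarrow> rat n (g k l)" "d > 0"
  shows "\<exists>K \<eta>. \<eta> \<le> d \<and> rat_field n g K \<eta>"
proof -
  obtain K e where *: "K > 0" "e > 0" "\<forall>i\<in>{..<n}\<times>{..<n}. tame n (g (fst i) (snd i)) K e"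
    using rat_family_tame[of "{..<n} \<times> {..<n}" n "\<lambda>i. g (fst i) (snd i)"] assms by auto
  define \<eta> where "\<eta> = min d e"
  have tame: "tame n (g k l) K \<eta>" if "k < n" "l < n" for k l
    using tame_mono[of n "g k l" K e K \<eta>] *(3) that by (auto simp: \<eta>_def)
  have "rat_field n g K \<eta>"
    by unfold_locales (use *(1,2) assms(2) tame in \<open>auto simp: tame_def \<eta>_def\<close>)
  moreover have "\<eta> \<le> d" by (simp add: \<eta>_def)
  ultimately show ?thesis by blast
qed

section \<open>Smoothness of local algebraic groups\<close>

lemma poly_funs_rat: "p \<in> poly_funs UNIV n \<Longrightarrow> rat n p"
  by (induction rule: poly_funs.induct) (auto intro: rat_const rat_coord rat_add rat_mult)

lemma poly_funs_curve:
  assumes "p \<in> poly_funs UNIV n" "\<And>k. k < n \<Longrightarrow> (\<lambda>z. c z k) field_differentiable at z"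
  shows "(\<lambda>z. p (c z)) field_differentiable at z"
  using assms by (induction rule: poly_funs.induct) (auto intro: derivative_intros)

lemma isCont_coordinate: "isCont (\<lambda>x::nat \<Rightarrow> complex. x k) y"
  by (rule continuous_on_interior[OF continuous_on_product_coordinates]) simp

lemma closed_real_vectors: "closed {u::nat \<Rightarrow> complex. \<forall>k. u k \<in> \<real>}"
proof -
  have "closed {x::nat \<Rightarrow> complex. x k \<in> \<real>}" for k
  proof -
    have "isCont (\<lambda>x::nat \<Rightarrow> complex. x k) y" for y by (rule isCont_coordinate)
    from continuous_closed_vimage[OF closed_complex_Reals this] show ?thesis by (simp add: vimage_def)
  qed
  then have "closed (\<Inter>k. {x::nat \<Rightarrow> complex. x k \<in> \<real>})" by (intro closed_INT) auto
  also have "(\<Inter>k. {x::nat \<Rightarrow> complex. x k \<in> \<real>}) = {x. \<forall>k. x k \<in> \<real>}" by auto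
  finally show ?thesis .
qed

lemma compact_polydisc: "compact {x::nat \<Rightarrow> complex. (\<forall>k<n. cmod (x k) \<le> b) \<and> (\<forall>k\<ge>n. x k = 0)}"
proof -
  define S where "S = (\<lambda>k. if k < n then cball (0::complex) b else {0})"
  have "{x::nat \<Rightarrow> complex. (\<forall>k<n. cmod (x k) \<le> b) \<and> (\<forall>k\<ge>n. x k = 0)} = PiE UNIV S"
    unfolding S_def PiE_UNIV_domain by (auto simp: Pi_iff split: if_splits)
  moreover have "compactin (product_topology (\<lambda>i. euclidean) UNIV) (PiE UNIV S)"
    unfolding compactin_PiE by (auto simp: S_def)
  ultimately show ?thesis
    by (simp add: euclidean_product_topology)
qed

text \<open>
  A pair of points of \<open>\<complex>\<^sup>n\<close> as one point of
  \<open>\<complex>\<^sup>2\<^sup>n\<close>.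
\<close>

definition join :: "nat \<Rightarrow> (nat \<Rightarrow> complex) \<Rightarrow> (nat \<Rightarrow> complex) \<Rightarrow> nat \<Rightarrow> complex" where
  "join n x y k = (if k < n then x k else y (k - n))"

lemma sum_lessThan_add:
  fixes n m :: nat and f :: "nat \<Rightarrow> 'a::comm_monoid_add"
  shows "(\<Sum>k<n+m. f k) = (\<Sum>k<n. f k) + (\<Sum>k<m. f (n + k))"
  by (induction m) (auto simp: algebra_simps)

lemma csize_join: "csize (n + n) (join n x y) = csize n x + csize n y"
  unfolding csize_def sum_lessThan_add by (simp add: join_def)

lemma join_zero [simp]: "join n (\<lambda>_. 0) (\<lambda>_. 0) = (\<lambda>_. 0)"
  by (auto simp: join_def)

lemma join_cnj: "join n (\<lambda>k. cnj (x k)) (\<lambda>k. cnj (y k)) = (\<lambda>k. cnj (join n x y k))"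
  by (auto simp: join_def)

lemma rat_germ_line:
  assumes "rat_germ n f f'"
  shows "((\<lambda>z. f (\<lambda>k. z * w k)) has_field_derivative (\<Sum>k<n. f' k (\<lambda>_. 0) * w k)) (at 0)"
proof -
  have "((\<lambda>z. f ((\<lambda>z k. z * w k) z)) has_field_derivative (\<Sum>k<n. f' k (\<lambda>_. 0) * w k)) (at 0)"
    by (rule has_gradientD[OF eventually_near0_zero[OF rat_germ_chain[OF assms]]])
       (auto intro!: derivative_eq_intros)
  then show ?thesis by simp
qed

text \<open>
  Conjugating the restrictions to lines parallel to the axes, where the derivative in one complex variable is
  unique.
\<close>

lemma rat_germ_real_partial:
  assumes f: "rat_germ n f f'" and real: "\<And>x. f (\<lambda>k. cnj (x k)) = cnj (f x)"
  shows "eventually (\<lambda>x. \<forall>k<n. f' k (\<lambda>k. cnj (x k)) = cnj (f' k x)) (near0 n)"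
proof -
  obtain d where d: "d > 0" "\<And>x. csize n x < d \<Longrightarrow> has_gradient n f (\<lambda>k. f' k x) x"
    using rat_germ_chain[OF f] by (rule near0E) (rule that)
  have line: "((\<lambda>z. f (\<lambda>l. x l + z * (if l = k then 1 else 0))) has_field_derivative f' k x) (at 0)"
    if "csize n x < d" "k < n" for x k
  proof -
    have "((\<lambda>z. f ((\<lambda>z l. x l + z * (if l = k then 1 else 0)) z)) has_field_derivative
        (\<Sum>l<n. f' l x * (if l = k then 1 else 0))) (at 0)"
      by (rule has_gradientD[OF d(2)[OF that(1)]]) (auto intro!: derivative_eq_intros)
    moreover have "(\<Sum>l<n. f' l x * (if l = k then 1 else 0)) = f' k x"
      using that(2) by (simp add: if_distrib[of "\<lambda>a. _ * a"] cong: if_cong)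
    ultimately show ?thesis by simp
  qed
  have "f' k (\<lambda>k. cnj (x k)) = cnj (f' k x)" if x: "csize n x < d" and k: "k < n" for x k
  proof -
    have "((\<lambda>z. f (\<lambda>l. x l + z * (if l = k then 1 else 0))) has_field_derivative f' k x) (at (cnj 0))"
      using line[OF x k] by simp
    from has_field_derivative_cnj_cnj[OF this]
    have "((\<lambda>z. cnj (f (\<lambda>l. x l + cnj z * (if l = k then 1 else 0)))) has_field_derivative cnj (f' k x)) (at 0)"
      by (simp add: o_def)
    also have "(\<lambda>z. cnj (f (\<lambda>l. x l + cnj z * (if l = k then 1 else 0)))) =
        (\<lambda>z. f (\<lambda>l. cnj (x l) + z * (if l = k then 1 else 0)))"
      unfolding real[symmetric] by (intro ext arg_cong[where f = f]) auto
    finally show ?thesis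
      using line[of "\<lambda>k. cnj (x k)" k] x k DERIV_unique by auto
  qed
  then show ?thesis unfolding eventually_near0 using d(1) by blast
qed

text \<open>
  An algebraic group in affine coordinates near its identity element \<open>0\<close>. Near the origin it is the
  zero set \<open>V\<close> of the polynomials \<open>S\<close>. Its multiplication is the restriction of
  rational functions \<open>M\<close> of the ambient space; off \<open>V\<close> these obey no group law, they
  only commute with complex conjugation.
\<close>

locale local_group =
  fixes n :: nat and V :: "(nat \<Rightarrow> complex) set" and M :: "nat \<Rightarrow> (nat \<Rightarrow> complex) \<Rightarrow> complex"
    and S :: "((nat \<Rightarrow> complex) \<Rightarrow> complex) set" and \<rho> :: real
  assumes rho_pos: "\<rho> > 0"
    and M_rat: "k < n \<Longrightarrow> rat (n + n) (M k)"
    and M_real: "k < n \<Longrightarrow> M k (\<lambda>l. cnj (z l)) = cnj (M k z)"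
    and M_in: "x \<in> V \<Longrightarrow> y \<in> V \<Longrightarrow> csize n x < \<rho> \<Longrightarrow> csize n y < \<rho> \<Longrightarrow>
      (\<lambda>k. if k < n then M k (join n x y) else 0) \<in> V"
    and M_unit: "x \<in> V \<Longrightarrow> csize n x < \<rho> \<Longrightarrow> k < n \<Longrightarrow> M k (join n x (\<lambda>_. 0)) = x k"
      "x \<in> V \<Longrightarrow> csize n x < \<rho> \<Longrightarrow> k < n \<Longrightarrow> M k (join n (\<lambda>_. 0) x) = x k"
    and S_poly: "S \<subseteq> poly_funs UNIV n"
    and V_zeros: "\<forall>k\<ge>n. x k = 0 \<Longrightarrow> csize n x < \<rho> \<Longrightarrow> x \<in> V \<longleftrightarrow> (\<forall>p\<in>S. p x = 0)"
    and V_support: "x \<in> V \<Longrightarrow> k \<ge> n \<Longrightarrow> x k = 0"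
    and zero_in_V: "(\<lambda>_. 0) \<in> V"
begin

definition mul :: "(nat \<Rightarrow> complex) \<Rightarrow> (nat \<Rightarrow> complex) \<Rightarrow> nat \<Rightarrow> complex" where
  "mul x y k = (if k < n then M k (join n x y) else 0)"

lemma mul_in: "x \<in> V \<Longrightarrow> y \<in> V \<Longrightarrow> csize n x < \<rho> \<Longrightarrow> csize n y < \<rho> \<Longrightarrow> mul x y \<in> V"
  using M_in unfolding mul_def by presburger

lemma mul_zero: "x \<in> V \<Longrightarrow> csize n x < \<rho> \<Longrightarrow> mul x (\<lambda>_. 0) = x"
  "x \<in> V \<Longrightarrow> csize n x < \<rho> \<Longrightarrow> mul (\<lambda>_. 0) x = x"
  unfolding mul_def using M_unit V_support by (auto simp: not_less)

definition vanishing :: "((nat \<Rightarrow> complex) \<Rightarrow> complex) \<Rightarrow> bool" where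
  "vanishing f \<longleftrightarrow> eventually (\<lambda>x. x \<in> V \<longrightarrow> f x = 0) (near0 n)"

text \<open>
  The Zariski tangent space of \<open>V\<close> at the origin, defined by all rational germs that vanish on
  \<open>V\<close>, not only by the linear parts of the given equations, which might be too few.
\<close>

definition tangent :: "(nat \<Rightarrow> complex) set" where
  "tangent = {w. \<forall>f f'. rat_germ n f f' \<and> vanishing f \<longrightarrow> (\<Sum>k<n. f' k (\<lambda>_. 0) * w k) = 0}"

definition M' :: "nat \<Rightarrow> nat \<Rightarrow> (nat \<Rightarrow> complex) \<Rightarrow> complex" where
  "M' k = (SOME f'. rat_germ (n + n) (M k) f')"

definition g :: "nat \<Rightarrow> nat \<Rightarrow> (nat \<Rightarrow> complex) \<Rightarrow> complex" where
  "g k l x = M' k (n + l) (join n x (\<lambda>_. 0))"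

text \<open>
  The derivative of \<open>y \<mapsto> x y\<close> at \<open>y = 0\<close> in the direction \<open>w\<close>:
  the left-invariant vector field with value \<open>w\<close> at the identity, extended to the ambient space by
  the choice of \<open>M\<close>.
\<close>

definition lvf :: "(nat \<Rightarrow> complex) \<Rightarrow> (nat \<Rightarrow> complex) \<Rightarrow> nat \<Rightarrow> complex" where
  "lvf w x k = (\<Sum>l<n. w l * g k l x)"

lemma M': "k < n \<Longrightarrow> rat_germ (n + n) (M k) (M' k)"
  using M_rat[of k] unfolding M'_def rat_def by (rule someI_ex)

lemma rat_join_left: "k < n + n \<Longrightarrow> rat n (\<lambda>x. join n x y k)"
  unfolding join_def by (cases "k < n") (auto intro: rat_coord rat_const)

lemma rat_join_right: "k < n + n \<Longrightarrow> rat n (\<lambda>y. join n x y k)"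
  unfolding join_def by (cases "k < n") (auto intro: rat_coord rat_const)

lemma rat_g: "k < n \<Longrightarrow> rat n (g k l)"
proof -
  assume k: "k < n"
  have "rat n (\<lambda>x. M' k (n + l) (join n x (\<lambda>_. 0)))"
    using eventually_near0_zero[OF rat_subst[OF rat_germ_partial[OF M'[OF k], of "n + l"]], rule_format,
        of n "\<lambda>x. join n x (\<lambda>_. 0)"]
    by (simp add: rat_join_left)
  then show ?thesis unfolding g_def[abs_def] .
qed

lemma rat_lvf: "k < n \<Longrightarrow> rat n (\<lambda>x. lvf w x k)"
  unfolding lvf_def by (intro rat_sum rat_mult rat_const rat_g)

lemma tangent_derivative:
  assumes "w \<in> tangent" "rat n f" "vanishing f"
  shows "((\<lambda>z. f (\<lambda>k. z * w k)) has_field_derivative 0) (at 0)"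
proof -
  obtain f' where f': "rat_germ n f f'" using assms(2) unfolding rat_def by blast
  then have "(\<Sum>k<n. f' k (\<lambda>_. 0) * w k) = 0" using assms unfolding tangent_def by blast
  then show ?thesis using rat_germ_line[OF f', of w] by simp
qed

lemma mul_right_derivative:
  "eventually (\<lambda>x. \<forall>k<n. \<forall>w. ((\<lambda>z. M k (join n x (\<lambda>l. z * w l))) has_field_derivative lvf w x k) (at 0)) (near0 n)"
proof -
  have "eventually (\<lambda>x. \<forall>w. ((\<lambda>z. M k (join n x (\<lambda>l. z * w l))) has_field_derivative lvf w x k) (at 0)) (near0 n)"
    if k: "k < n" for k
  proof -
    obtain d where d: "d > 0" "\<And>x. csize (n + n) x < d \<Longrightarrow> has_gradient (n + n) (M k) (\<lambda>l. M' k l x) x"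
      using rat_germ_chain[OF M'[OF k]] by (rule near0E) (rule that)
    have "((\<lambda>z. M k (join n x (\<lambda>l. z * w l))) has_field_derivative lvf w x k) (at 0)"
      if x: "csize n x < d" for x w
    proof -
      have "((\<lambda>z. M k ((\<lambda>z. join n x (\<lambda>l. z * w l)) z)) has_field_derivative
          (\<Sum>l<n+n. M' k l (join n x (\<lambda>_. 0)) * join n (\<lambda>_. 0) w l)) (at 0)"
        by (rule has_gradientD[OF d(2)]) (use x in \<open>auto simp: csize_join join_def intro!: derivative_eq_intros\<close>)
      moreover have "(\<Sum>l<n+n. M' k l (join n x (\<lambda>_. 0)) * join n (\<lambda>_. 0) w l) = lvf w x k"
        unfolding sum_lessThan_add by (simp add: join_def lvf_def g_def mult.commute)
      ultimately show ?thesis by simp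
    qed
    then show ?thesis unfolding eventually_near0 using d(1) by blast
  qed
  then have "eventually (\<lambda>x. \<forall>k\<in>{..<n}. \<forall>w. ((\<lambda>z. M k (join n x (\<lambda>l. z * w l))) has_field_derivative lvf w x k) (at 0)) (near0 n)"
    by (simp add: eventually_ball_finite)
  then show ?thesis by (rule eventually_mono) simp
qed

text \<open>
  For a fixed small \<open>x \<in> V\<close> the germ \<open>y \<mapsto> f(x y)\<close> vanishes on
  \<open>V\<close>, because \<open>V\<close> is closed under multiplication. So its derivative at
  \<open>0\<close> in each tangent direction is zero.
\<close>

lemma lvf_tangent:
  assumes f: "rat_germ n f f'" and "vanishing f"
  shows "eventually (\<lambda>x. x \<in> V \<longrightarrow> (\<forall>w\<in>tangent. (\<Sum>k<n. f' k x * lvf w x k) = 0)) (near0 n)"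
proof -
  have rat_f: "rat n f" using f rat_germ_imp_rat by blast
  obtain d1 where d1: "d1 > 0" "\<And>x. csize n x < d1 \<Longrightarrow> has_gradient n f (\<lambda>k. f' k x) x"
    using rat_germ_chain[OF f] by (rule near0E) (rule that)
  obtain d2 where d2: "d2 > 0" "\<And>y. csize n y < d2 \<Longrightarrow> \<forall>m s. (\<forall>k<n. rat m (\<lambda>x. s x k)) \<longrightarrow>
      (\<forall>k. s (\<lambda>_. 0) k = y k) \<longrightarrow> rat m (\<lambda>x. f (s x))"
    using rat_subst[OF rat_f] by (rule near0E) (rule that)
  have "eventually (\<lambda>y. \<forall>k\<in>{..<n}. \<forall>m s. (\<forall>k<n+n. rat m (\<lambda>x. s x k)) \<longrightarrow>
      (\<forall>k. s (\<lambda>_. 0) k = y k) \<longrightarrow> rat m (\<lambda>x. M k (s x))) (near0 (n + n))"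
    by (intro eventually_ball_finite ballI rat_subst M_rat) auto
  then obtain d3 where d3: "d3 > 0" "\<And>y. csize (n + n) y < d3 \<Longrightarrow> \<forall>k\<in>{..<n}. \<forall>m s. (\<forall>k<n+n. rat m (\<lambda>x. s x k)) \<longrightarrow>
      (\<forall>k. s (\<lambda>_. 0) k = y k) \<longrightarrow> rat m (\<lambda>x. M k (s x))"
    by (rule near0E) (rule that)
  obtain d4 where d4: "d4 > 0" "\<And>x. csize n x < d4 \<Longrightarrow>
      \<forall>k<n. \<forall>w. ((\<lambda>z. M k (join n x (\<lambda>l. z * w l))) has_field_derivative lvf w x k) (at 0)"
    using mul_right_derivative by (rule near0E) (rule that)
  obtain d5 where d5: "d5 > 0" "\<And>x. csize n x < d5 \<Longrightarrow> x \<in> V \<longrightarrow> f x = 0"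
    using assms(2) unfolding vanishing_def by (rule near0E) (rule that)
  define d where "d = Min {d1, d2, d3, d4, d5, \<rho>}"
  have d: "d > 0" "d \<le> d1" "d \<le> d2" "d \<le> d3" "d \<le> d4" "d \<le> d5" "d \<le> \<rho>"
    unfolding d_def using d1(1) d2(1) d3(1) d4(1) d5(1) rho_pos by auto
  have "(\<Sum>k<n. f' k x * lvf w x k) = 0" if x: "csize n x < d" "x \<in> V" and w: "w \<in> tangent" for x w
  proof -
    have mul0: "mul x (\<lambda>_. 0) = x" using mul_zero(1) x d by auto
    have rat_mul: "rat n (\<lambda>y. mul x y k)" if "k < n" for k
    proof -
      have "rat n (\<lambda>y. M k (join n x y))"
        using d3(2)[of "join n x (\<lambda>_. 0)", rule_format, of k n "join n x"] x d that
        by (auto simp: csize_join rat_join_right)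
      then show ?thesis using that by (simp add: mul_def)
    qed
    have rat_F: "rat n (\<lambda>y. f (mul x y))"
      using d2(2)[of x, rule_format, of n "mul x"] x d rat_mul mul0 by auto
    have "((\<lambda>y. csize n (mul x y)) \<longlongrightarrow> csize n (mul x (\<lambda>_. 0))) (near0 n)"
      unfolding csize_def by (intro tendsto_sum tendsto_norm rat_continuous rat_mul) auto
    then have "eventually (\<lambda>y. csize n (mul x y) < d5) (near0 n)"
      using x d mul0 by (auto intro!: order_tendstoD(2)[of _ "csize n x"])
    moreover have "eventually (\<lambda>y. csize n y < \<rho>) (near0 n)"
      unfolding eventually_near0 using rho_pos by blast
    ultimately have "vanishing (\<lambda>y. f (mul x y))"
      unfolding vanishing_def
    proof eventually_elim
      case (elim y)
      then show ?case using d5(2) mul_in[of x y] x d by auto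
    qed
    from tangent_derivative[OF w rat_F this]
    have "((\<lambda>z. f (mul x (\<lambda>k. z * w k))) has_field_derivative 0) (at 0)" .
    moreover have "((\<lambda>z. f (mul x (\<lambda>k. z * w k))) has_field_derivative (\<Sum>k<n. f' k x * lvf w x k)) (at 0)"
    proof (rule has_gradientD[OF d1(2)])
      show "csize n x < d1" using x d by simp
      show "mul x (\<lambda>k. 0 * w k) k = x k" for k using mul0 by simp
      show "((\<lambda>z. mul x (\<lambda>k. z * w k) k) has_field_derivative lvf w x k) (at 0)" if "k < n" for k
        using d4(2)[of x] x d that by (simp add: mul_def)
    qed
    ultimately show ?thesis using DERIV_unique by blast
  qed
  then show ?thesis unfolding eventually_near0 using d(1) by blast
qed

text \<open>
  The derivation given by a left-invariant field maps the ideal of \<open>V\<close> to itself. This is where the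
  group structure forces smoothness.
\<close>

lemma lvf_derivative_vanishing:
  assumes "rat n f" "vanishing f" "w \<in> tangent"
  shows "\<exists>h. rat n h \<and> vanishing h \<and> eventually (\<lambda>x. \<forall>c z. c z = x \<longrightarrow>
    (\<forall>k<n. ((\<lambda>z. c z k) has_field_derivative lvf w x k) (at z)) \<longrightarrow>
     ((\<lambda>z. f (c z)) has_field_derivative h x) (at z)) (near0 n)"
proof -
  obtain f' where f': "rat_germ n f f'" using assms(1) unfolding rat_def by blast
  define h where "h = (\<lambda>x. \<Sum>k<n. f' k x * lvf w x k)"
  have "rat n h"
    unfolding h_def using rat_germ_partial[OF f'] rat_lvf by (intro rat_sum rat_mult) auto
  moreover have "vanishing h"
    unfolding vanishing_def h_def using lvf_tangent[OF f' assms(2)] assms(3)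
    by (auto elim: eventually_mono)
  moreover have "eventually (\<lambda>x. \<forall>c z. c z = x \<longrightarrow>
    (\<forall>k<n. ((\<lambda>z. c z k) has_field_derivative lvf w x k) (at z)) \<longrightarrow>
     ((\<lambda>z. f (c z)) has_field_derivative h x) (at z)) (near0 n)"
    using rat_germ_chain[OF f'] by eventually_elim (auto simp: h_def has_gradient_def)
  ultimately show ?thesis by blast
qed

lemma vanishing_at_zero: "vanishing f \<Longrightarrow> f (\<lambda>_. 0) = 0"
  using eventually_near0_zero zero_in_V unfolding vanishing_def by blast

text \<open>
  The \<open>m\<close>-th derivative along the curve is the value of the \<open>m\<close>-fold derivation, hence
  of another germ in the ideal.
\<close>

lemma curve_vanishing_derivs:
  assumes "w \<in> tangent" and c: "\<And>k. k < n \<Longrightarrow> c 0 k = 0"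
    "\<And>z k. z \<in> disc2 \<Longrightarrow> k < n \<Longrightarrow> ((\<lambda>z. c z k) has_field_derivative lvf w (c z) k) (at z)"
  shows "rat n f \<Longrightarrow> vanishing f \<Longrightarrow> (deriv ^^ m) (\<lambda>z. f (c z)) 0 = 0"
proof (induction m arbitrary: f)
  case 0
  have "f (c 0) = f (\<lambda>_. 0)" by (rule rat_local[OF 0(1)]) (simp add: c)
  then show ?case using vanishing_at_zero[OF 0(2)] by simp
next
  case (Suc m)
  obtain h where h: "rat n h" "vanishing h" "eventually (\<lambda>x. \<forall>c z. c z = x \<longrightarrow>
    (\<forall>k<n. ((\<lambda>z. c z k) has_field_derivative lvf w x k) (at z)) \<longrightarrow>
     ((\<lambda>z. f (c z)) has_field_derivative h x) (at z)) (near0 n)"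
    using lvf_derivative_vanishing[OF Suc.prems assms(1)] by blast
  obtain d where d: "d > 0" "\<And>x. csize n x < d \<Longrightarrow> \<forall>c z. c z = x \<longrightarrow>
    (\<forall>k<n. ((\<lambda>z. c z k) has_field_derivative lvf w x k) (at z)) \<longrightarrow>
     ((\<lambda>z. f (c z)) has_field_derivative h x) (at z)"
    using h(3) by (rule near0E) (rule that)
  have "isCont (\<lambda>z. csize n (c z)) 0"
    unfolding csize_def using c(2)[of 0] by (intro continuous_intros) (auto intro: DERIV_isCont)
  moreover have "csize n (c 0) = 0" unfolding csize_def using c(1) by simp
  ultimately have "((\<lambda>z. csize n (c z)) \<longlongrightarrow> 0) (nhds 0)"
    using tendsto_at_iff_tendsto_nhds[of "\<lambda>z. csize n (c z)" 0] by (simp add: isCont_def)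
  then have "eventually (\<lambda>z. csize n (c z) < d) (nhds 0)"
    using d(1) order_tendstoD(2) by blast
  moreover have "eventually (\<lambda>z. z \<in> disc2) (nhds (0::complex))"
    by (intro eventually_nhds_in_open) auto
  ultimately have "eventually (\<lambda>z. deriv (\<lambda>z. f (c z)) z = h (c z)) (nhds 0)"
  proof eventually_elim
    case (elim z)
    then have "((\<lambda>z. f (c z)) has_field_derivative h (c z)) (at z)"
      using d(2)[OF elim(1), rule_format, of c z] c(2) by blast
    then show ?case by (rule DERIV_imp_deriv)
  qed
  then have "(deriv ^^ m) (deriv (\<lambda>z. f (c z))) 0 = (deriv ^^ m) (\<lambda>z. h (c z)) 0"
    by (rule higher_deriv_cong_ev) simp
  then show ?case using Suc.IH[OF h(1,2)] by (simp add: funpow_Suc_right del: funpow.simps)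
qed

text \<open>
  A holomorphic function on the disc all of whose derivatives at \<open>0\<close> are zero is zero. It applies
  to the equations of \<open>V\<close> because polynomials, unlike other germs, are holomorphic along the whole
  curve.
\<close>

lemma curve_in_V:
  assumes "w \<in> tangent" and c: "\<And>k. k < n \<Longrightarrow> c 0 k = 0"
    "\<And>z k. z \<in> disc2 \<Longrightarrow> k < n \<Longrightarrow> ((\<lambda>z. c z k) has_field_derivative lvf w (c z) k) (at z)"
    "\<And>z k. k \<ge> n \<Longrightarrow> c z k = 0" "\<And>z. z \<in> disc2 \<Longrightarrow> csize n (c z) < \<rho>" and z: "z \<in> disc2"
  shows "c z \<in> V"
proof -
  have "p (c z) = 0" if p: "p \<in> S" for p
  proof -
    have poly: "p \<in> poly_funs UNIV n" using p S_poly by blast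
    have "vanishing p"
      unfolding vanishing_def eventually_near0
    proof (intro exI[of _ \<rho>] conjI allI impI rho_pos)
      fix x assume "csize n x < \<rho>" "x \<in> V"
      then show "p x = 0" using V_zeros[of x] V_support[of x] p by blast
    qed
    then have "(deriv ^^ m) (\<lambda>z. p (c z)) 0 = 0" for m
      by (intro curve_vanishing_derivs[OF assms(1) c(1,2)] poly_funs_rat[OF poly])
    moreover have "(\<lambda>z. p (c z)) holomorphic_on disc2"
      unfolding holomorphic_on_def
    proof
      fix z :: complex assume "z \<in> disc2"
      then have "(\<lambda>z. p (c z)) field_differentiable at z"
        using c(2) by (intro poly_funs_curve[OF poly]) (auto simp: field_differentiable_def)
      then show "(\<lambda>z. p (c z)) field_differentiable at z within disc2"
        by (rule field_differentiable_at_within)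
    qed
    ultimately show ?thesis
      using holomorphic_fun_eq_0_on_connected[of "\<lambda>z. p (c z)" disc2 0 z] z by auto
  qed
  then show ?thesis using V_zeros[of "c z"] c(3,4) z by blast
qed

lemma tangent_scale: "w \<in> tangent \<Longrightarrow> (\<lambda>k. c * w k) \<in> tangent"
  unfolding tangent_def by (simp add: sum_distrib_left[symmetric] mult.left_commute[of _ c])

lemma zero_tangent: "(\<lambda>_. 0) \<in> tangent"
  unfolding tangent_def by simp

text \<open>
  Otherwise there are bad points \<open>r\<close> of \<open>V\<close> tending to \<open>0\<close>. A limit
  direction of theirs is a tangent vector, by the first order expansion of the germs vanishing on
  \<open>V\<close>, and some \<open>r\<close> is as close to this direction as required. The cone
  \<open>Q\<close> keeps track of reality.
\<close>

lemma tangent_approx_in_closed_cone: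
  assumes Q: "closed Q" "\<And>x t. x \<in> Q \<Longrightarrow> (\<lambda>k. of_real t * x k) \<in> Q" and "e > 0"
  shows "eventually (\<lambda>r. r \<in> V \<longrightarrow> r \<in> Q \<longrightarrow>
    (\<exists>w\<in>tangent. w \<in> Q \<and> (\<forall>k\<ge>n. w k = 0) \<and> cdist n r w \<le> e * csize n r)) (near0 n)"
proof (rule ccontr)
  let ?good = "\<lambda>r. r \<in> V \<longrightarrow> r \<in> Q \<longrightarrow>
    (\<exists>w\<in>tangent. w \<in> Q \<and> (\<forall>k\<ge>n. w k = 0) \<and> cdist n r w \<le> e * csize n r)"
  assume "\<not> eventually ?good (near0 n)"
  then have "\<exists>r. csize n r < inverse (real (Suc m)) \<and> \<not> ?good r" for m
    unfolding eventually_near0 by (metis inverse_positive_iff_positive of_nat_0_less_iff zero_less_Suc)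
  then obtain r where r: "\<And>m. csize n (r m) < inverse (real (Suc m))" "\<And>m. \<not> ?good (r m)"
    by metis
  then have rV: "r m \<in> V" "r m \<in> Q" for m by blast+
  have pos: "csize n (r m) > 0" for m
  proof (rule ccontr)
    assume "\<not> csize n (r m) > 0"
    then have z: "csize n (r m) = 0" using csize_nonneg[of n "r m"] by linarith
    have "(\<lambda>k. of_real 0 * r m k) \<in> Q" using rV Q(2) by blast
    then have "(\<lambda>_. 0) \<in> Q" by simp
    then show False using r(2)[of m] zero_tangent z by force
  qed
  define u where "u = (\<lambda>m k. of_real (inverse (csize n (r m))) * r m k)"
  have uQ: "u m \<in> Q" for m unfolding u_def using Q(2) rV by blast
  have u_size: "csize n (u m) = 1" for m
    unfolding u_def csize_scale using pos[of m] by (simp add: norm_inverse)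
  define P where "P = {x::nat \<Rightarrow> complex. (\<forall>k<n. cmod (x k) \<le> 1) \<and> (\<forall>k\<ge>n. x k = 0)}"
  have "u m \<in> P" for m
    unfolding P_def using cmod_le_csize[of _ n "u m"] u_size[of m] V_support[OF rV(1)[of m]]
    by (auto simp: u_def)
  moreover have "seq_compact P"
    unfolding P_def by (intro compact_imp_seq_compact compact_polydisc)
  ultimately obtain v \<sigma> where v: "v \<in> P" and \<sigma>: "strict_mono \<sigma>" and lim: "(u \<circ> \<sigma>) \<longlonglongrightarrow> v"
    by (metis seq_compactE)
  have vQ: "v \<in> Q" using closed_sequentially[OF Q(1) _ lim] uQ by simp
  have limk: "(\<lambda>m. u (\<sigma> m) k) \<longlonglongrightarrow> v k" for k
  proof -
    have "isCont (\<lambda>x::nat \<Rightarrow> complex. x k) v"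
      by (rule isCont_coordinate)
    from isCont_tendsto_compose[OF this lim] show ?thesis by (simp add: o_def)
  qed
  have r0: "(\<lambda>m. csize n (r (\<sigma> m))) \<longlonglongrightarrow> 0"
  proof (rule tendsto_sandwich[of "\<lambda>_. 0" _ _ "\<lambda>m. inverse (real (Suc m))"])
    show "eventually (\<lambda>m. csize n (r (\<sigma> m)) \<le> inverse (real (Suc m))) sequentially"
    proof (intro always_eventually allI)
      fix m
      have "m \<le> \<sigma> m" using \<sigma> by (rule seq_suble)
      then have "inverse (real (Suc (\<sigma> m))) \<le> inverse (real (Suc m))" by (simp add: le_imp_inverse_le)
      then show "csize n (r (\<sigma> m)) \<le> inverse (real (Suc m))" using r(1)[of "\<sigma> m"] by linarith
    qed
  qed (use LIMSEQ_inverse_real_of_nat in auto)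
  have v_tangent: "v \<in> tangent"
    unfolding tangent_def
  proof (intro CollectI allI impI, elim conjE)
    fix f f' assume f: "rat_germ n f f'" "vanishing f"
    let ?L = "\<lambda>x. \<Sum>k<n. f' k (\<lambda>_. 0) * x k"
    have "(\<lambda>m. ?L (u (\<sigma> m))) \<longlonglongrightarrow> 0"
    proof (rule LIMSEQ_I)
      fix \<epsilon> :: real assume "\<epsilon> > 0"
      then obtain d where d: "d > 0" "\<And>x y. csize n x < d \<Longrightarrow> csize n y < d \<Longrightarrow>
        cmod (f x - f y - (\<Sum>k<n. f' k (\<lambda>_. 0) * (x k - y k))) \<le> \<epsilon> / 2 * cdist n x y"
        using rat_germ_strict[OF f(1), of "\<epsilon> / 2"] by auto
      obtain d' where d': "d' > 0" "\<And>x. csize n x < d' \<Longrightarrow> x \<in> V \<longrightarrow> f x = 0"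
        using f(2) unfolding vanishing_def by (rule near0E) (rule that)
      have "eventually (\<lambda>m. csize n (r (\<sigma> m)) < min d d') sequentially"
        using order_tendstoD(2)[OF r0, of "min d d'"] d(1) d'(1) by simp
      then obtain N where N: "\<And>m. m \<ge> N \<Longrightarrow> csize n (r (\<sigma> m)) < min d d'"
        unfolding eventually_sequentially by blast
      have "norm (?L (u (\<sigma> m)) - 0) < \<epsilon>" if "m \<ge> N" for m
      proof -
        have "f (r (\<sigma> m)) = 0" using d'(2) N[OF that] rV by simp
        moreover have "f (\<lambda>_. 0) = 0" using vanishing_at_zero[OF f(2)] .
        ultimately have "cmod (?L (r (\<sigma> m))) \<le> \<epsilon> / 2 * csize n (r (\<sigma> m))"
          using d(2)[of "r (\<sigma> m)" "\<lambda>_. 0"] N[OF that] d(1) by simp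
        moreover have "?L (u (\<sigma> m)) = of_real (inverse (csize n (r (\<sigma> m)))) * ?L (r (\<sigma> m))"
          unfolding u_def sum_distrib_left by (intro sum.cong) auto
        ultimately have "cmod (?L (u (\<sigma> m))) \<le> inverse (csize n (r (\<sigma> m))) * (\<epsilon> / 2 * csize n (r (\<sigma> m)))"
          using pos[of "\<sigma> m"] by (simp add: norm_mult mult_left_mono norm_inverse del: of_real_inverse)
        also have "\<dots> < \<epsilon>" using pos[of "\<sigma> m"] \<open>\<epsilon> > 0\<close> by simp
        finally show ?thesis by simp
      qed
      then show "\<exists>N. \<forall>m\<ge>N. norm (?L (u (\<sigma> m)) - 0) < \<epsilon>" by blast
    qed
    moreover have "(\<lambda>m. ?L (u (\<sigma> m))) \<longlonglongrightarrow> ?L v"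
      by (intro tendsto_intros limk)
    ultimately show "?L v = 0" using LIMSEQ_unique by blast
  qed
  have "(\<lambda>m. cdist n (u (\<sigma> m)) v) \<longlonglongrightarrow> 0"
    unfolding csize_def by (rule tendsto_null_sum) (use limk in \<open>auto intro!: tendsto_norm_zero simp: LIM_zero_iff\<close>)
  then have "eventually (\<lambda>m. cdist n (u (\<sigma> m)) v < e) sequentially"
    using \<open>e > 0\<close> order_tendstoD(2) by blast
  then obtain m where m: "cdist n (u (\<sigma> m)) v < e"
    unfolding eventually_sequentially by blast
  let ?s = "csize n (r (\<sigma> m))"
  have "cdist n (r (\<sigma> m)) (\<lambda>k. of_real ?s * v k) = csize n (\<lambda>k. of_real ?s * (u (\<sigma> m) k - v k))"
    using pos[of "\<sigma> m"] by (intro csize_cong) (simp add: u_def algebra_simps)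
  also have "\<dots> = ?s * cdist n (u (\<sigma> m)) v" unfolding csize_scale by simp
  also have "\<dots> \<le> ?s * e" using m by (intro mult_left_mono) auto
  finally have "cdist n (r (\<sigma> m)) (\<lambda>k. of_real ?s * v k) \<le> e * ?s" by (simp add: mult.commute)
  moreover have "(\<lambda>k. of_real ?s * v k) \<in> Q" using vQ Q(2) by blast
  moreover have "\<forall>k\<ge>n. of_real ?s * v k = 0" using v by (simp add: P_def)
  moreover have "(\<lambda>k. of_real ?s * v k) \<in> tangent" by (rule tangent_scale[OF v_tangent])
  ultimately show False using r(2)[of "\<sigma> m"] by blast
qed

lemma tangent_approx:
  assumes "e > 0"
  shows "eventually (\<lambda>r. r \<in> V \<longrightarrow> (\<exists>w\<in>tangent. (\<forall>k\<ge>n. w k = 0) \<and> cdist n r w \<le> e * csize n r \<and>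
    ((\<forall>k. r k \<in> \<real>) \<longrightarrow> (\<forall>k. w k \<in> \<real>)))) (near0 n)"
proof -
  have "eventually (\<lambda>r. r \<in> V \<longrightarrow> r \<in> {x. \<forall>k. x k \<in> \<real>} \<longrightarrow>
    (\<exists>w\<in>tangent. w \<in> {x. \<forall>k. x k \<in> \<real>} \<and> (\<forall>k\<ge>n. w k = 0) \<and> cdist n r w \<le> e * csize n r)) (near0 n)"
    by (rule tangent_approx_in_closed_cone[OF closed_real_vectors _ assms]) auto
  moreover have "eventually (\<lambda>r. r \<in> V \<longrightarrow> r \<in> UNIV \<longrightarrow>
    (\<exists>w\<in>tangent. w \<in> UNIV \<and> (\<forall>k\<ge>n. w k = 0) \<and> cdist n r w \<le> e * csize n r)) (near0 n)"
    by (rule tangent_approx_in_closed_cone[OF closed_UNIV _ assms]) auto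
  ultimately show ?thesis by eventually_elim blast
qed

lemma g_real: "eventually (\<lambda>x. \<forall>k<n. \<forall>l<n. g k l (\<lambda>i. cnj (x i)) = cnj (g k l x)) (near0 n)"
proof -
  have "eventually (\<lambda>x. \<forall>k\<in>{..<n}. \<forall>m<n+n. M' k m (\<lambda>i. cnj (x i)) = cnj (M' k m x)) (near0 (n + n))"
    by (intro eventually_ball_finite ballI, simp)
       (rule rat_germ_real_partial[OF M'], use M_real in auto)
  then obtain d where d: "d > 0" "\<And>x. csize (n + n) x < d \<Longrightarrow>
      \<forall>k\<in>{..<n}. \<forall>m<n+n. M' k m (\<lambda>i. cnj (x i)) = cnj (M' k m x)"
    by (rule near0E) (rule that)
  have "g k l (\<lambda>i. cnj (x i)) = cnj (g k l x)" if "csize n x < d" "k < n" "l < n" for x k l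
    using d(2)[of "join n x (\<lambda>_. 0)"] that join_cnj[of n x "\<lambda>_. 0"] by (simp add: g_def csize_join)
  then show ?thesis unfolding eventually_near0 using d(1) by blast
qed

text \<open>
  The germ \<open>y \<mapsto> M(0, y) - y\<close> need not be zero, but it vanishes on \<open>V\<close>.
\<close>

lemma lvf_zero:
  assumes "w \<in> tangent" "k < n"
  shows "lvf w (\<lambda>_. 0) k = w k"
proof -
  let ?f = "\<lambda>y. M k (join n (\<lambda>_. 0) y) - y k"
  have "rat n (\<lambda>y. M k (join n (\<lambda>_. 0) y))"
    using eventually_near0_zero[OF rat_subst[OF M_rat[OF assms(2)]], rule_format, of n "join n (\<lambda>_. 0)"]
    by (simp add: rat_join_right)
  then have "rat n ?f" by (intro rat_diff rat_coord assms)
  moreover have "vanishing ?f"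
    unfolding vanishing_def eventually_near0
    by (intro exI[of _ \<rho>] conjI allI impI rho_pos) (use M_unit(2) assms in auto)
  ultimately have "((\<lambda>z. ?f (\<lambda>l. z * w l)) has_field_derivative 0) (at 0)"
    by (rule tangent_derivative[OF assms(1)])
  moreover have "((\<lambda>z. ?f (\<lambda>l. z * w l)) has_field_derivative (lvf w (\<lambda>_. 0) k - w k)) (at 0)"
    using eventually_near0_zero[OF mul_right_derivative] assms(2)
    by (intro DERIV_diff) (auto intro!: derivative_eq_intros)
  ultimately have "lvf w (\<lambda>_. 0) k - w k = 0" using DERIV_unique by blast
  then show ?thesis by simp
qed

text \<open>
  The velocity at the point \<open>c z\<close> differs from \<open>w\<close> by at most a constant times
  \<open>|c z| |w|\<close>, that is, by a quantity of order \<open>|w|\<^sup>2\<close>.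
\<close>

lemma tangent_curve:
  assumes "e > 0"
  shows "eventually (\<lambda>w. w \<in> tangent \<longrightarrow> (\<forall>k\<ge>n. w k = 0) \<longrightarrow> (\<exists>c::complex \<Rightarrow> nat \<Rightarrow> complex.
    c 0 = (\<lambda>_. 0) \<and> (\<forall>z\<in>disc2. c z \<in> V \<and> cdist n (c z) (\<lambda>k. z * w k) \<le> e * csize n w \<and>
      (\<forall>k. isCont (\<lambda>z. c z k) z)) \<and>
    ((\<forall>k. w k \<in> \<real>) \<longrightarrow> (\<forall>z\<in>disc2. z \<in> \<real> \<longrightarrow> (\<forall>k. c z k \<in> \<real>))))) (near0 n)"
proof -
  obtain d where d: "d > 0" "\<And>x. csize n x < d \<Longrightarrow>
      \<forall>k<n. \<forall>l<n. g k l (\<lambda>i. cnj (x i)) = cnj (g k l x)"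
    using g_real by (rule near0E) (rule that)
  have "min d \<rho> > 0" using d(1) rho_pos by simp
  with rat_field_exists[of n g "min d \<rho>"] rat_g obtain K \<eta>
    where eta: "\<eta> \<le> min d \<rho>" and rf: "rat_field n g K \<eta>" by blast
  interpret rf: rat_field n g K \<eta> by (rule rf)
  have vf: "rf.vf = lvf" by (intro ext) (simp add: rf.vf_def lvf_def)
  define C where "C = real n * (2 * (real n * (2 * K * K)))"
  have C: "C \<ge> 0" unfolding C_def using rf.K_pos by simp
  define \<delta> where "\<delta> = min rf.small_radius (e / (C + 1))"
  have \<delta>: "\<delta> > 0" unfolding \<delta>_def using rf.small_radius_pos assms C by simp
  have "\<exists>c::complex \<Rightarrow> nat \<Rightarrow> complex.
    c 0 = (\<lambda>_. 0) \<and> (\<forall>z\<in>disc2. c z \<in> V \<and> cdist n (c z) (\<lambda>k. z * w k) \<le> e * csize n w \<and>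
      (\<forall>k. isCont (\<lambda>z. c z k) z)) \<and>
    ((\<forall>k. w k \<in> \<real>) \<longrightarrow> (\<forall>z\<in>disc2. z \<in> \<real> \<longrightarrow> (\<forall>k. c z k \<in> \<real>)))"
    if w: "csize n w < \<delta>" "w \<in> tangent" "\<forall>k\<ge>n. w k = 0" for w
  proof -
    have w_small: "csize n w < rf.small_radius" using w by (simp add: \<delta>_def)
    obtain c where c: "rf.integral_curve w c"
      and c_size: "\<forall>z\<in>disc2. csize n (c z) \<le> real n * (2 * (csize n w * K))"
      and c_supp: "\<forall>z. \<forall>k\<ge>n. c z k = 0"
      using rf.integral_curve_exists[OF w_small] by blast
    have c0: "c 0 k = 0" if "k < n" for k using c that by (simp add: rf.integral_curve_def)
    have c_eta: "csize n (c z) < \<eta>" if "z \<in> disc2" for z using c that by (simp add: rf.integral_curve_def)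
    have c_der: "((\<lambda>z. c z k) has_field_derivative lvf w (c z) k) (at z)" if "z \<in> disc2" "k < n" for z k
      using c that by (simp add: rf.integral_curve_def vf)
    have c0': "c 0 = (\<lambda>_. 0)" using c0 c_supp by (auto simp: fun_eq_iff not_less[symmetric])
    have inV: "c z \<in> V" if "z \<in> disc2" for z
      by (rule curve_in_V[OF w(2) c0 c_der _ _ that]) (use c_supp c_eta eta in force)+
    have cont: "isCont (\<lambda>z. c z k) z" if "z \<in> disc2" for z k
    proof (cases "k < n")
      case True then show ?thesis using c_der[OF that] DERIV_isCont by blast
    next
      case False then show ?thesis using c_supp by simp
    qed
    have close: "cdist n (c z) (\<lambda>k. z * w k) \<le> e * csize n w" if z: "z \<in> disc2" for z
    proof -
      define B where "B = csize n w * K * (real n * (2 * (csize n w * K)))"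
      have B0: "B \<ge> 0" unfolding B_def using rf.K_pos by simp
      have "csize n ((\<lambda>z k. c z k - z * w k) z) \<le> real n * (2 * B)"
      proof (rule bounded_derivative_csize[OF _ _ _ z B0])
        fix k z assume k: "k < n" and z: "z \<in> disc2"
        show "((\<lambda>z. c z k - z * w k) has_field_derivative lvf w (c z) k - w k) (at z)"
          using c_der[OF z k] by (auto intro!: derivative_eq_intros)
        have "cmod (lvf w (c z) k - lvf w (\<lambda>_. 0) k) \<le> csize n w * K * cdist n (c z) (\<lambda>_. 0)"
          unfolding vf[symmetric] by (rule rf.vf_lip[OF k c_eta[OF z]]) (use rf.eta_pos in simp)
        also have "\<dots> \<le> B"
          unfolding B_def using c_size z rf.K_pos by (intro mult_left_mono) auto
        finally show "cmod (lvf w (c z) k - w k) \<le> B" using lvf_zero[OF w(2) k] by simp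
      qed (simp add: c0)
      also have "real n * (2 * B) = C * csize n w * csize n w" unfolding B_def C_def by simp
      also have "\<dots> \<le> e * csize n w"
      proof (rule mult_right_mono)
        have "C * csize n w \<le> (C + 1) * (e / (C + 1))"
          using w(1) C by (intro mult_mono) (auto simp: \<delta>_def)
        then show "C * csize n w \<le> e" using C by simp
      qed simp
      finally show ?thesis by simp
    qed
    have real: "c z k \<in> \<real>" if wr: "\<forall>k. w k \<in> \<real>" and z: "z \<in> disc2" "z \<in> \<real>" for z k
    proof (cases "k < n")
      case False then show ?thesis using c_supp by simp
    next
      case True
      \<comment> \<open>the reflected curve solves the same equation, hence is the same curve\<close>
      define c' where "c' = (\<lambda>z k. cnj (c (cnj z) k))"
      have "rf.integral_curve w c'"
        unfolding rf.integral_curve_def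
      proof (intro conjI ballI allI impI)
        show "c' 0 k = 0" if "k < n" for k using c0 that by (simp add: c'_def)
        fix z :: complex assume "z \<in> disc2"
        then have z': "cnj z \<in> disc2" by simp
        show "csize n (c' z) < \<eta>" using c_eta[OF z'] by (simp add: c'_def)
        fix k assume k: "k < n"
        have "lvf w (\<lambda>i. cnj (c (cnj z) i)) k = (\<Sum>l<n. cnj (w l) * cnj (g k l (c (cnj z))))"
          unfolding lvf_def using d(2)[of "c (cnj z)"] c_eta[OF z'] eta k wr
          by (intro sum.cong) (auto simp: Reals_cnj_iff)
        then have "rf.vf w (c' z) k = cnj (lvf w (c (cnj z)) k)"
          unfolding vf by (simp add: c'_def lvf_def)
        moreover have "((\<lambda>z. c' z k) has_field_derivative cnj (lvf w (c (cnj z)) k)) (at z)"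
          using has_field_derivative_cnj_cnj[OF c_der[OF z' k]] by (simp add: o_def c'_def)
        ultimately show "((\<lambda>z. c' z k) has_field_derivative rf.vf w (c' z) k) (at z)" by simp
      qed
      then have "c z k = c' z k" using rf.integral_curve_unique[OF w_small c] z True by blast
      then show ?thesis using z by (simp add: c'_def Reals_cnj_iff)
    qed
    show ?thesis using c0' inV close cont real by blast
  qed
  then show ?thesis unfolding eventually_near0 using \<delta> by blast
qed

text \<open>
  Smoothness in the form used below: the integral curve of a tangent vector close to \<open>r\<close>.
\<close>

lemma curve_through:
  assumes "e > 0"
  shows "eventually (\<lambda>r. r \<in> V \<longrightarrow> (\<exists>c::complex \<Rightarrow> nat \<Rightarrow> complex. c 0 = (\<lambda>_. 0) \<and>
    (\<forall>t\<in>closed_segment 0 1. c t \<in> V \<and> cdist n (c t) (\<lambda>k. t * r k) \<le> e * csize n r \<and>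
      (\<forall>k. isCont (\<lambda>z. c z k) t) \<and> ((\<forall>k. r k \<in> \<real>) \<longrightarrow> (\<forall>k. c t k \<in> \<real>))))) (near0 n)"
proof -
  define e1 where "e1 = min 1 (e / 3)"
  have e1: "e1 > 0" "e1 \<le> 1" "3 * e1 \<le> e" using assms by (auto simp: e1_def)
  obtain d1 where d1: "d1 > 0" "\<And>r. csize n r < d1 \<Longrightarrow> r \<in> V \<longrightarrow> (\<exists>w\<in>tangent. (\<forall>k\<ge>n. w k = 0) \<and>
    cdist n r w \<le> e1 * csize n r \<and> ((\<forall>k. r k \<in> \<real>) \<longrightarrow> (\<forall>k. w k \<in> \<real>)))"
    using tangent_approx[OF e1(1)] by (rule near0E) (rule that)
  obtain d2 where d2: "d2 > 0" "\<And>w. csize n w < d2 \<Longrightarrow> w \<in> tangent \<longrightarrow> (\<forall>k\<ge>n. w k = 0) \<longrightarrow> (\<exists>c::complex \<Rightarrow> nat \<Rightarrow> complex.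
    c 0 = (\<lambda>_. 0) \<and> (\<forall>z\<in>disc2. c z \<in> V \<and> cdist n (c z) (\<lambda>k. z * w k) \<le> e1 * csize n w \<and>
      (\<forall>k. isCont (\<lambda>z. c z k) z)) \<and>
    ((\<forall>k. w k \<in> \<real>) \<longrightarrow> (\<forall>z\<in>disc2. z \<in> \<real> \<longrightarrow> (\<forall>k. c z k \<in> \<real>))))"
    using tangent_curve[OF e1(1)] by (rule near0E) (rule that)
  have "\<exists>c::complex \<Rightarrow> nat \<Rightarrow> complex. c 0 = (\<lambda>_. 0) \<and>
    (\<forall>t\<in>closed_segment 0 1. c t \<in> V \<and> cdist n (c t) (\<lambda>k. t * r k) \<le> e * csize n r \<and>
      (\<forall>k. isCont (\<lambda>z. c z k) t) \<and> ((\<forall>k. r k \<in> \<real>) \<longrightarrow> (\<forall>k. c t k \<in> \<real>)))"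
    if r: "csize n r < min d1 (d2 / 2)" "r \<in> V" for r
  proof -
    obtain w where w: "w \<in> tangent" "\<forall>k\<ge>n. w k = 0" "cdist n r w \<le> e1 * csize n r"
      "(\<forall>k. r k \<in> \<real>) \<longrightarrow> (\<forall>k. w k \<in> \<real>)"
      using d1(2)[of r] r by auto
    have wr: "csize n w \<le> 2 * csize n r"
    proof -
      have "csize n w \<le> cdist n r w + csize n r"
        using csize_le_cdist[of n w r] cdist_commute[of n r w] by simp
      also have "\<dots> \<le> 1 * csize n r + csize n r"
        using w(3) mult_right_mono[OF e1(2), of "csize n r"] by simp
      finally show ?thesis by simp
    qed
    then have "csize n w < d2" using r by simp
    then obtain c where c: "c 0 = (\<lambda>_. 0)" "\<forall>z\<in>disc2. c z \<in> V \<and> cdist n (c z) (\<lambda>k. z * w k) \<le> e1 * csize n w \<and>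
      (\<forall>k. isCont (\<lambda>z. c z k) z)"
      "(\<forall>k. w k \<in> \<real>) \<longrightarrow> (\<forall>z\<in>disc2. z \<in> \<real> \<longrightarrow> (\<forall>k. c z k \<in> \<real>))"
      using d2(2) w(1,2) by blast
    show ?thesis
    proof (intro exI[of _ c] conjI ballI c(1))
      fix t :: complex assume "t \<in> closed_segment 0 1"
      then obtain s where s: "0 \<le> s" "s \<le> 1" "t = of_real s"
        unfolding closed_segment_def by (auto simp: scaleR_conv_of_real)
      have t: "t \<in> disc2" "t \<in> \<real>" using s by auto
      show "c t \<in> V" using c(2) t by blast
      show "\<forall>k. isCont (\<lambda>z. c z k) t" using c(2) t by blast
      show "(\<forall>k. r k \<in> \<real>) \<longrightarrow> (\<forall>k. c t k \<in> \<real>)" using c(3) t w(4) by blast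
      have "cdist n (c t) (\<lambda>k. t * r k) \<le> cdist n (c t) (\<lambda>k. t * w k) + cdist n (\<lambda>k. t * w k) (\<lambda>k. t * r k)"
        by (rule cdist_triangle)
      also have "cdist n (\<lambda>k. t * w k) (\<lambda>k. t * r k) = s * cdist n r w"
        using s csize_scale[of n t "\<lambda>k. w k - r k"] cdist_commute[of n w r] by (simp add: algebra_simps)
      also have "cdist n (c t) (\<lambda>k. t * w k) + s * cdist n r w \<le> e1 * (2 * csize n r) + 1 * (e1 * csize n r)"
      proof (rule add_mono)
        have "cdist n (c t) (\<lambda>k. t * w k) \<le> e1 * csize n w" using c(2) t by blast
        also have "\<dots> \<le> e1 * (2 * csize n r)" using wr e1 by (intro mult_left_mono) auto
        finally show "cdist n (c t) (\<lambda>k. t * w k) \<le> e1 * (2 * csize n r)" .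
        show "s * cdist n r w \<le> 1 * (e1 * csize n r)" using s w(3) by (intro mult_mono) auto
      qed
      also have "\<dots> = 3 * e1 * csize n r" by simp
      also have "\<dots> \<le> e * csize n r" using e1 by (intro mult_right_mono) auto
      finally show "cdist n (c t) (\<lambda>k. t * r k) \<le> e * csize n r" .
    qed
  qed
  moreover have "min d1 (d2 / 2) > 0" using d1(1) d2(1) by simp
  ultimately show ?thesis unfolding eventually_near0 by blast
qed

text \<open>
  By strict differentiability, \<open>M(x, y) - M(x, 0)\<close> and \<open>M(0, y) - M(0, 0)\<close> agree up to
  \<open>e |y|\<close>.
\<close>

lemma mul_almost_additive:
  assumes "e > 0"
  shows "\<exists>d>0. \<forall>x\<in>V. \<forall>y\<in>V. csize n x < d \<longrightarrow> csize n y < d \<longrightarrow>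
    cdist n (mul x y) (\<lambda>k. x k + y k) \<le> e * csize n y"
proof -
  define e1 where "e1 = e / (2 * real n + 1)"
  have e1: "e1 > 0" "real n * (2 * e1) \<le> e"
    using assms by (auto simp: e1_def field_simps)
  have "eventually (\<lambda>d. \<forall>k\<in>{..<n}. \<forall>x y. csize (n + n) x < d \<longrightarrow> csize (n + n) y < d \<longrightarrow>
    cmod (M k x - M k y - (\<Sum>l<n+n. M' k l (\<lambda>_. 0) * (x l - y l))) \<le> e1 * cdist (n + n) x y) (at_right 0)"
  proof (intro eventually_ball_finite ballI)
    fix k assume "k \<in> {..<n}"
    then obtain d where d: "d > 0" "\<forall>x y. csize (n + n) x < d \<longrightarrow> csize (n + n) y < d \<longrightarrow>
      cmod (M k x - M k y - (\<Sum>l<n+n. M' k l (\<lambda>_. 0) * (x l - y l))) \<le> e1 * cdist (n + n) x y"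
      using rat_germ_strict[OF M' e1(1)] by blast
    have "eventually (\<lambda>d'. d' < d) (at_right 0)"
      unfolding eventually_at_right_field using d(1) by blast
    then show "eventually (\<lambda>d. \<forall>x y. csize (n + n) x < d \<longrightarrow> csize (n + n) y < d \<longrightarrow>
      cmod (M k x - M k y - (\<Sum>l<n+n. M' k l (\<lambda>_. 0) * (x l - y l))) \<le> e1 * cdist (n + n) x y) (at_right 0)"
      by eventually_elim (use d(2) in \<open>meson less_trans\<close>)
  qed simp
  then obtain b where b: "b > 0" "\<And>d. 0 < d \<Longrightarrow> d < b \<Longrightarrow> \<forall>k\<in>{..<n}. \<forall>x y. csize (n + n) x < d \<longrightarrow> csize (n + n) y < d \<longrightarrow>
    cmod (M k x - M k y - (\<Sum>l<n+n. M' k l (\<lambda>_. 0) * (x l - y l))) \<le> e1 * cdist (n + n) x y"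
    unfolding eventually_at_right_field by blast
  define d where "d = b / 2"
  have d: "d > 0" "d < b" using b(1) by (auto simp: d_def)
  define d' where "d' = min (d / 2) \<rho>"
  have d': "d' > 0" "d' \<le> d / 2" "d' \<le> \<rho>" using d rho_pos by (auto simp: d'_def)
  have "cdist n (mul x y) (\<lambda>k. x k + y k) \<le> e * csize n y"
    if V: "x \<in> V" "y \<in> V" and size: "csize n x < d'" "csize n y < d'" for x y
  proof -
    have "csize n (\<lambda>k. mul x y k - (x k + y k)) \<le> real n * (2 * e1 * csize n y)"
    proof (rule csize_le_bound)
      fix k assume k: "k < n"
      let ?L = "\<lambda>z. \<Sum>l<n+n. M' k l (\<lambda>_. 0) * z l"
      have strict: "cmod (M k x - M k y - ?L (\<lambda>l. x l - y l)) \<le> e1 * cdist (n + n) x y"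
        if "csize (n + n) x < d" "csize (n + n) y < d" for x y
        using b(2)[OF d] k that by blast
      have eq: "join n a y l - join n a (\<lambda>_. 0) l = join n (\<lambda>_. 0) y l" for a l
        by (simp add: join_def)
      have 1: "cmod (M k (join n a y) - M k (join n a (\<lambda>_. 0)) - ?L (join n (\<lambda>_. 0) y)) \<le> e1 * csize n y"
        if "csize n a < d'" for a
        using strict[of "join n a y" "join n a (\<lambda>_. 0)"] that size d' unfolding eq csize_join by simp
      have "M k (join n x (\<lambda>_. 0)) = x k" "M k (join n (\<lambda>_. 0) y) = y k" "M k (join n (\<lambda>_. 0) (\<lambda>_. 0)) = 0"
        using M_unit(1)[OF V(1) _ k] M_unit(2)[OF V(2) _ k] M_unit(1)[OF zero_in_V _ k] size d' rho_pos by auto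
      then have "cmod (M k (join n x y) - x k - ?L (join n (\<lambda>_. 0) y)) \<le> e1 * csize n y"
        "cmod (y k - 0 - ?L (join n (\<lambda>_. 0) y)) \<le> e1 * csize n y"
        using 1[OF size(1)] 1[of "\<lambda>_. 0"] d' by auto
      then have "cmod ((M k (join n x y) - x k - ?L (join n (\<lambda>_. 0) y)) - (y k - 0 - ?L (join n (\<lambda>_. 0) y)))
          \<le> e1 * csize n y + e1 * csize n y"
        using norm_triangle_ineq4 add_mono order_trans by blast
      then show "cmod (mul x y k - (x k + y k)) \<le> 2 * e1 * csize n y"
        using k by (simp add: mul_def algebra_simps)
    qed
    also have "\<dots> \<le> e * csize n y"
      using mult_right_mono[OF e1(2), of "csize n y"] by (simp add: mult.assoc)
    finally show ?thesis .
  qed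
  then show ?thesis using d'(1) by blast
qed

end

section \<open>The strong topology of a real algebraic variety\<close>

lemma continuous_map_mult_complex:
  fixes f g :: "'a \<Rightarrow> complex"
  assumes "continuous_map X euclidean f" "continuous_map X euclidean g"
  shows "continuous_map X euclidean (\<lambda>x. f x * g x)"
  using assms by (simp add: continuous_map_atin tendsto_mult)

lemma continuous_map_sum_complex:
  fixes f :: "nat \<Rightarrow> 'a \<Rightarrow> complex"
  assumes "\<And>k. k < m \<Longrightarrow> continuous_map X euclidean (f k)"
  shows "continuous_map X euclidean (\<lambda>x. \<Sum>k<m. f k x)"
  using assms by (auto simp: continuous_map_atin intro!: tendsto_sum)

lemma strong_generator:
  "openin (zariski X) W \<Longrightarrow> f \<in> reg X W \<Longrightarrow> open D \<Longrightarrow> openin (strong_topology X) {x \<in> W. f x \<in> D}"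
  unfolding strong_topology_def by (rule topology_generated_by_Basis) blast

lemma topspace_strong_subset: "topspace (strong_topology X) \<subseteq> topspace (zariski X)"
  unfolding strong_topology_def topology_generated_by_topspace using openin_subset by fastforce

lemma continuous_map_into_strong:
  assumes "f \<in> topspace T \<rightarrow> topspace (strong_topology Y)"
    and "\<And>W h D. openin (zariski Y) W \<Longrightarrow> h \<in> reg Y W \<Longrightarrow> open D \<Longrightarrow>
      openin T {x \<in> topspace T. f x \<in> W \<and> h (f x) \<in> D}"
  shows "continuous_map T (strong_topology Y) f"
  unfolding strong_topology_def continuous_on_generated_topo_iff
proof (intro conjI allI impI)
  fix U assume "U \<in> {{x \<in> U. f x \<in> D} | U f D. openin (zariski Y) U \<and> f \<in> reg Y U \<and> open D}"
  then obtain W h D where W: "openin (zariski Y) W" "h \<in> reg Y W" "open D" "U = {x \<in> W. h x \<in> D}" by blast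
  have "f -` U \<inter> topspace T = {x \<in> topspace T. f x \<in> W \<and> h (f x) \<in> D}" using W(4) by auto
  then show "openin T (f -` U \<inter> topspace T)" using assms(2)[OF W(1-3)] by simp
next
  show "f ` topspace T \<subseteq> \<Union> {{x \<in> U. f x \<in> D} | U f D. openin (zariski Y) U \<and> f \<in> reg Y U \<and> open D}"
    using assms(1) unfolding strong_topology_def topology_generated_by_topspace by blast
qed

lemma real_map_strong_continuous:
  assumes "real_map X Y \<phi>" "topspace (strong_topology Y) = topspace (zariski Y)"
  shows "continuous_map (strong_topology X) (strong_topology Y) \<phi>"
proof (rule continuous_map_into_strong)
  have cont: "continuous_map (zariski X) (zariski Y) \<phi>" using assms(1) by (simp add: real_map_def)
  then show "\<phi> \<in> topspace (strong_topology X) \<rightarrow> topspace (strong_topology Y)"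
    using topspace_strong_subset[of X] assms(2) by (auto simp: continuous_map_def)
  fix W h D assume W: "openin (zariski Y) W" "h \<in> reg Y W" "open (D::complex set)"
  have "openin (strong_topology X) {x \<in> {x \<in> topspace (zariski X). \<phi> x \<in> W}. h (\<phi> x) \<in> D}"
    using assms(1) W by (intro strong_generator openin_continuous_map_preimage[OF cont]) (auto simp: real_map_def)
  then have "openin (strong_topology X) (topspace (strong_topology X) \<inter> {x \<in> {x \<in> topspace (zariski X). \<phi> x \<in> W}. h (\<phi> x) \<in> D})"
    by (intro openin_Int openin_topspace)
  also have "topspace (strong_topology X) \<inter> {x \<in> {x \<in> topspace (zariski X). \<phi> x \<in> W}. h (\<phi> x) \<in> D} =
      {x \<in> topspace (strong_topology X). \<phi> x \<in> W \<and> h (\<phi> x) \<in> D}"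
    using topspace_strong_subset[of X] by auto
  finally show "openin (strong_topology X) {x \<in> topspace (strong_topology X). \<phi> x \<in> W \<and> h (\<phi> x) \<in> D}" .
qed

lemma poly_funs_continuous: "p \<in> poly_funs K n \<Longrightarrow> continuous_on S p"
proof (induction rule: poly_funs.induct)
  case (coord k)
  show ?case by (rule continuous_on_subset[OF continuous_on_product_coordinates]) simp
qed (auto intro: continuous_intros)

lemma closed_real_affine_set:
  assumes "real_affine_set n V"
  shows "closed V"
proof -
  obtain S where S: "S \<subseteq> poly_funs \<real> n" "V = {x \<in> affine_space n. \<forall>p\<in>S. p x = 0}"
    using assms unfolding real_affine_set_def by blast
  have "closed {x::nat \<Rightarrow> complex. x k = 0}" for k
    using continuous_closed_preimage_constant[of UNIV "\<lambda>x::nat \<Rightarrow> complex. x k" 0] continuous_on_product_coordinates[of k]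
    by simp
  then have "closed (\<Inter>k\<in>{n..}. {x::nat \<Rightarrow> complex. x k = 0})" by (intro closed_INT) auto
  moreover have "closed {x. p x = 0}" if "p \<in> S" for p
    using continuous_closed_preimage_constant[of UNIV p 0] poly_funs_continuous[of p _ n UNIV] S that by auto
  then have "closed (\<Inter>p\<in>S. {x. p x = 0})" by (intro closed_INT) auto
  ultimately have "closed ((\<Inter>k\<in>{n..}. {x::nat \<Rightarrow> complex. x k = 0}) \<inter> (\<Inter>p\<in>S. {x. p x = 0}))"
    by (rule closed_Int)
  also have "(\<Inter>k\<in>{n..}. {x::nat \<Rightarrow> complex. x k = 0}) \<inter> (\<Inter>p\<in>S. {x. p x = 0}) = V"
    unfolding S(2) affine_space_def by auto
  finally show ?thesis .
qed

lemma poly_funs_mono: "p \<in> poly_funs K n \<Longrightarrow> K \<subseteq> L \<Longrightarrow> p \<in> poly_funs L n"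
  by (induction rule: poly_funs.induct) (auto intro: poly_funs.intros)

lemma affine_variety_zariski:
  "zariski (affine_variety n V) = topology_generated_by {{x \<in> V. p x \<noteq> 0} | p. p \<in> poly_funs UNIV n}"
  by (simp add: affine_variety_def Let_def)

lemma affine_variety_gal: "gal (affine_variety n V) x = (\<lambda>k. cnj (x k))"
  by (simp add: affine_variety_def Let_def)

lemma affine_variety_reg: "f \<in> reg (affine_variety n V) U \<longleftrightarrow>
  (\<forall>x\<in>U. \<exists>W. openin (zariski (affine_variety n V)) W \<and> x \<in> W \<and> W \<subseteq> U \<and>
    (\<exists>p\<in>poly_funs UNIV n. \<exists>q\<in>poly_funs UNIV n. \<forall>y\<in>W. q y \<noteq> 0 \<and> f y = p y / q y))"
  by (simp add: affine_variety_def Let_def)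

lemma Union_basic_opens: "\<Union>{{x \<in> V. p x \<noteq> 0} | p. p \<in> poly_funs UNIV n} = V"
proof (intro equalityI subsetI)
  fix x assume x: "x \<in> V"
  show "x \<in> \<Union>{{x \<in> V. p x \<noteq> 0} | p. p \<in> poly_funs UNIV n}"
  proof (rule UnionI)
    show "{x \<in> V. (\<lambda>_. 1) x \<noteq> (0::complex)} \<in> {{x \<in> V. p x \<noteq> 0} | p. p \<in> poly_funs UNIV n}"
      by (intro CollectI exI[of _ "\<lambda>_. 1"] conjI refl poly_funs.const) simp
  qed (simp add: x)
qed blast

lemma affine_variety_topspace [simp]: "topspace (zariski (affine_variety n V)) = V"
  unfolding affine_variety_zariski topology_generated_by_topspace by (rule Union_basic_opens)

text \<open>
  Complements of zero sets of polynomials are open in the product topology of \<open>\<complex>\<close>-valued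
  sequences, which induces the usual topology on \<open>\<complex>\<^sup>n\<close>.
\<close>

lemma affine_zariski_open_is_open:
  assumes "openin (zariski (affine_variety n V)) W"
  shows "openin (top_of_set V) W"
proof -
  have "continuous_map (top_of_set V) (zariski (affine_variety n V)) id"
    unfolding affine_variety_zariski continuous_on_generated_topo_iff
  proof (intro conjI allI impI)
    fix U assume "U \<in> {{x \<in> V. p x \<noteq> 0} |p. p \<in> poly_funs UNIV n}"
    then obtain p where p: "p \<in> poly_funs UNIV n" "U = {x \<in> V. p x \<noteq> 0}" by blast
    have "openin (top_of_set V) (V \<inter> p -` (- {0}))"
      by (rule continuous_openin_preimage_gen[OF poly_funs_continuous[OF p(1)]]) auto
    moreover have "V \<inter> p -` (- {0}) = id -` U \<inter> topspace (top_of_set V)" using p(2) by auto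
    ultimately show "openin (top_of_set V) (id -` U \<inter> topspace (top_of_set V))" by simp
  next
    show "id ` topspace (top_of_set V) \<subseteq> \<Union> {{x \<in> V. p x \<noteq> 0} |p. p \<in> poly_funs UNIV n}"
      unfolding Union_basic_opens by simp
  qed
  from openin_continuous_map_preimage[OF this assms]
  have "openin (top_of_set V) {x \<in> V. x \<in> W}" by simp
  moreover have "W \<subseteq> V" using openin_subset[OF assms] by simp
  then have "{x \<in> V. x \<in> W} = W" by blast
  ultimately show ?thesis by simp
qed

text \<open>
  One affine chart of a real variety: the witness of \<open>real_variety\<close> with its inverse named.
\<close>

locale chart =
  fixes X :: "'a rspace" and U :: "'a set" and n :: nat and V :: "(nat \<Rightarrow> complex) set"
    and \<phi> :: "'a \<Rightarrow> nat \<Rightarrow> complex" and \<psi> :: "(nat \<Rightarrow> complex) \<Rightarrow> 'a"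
  assumes sheaf: "function_sheaf X" and U_open: "openin (zariski X) U" and gal_U: "gal X ` U = U"
    and V_affine: "real_affine_set n V"
    and phi: "real_map (open_subspace X U) (affine_variety n V) \<phi>"
    and psi: "real_map (affine_variety n V) (open_subspace X U) \<psi>"
    and psi_phi: "x \<in> U \<Longrightarrow> \<psi> (\<phi> x) = x" and phi_psi: "y \<in> V \<Longrightarrow> \<phi> (\<psi> y) = y"
begin

lemma U_subset: "U \<subseteq> topspace (zariski X)"
  using U_open by (rule openin_subset)

lemma topspace_sub: "topspace (zariski (open_subspace X U)) = U"
  using U_subset by (auto simp: open_subspace_def)

lemma phi_in: "x \<in> U \<Longrightarrow> \<phi> x \<in> V"
  using phi topspace_sub by (auto simp: real_map_def continuous_map_def)

lemma psi_in: "y \<in> V \<Longrightarrow> \<psi> y \<in> U"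
  using psi topspace_sub by (auto simp: real_map_def continuous_map_def)

lemma phi_gal: "x \<in> U \<Longrightarrow> \<phi> (gal X x) = (\<lambda>k. cnj (\<phi> x k))"
  using phi topspace_sub by (auto simp: real_map_def affine_variety_gal open_subspace_def)

lemma gal_in: "x \<in> U \<Longrightarrow> gal X x \<in> U"
  using gal_U by blast

lemma gal_gal: "x \<in> U \<Longrightarrow> gal X (gal X x) = x"
  using phi_gal[of x] phi_gal[OF gal_in, of x] psi_phi[of x] psi_phi[OF gal_in[OF gal_in], of x] by simp

lemma V_support: "y \<in> V \<Longrightarrow> k \<ge> n \<Longrightarrow> y k = 0"
  using V_affine unfolding real_affine_set_def affine_space_def by auto

lemma closed_V: "closed V"
  by (rule closed_real_affine_set[OF V_affine])

lemma reg_restrict: "openin (zariski X) W \<Longrightarrow> openin (zariski X) W' \<Longrightarrow> W' \<subseteq> W \<Longrightarrow> f \<in> reg X W \<Longrightarrow> f \<in> reg X W'"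
  using sheaf unfolding function_sheaf_def by blast

lemma poly_reg:
  assumes "p \<in> poly_funs UNIV n"
  shows "(\<lambda>x. p (\<phi> x)) \<in> reg X U"
proof -
  have V: "openin (zariski (affine_variety n V)) V"
    using openin_topspace[of "zariski (affine_variety n V)"] by simp
  have one: "(\<lambda>_. 1) \<in> poly_funs UNIV n" by (rule poly_funs.const) simp
  have "p \<in> reg (affine_variety n V) V"
    unfolding affine_variety_reg
    by (rule ballI, rule exI[of _ V], intro conjI, rule V, assumption, rule subset_refl,
        rule bexI[OF _ assms], rule bexI[OF _ one], simp)
  moreover have "openin (zariski (affine_variety n V)) V"
    using openin_topspace[of "zariski (affine_variety n V)"] by simp
  ultimately have "(\<lambda>x. p (\<phi> x)) \<in> reg (open_subspace X U) {x \<in> topspace (zariski (open_subspace X U)). \<phi> x \<in> V}"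
    using phi unfolding real_map_def by blast
  moreover have "{x \<in> topspace (zariski (open_subspace X U)). \<phi> x \<in> V} = U"
    using topspace_sub phi_in by auto
  ultimately show ?thesis by (simp add: open_subspace_def)
qed

lemma coord_reg: "(\<lambda>x. \<phi> x k) \<in> reg X U"
proof (cases "k < n")
  case True then show ?thesis using poly_reg[OF poly_funs.coord] by blast
next
  case False
  then have "\<phi> x k = 0" if "x \<in> U" for x using V_support[OF phi_in[OF that]] by simp
  moreover have "(\<lambda>x. 0) \<in> reg X U" using poly_reg[OF poly_funs.const, of 0] by simp
  ultimately show ?thesis using sheaf U_open unfolding function_sheaf_def by metis
qed

lemma const_reg: "(\<lambda>x. c) \<in> reg X U"
  using poly_reg[OF poly_funs.const, of c] by simp

lemma reg_local_rational:
  assumes W: "openin (zariski X) W" "f \<in> reg X W" "x \<in> W" "x \<in> U"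
  shows "\<exists>p\<in>poly_funs UNIV n. \<exists>q\<in>poly_funs UNIV n. \<exists>N. open N \<and> \<phi> x \<in> N \<and>
    (\<forall>y\<in>V \<inter> N. \<psi> y \<in> W \<and> q y \<noteq> 0 \<and> f (\<psi> y) = p y / q y)"
proof -
  have WU: "openin (zariski X) (W \<inter> U)" using W U_open by blast
  have f: "f \<in> reg X (W \<inter> U)" using reg_restrict[OF W(1) WU _ W(2)] by blast
  have "openin (zariski (open_subspace X U)) (W \<inter> U)"
    unfolding open_subspace_def using W(1) by (auto simp: openin_subtopology)
  moreover have "f \<in> reg (open_subspace X U) (W \<inter> U)" using f by (simp add: open_subspace_def)
  ultimately have "(\<lambda>y. f (\<psi> y)) \<in> reg (affine_variety n V)
      {y \<in> topspace (zariski (affine_variety n V)). \<psi> y \<in> W \<inter> U}"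
    using psi unfolding real_map_def by blast
  then have reg: "(\<lambda>y. f (\<psi> y)) \<in> reg (affine_variety n V) {y \<in> V. \<psi> y \<in> W \<inter> U}"
    by (simp only: affine_variety_topspace)
  have mem: "\<phi> x \<in> {y \<in> V. \<psi> y \<in> W \<inter> U}" using phi_in psi_phi W by auto
  from reg[unfolded affine_variety_reg, THEN bspec, OF mem] obtain O' p q where O': "openin (zariski (affine_variety n V)) O'" "\<phi> x \<in> O'"
    "O' \<subseteq> {y \<in> V. \<psi> y \<in> W \<inter> U}" and pq: "p \<in> poly_funs UNIV n" "q \<in> poly_funs UNIV n"
    "\<forall>y\<in>O'. q y \<noteq> 0 \<and> f (\<psi> y) = p y / q y"
    by (elim exE conjE bexE) (rule that; assumption)
  obtain N where N: "open N" "O' = V \<inter> N"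
    using affine_zariski_open_is_open[OF O'(1)] unfolding openin_open by blast
  show ?thesis
    using pq O' N by (intro bexI[of _ p] bexI[of _ q] exI[of _ N]) auto
qed

lemma strong_open_U: "openin (strong_topology X) W" if "openin (zariski X) W" "W \<subseteq> U"
proof -
  have "(\<lambda>x. 0) \<in> reg X W" using reg_restrict[OF U_open that] const_reg by blast
  from strong_generator[OF that(1) this open_UNIV] show ?thesis by simp
qed

lemma U_strong: "openin (strong_topology X) U"
  using strong_open_U[OF U_open] by simp

lemma topspace_strong_U: "topspace (subtopology (strong_topology X) U) = U"
  using openin_subset[OF U_strong] by auto

text \<open>
  The coordinates are regular, hence continuous. Conversely, regular functions are locally quotients of
  polynomials in the coordinates, so the topology that makes them continuous is not finer.
\<close>

lemma chart_homeomorphic: "homeomorphic_maps (subtopology (strong_topology X) U) (top_of_set V) \<phi> \<psi>"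
  unfolding homeomorphic_maps_def topspace_strong_U
proof (intro conjI ballI)
  have "continuous_map (subtopology (strong_topology X) U) euclidean (\<lambda>x. \<phi> x k)" for k
    unfolding continuous_map_def topspace_strong_U
  proof (intro conjI allI impI)
    fix D :: "complex set" assume "openin euclidean D"
    then show "openin (subtopology (strong_topology X) U) {x \<in> U. \<phi> x k \<in> D}"
      using strong_generator[OF U_open coord_reg] openin_open_subtopology[OF U_strong] by auto
  qed auto
  then have "continuous_map (subtopology (strong_topology X) U) (product_topology (\<lambda>_. euclidean) UNIV) \<phi>"
    by (simp add: continuous_map_componentwise_UNIV)
  then show "continuous_map (subtopology (strong_topology X) U) (top_of_set V) \<phi>"
    using phi_in topspace_strong_U by (auto simp: euclidean_product_topology continuous_map_in_subtopology)
  have "continuous_map (top_of_set V) (strong_topology X) \<psi>"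
  proof (rule continuous_map_into_strong)
    show "\<psi> \<in> topspace (top_of_set V) \<rightarrow> topspace (strong_topology X)"
      using psi_in openin_subset[OF U_strong] by auto
    fix W h D assume W: "openin (zariski X) W" "h \<in> reg X W" "open (D::complex set)"
    show "openin (top_of_set V) {y \<in> topspace (top_of_set V). \<psi> y \<in> W \<and> h (\<psi> y) \<in> D}"
      unfolding topspace_euclidean_subtopology
    proof (subst openin_subopen, intro ballI)
      fix y assume y: "y \<in> {y \<in> V. \<psi> y \<in> W \<and> h (\<psi> y) \<in> D}"
      then obtain p q N where pq: "p \<in> poly_funs UNIV n" "q \<in> poly_funs UNIV n" and N: "open N" "y \<in> N"
        "\<forall>y\<in>V \<inter> N. \<psi> y \<in> W \<and> q y \<noteq> 0 \<and> h (\<psi> y) = p y / q y"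
        using reg_local_rational[OF W(1,2), of "\<psi> y"] psi_in phi_psi by auto
      have cont: "continuous_on (V \<inter> N) (\<lambda>y. p y / q y)"
        using N(3) pq by (intro continuous_intros poly_funs_continuous) auto
      have "openin (top_of_set (V \<inter> N)) (V \<inter> N \<inter> (\<lambda>y. p y / q y) -` D)"
        by (rule continuous_openin_preimage_gen[OF cont W(3)])
      then have "openin (top_of_set V) (V \<inter> N \<inter> (\<lambda>y. p y / q y) -` D)"
        using N(1) openin_trans openin_open_Int by blast
      moreover have "V \<inter> N \<inter> (\<lambda>y. p y / q y) -` D \<subseteq> {y \<in> V. \<psi> y \<in> W \<and> h (\<psi> y) \<in> D}"
        using N(3) by auto
      moreover have "y \<in> V \<inter> N \<inter> (\<lambda>y. p y / q y) -` D" using y N by auto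
      ultimately show "\<exists>T. openin (top_of_set V) T \<and> y \<in> T \<and> T \<subseteq> {y \<in> V. \<psi> y \<in> W \<and> h (\<psi> y) \<in> D}" by blast
    qed
  qed
  then show "continuous_map (top_of_set V) (subtopology (strong_topology X) U) \<psi>"
    using psi_in by (auto simp: continuous_map_in_subtopology)
  show "\<psi> (\<phi> x) = x" if "x \<in> U" for x using psi_phi that .
  show "\<phi> (\<psi> y) = y" if "y \<in> topspace (top_of_set V)" for y using phi_psi that by simp
qed

lemma continuous_psi: "continuous_map (top_of_set V) (strong_topology X) \<psi>"
  using chart_homeomorphic by (auto simp: homeomorphic_maps_def continuous_map_in_subtopology)

lemma continuous_coord: "continuous_map (subtopology (strong_topology X) U) euclidean (\<lambda>x. \<phi> x k)"
proof -
  have "continuous_map (subtopology (strong_topology X) U) (product_topology (\<lambda>_. euclidean) UNIV) \<phi>"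
    using chart_homeomorphic by (auto simp: homeomorphic_maps_def continuous_map_in_subtopology euclidean_product_topology)
  then show ?thesis by (simp add: continuous_map_componentwise_UNIV)
qed

lemma continuous_dist: "continuous_map (subtopology (strong_topology X) U) euclidean (\<lambda>x. cdist n (\<phi> x) a)"
  using continuous_coord unfolding csize_def
  by (simp add: continuous_map_atin tendsto_sum tendsto_norm tendsto_diff)

lemma open_ball_chart: "openin (strong_topology X) {x \<in> U. cdist n (\<phi> x) a < d}"
proof -
  have "openin (subtopology (strong_topology X) U) {x \<in> topspace (subtopology (strong_topology X) U). cdist n (\<phi> x) a \<in> {..<d}}"
    by (rule openin_continuous_map_preimage[OF continuous_dist]) auto
  then show ?thesis unfolding topspace_strong_U using openin_trans_full[OF _ U_strong] by simp
qed

lemma compact_ball_V: "compact {y \<in> V. cdist n y a \<le> d}"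
proof -
  define b where "b = csize n a + d"
  have "continuous_on UNIV (\<lambda>y::nat \<Rightarrow> complex. cdist n y a)"
    unfolding csize_def by (intro continuous_intros) (rule continuous_on_product_coordinates)
  then have "closed {y::nat \<Rightarrow> complex. cdist n y a \<le> d}"
    using continuous_closed_preimage[of UNIV "\<lambda>y::nat \<Rightarrow> complex. cdist n y a" "{..d}"]
    by (simp add: vimage_def)
  then have "compact ({x::nat \<Rightarrow> complex. (\<forall>k<n. cmod (x k) \<le> b) \<and> (\<forall>k\<ge>n. x k = 0)} \<inter> (V \<inter> {y. cdist n y a \<le> d}))"
    using compact_polydisc closed_V by (intro compact_Int_closed closed_Int)
  moreover have "cmod (y k) \<le> b" if "cdist n y a \<le> d" "k < n" for y k
    using cmod_le_csize[OF that(2), of y] csize_le_cdist[of n y a] that(1) by (simp add: b_def)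
  then have "{x::nat \<Rightarrow> complex. (\<forall>k<n. cmod (x k) \<le> b) \<and> (\<forall>k\<ge>n. x k = 0)} \<inter> (V \<inter> {y. cdist n y a \<le> d}) =
      {y \<in> V. cdist n y a \<le> d}" using V_support by auto
  ultimately show ?thesis by simp
qed

lemma compact_ball_chart: "compactin (strong_topology X) {x \<in> U. cdist n (\<phi> x) a \<le> d}"
proof -
  have "compactin (top_of_set V) {y \<in> V. cdist n y a \<le> d}"
    using compact_ball_V by (auto simp: compactin_subtopology)
  from image_compactin[OF this continuous_psi]
  have "compactin (strong_topology X) (\<psi> ` {y \<in> V. cdist n y a \<le> d})" .
  also have "\<psi> ` {y \<in> V. cdist n y a \<le> d} = {x \<in> U. cdist n (\<phi> x) a \<le> d}"
    using phi_in psi_in phi_psi psi_phi by (auto simp: image_iff) metis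
  finally show ?thesis .
qed

lemma open_contains_ball:
  assumes "openin (strong_topology X) W" "x \<in> W" "x \<in> U"
  shows "\<exists>d>0. {y \<in> U. cdist n (\<phi> y) (\<phi> x) < d} \<subseteq> W"
proof -
  have "openin (top_of_set V) {y \<in> V. \<psi> y \<in> W}"
    using openin_continuous_map_preimage[OF continuous_psi assms(1)] by simp
  then obtain N where N: "open N" "{y \<in> V. \<psi> y \<in> W} = V \<inter> N" unfolding openin_open by blast
  have xN: "\<phi> x \<in> N" using N assms phi_in psi_phi by auto
  obtain Y where Y: "\<phi> x \<in> PiE UNIV Y" "\<And>i. open (Y i)" "finite {i. Y i \<noteq> UNIV}" "PiE UNIV Y \<subseteq> N"
    using product_topology_open_contains_basis[of "\<lambda>_. euclidean" UNIV N "\<phi> x"] N(1) xN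
    unfolding euclidean_product_topology by auto
  have "\<exists>d>0. \<forall>z. dist z (\<phi> x k) < d \<longrightarrow> z \<in> Y k" for k
    using Y(1,2) by (auto simp: open_dist)
  then obtain d where d: "\<And>k. d k > 0" "\<And>k z. dist z (\<phi> x k) < d k \<Longrightarrow> z \<in> Y k" by metis
  define \<delta> where "\<delta> = Min (insert 1 (d ` {..<n}))"
  have \<delta>: "\<delta> > 0" unfolding \<delta>_def using d(1) by (subst Min_gr_iff) auto
  have "\<phi> y \<in> N" if y: "y \<in> U" "cdist n (\<phi> y) (\<phi> x) < \<delta>" for y
  proof -
    have "\<phi> y k \<in> Y k" for k
    proof (cases "k < n")
      case True
      have "cmod (\<phi> y k - \<phi> x k) \<le> cdist n (\<phi> y) (\<phi> x)"
        using cmod_le_csize[OF True, of "\<lambda>k. \<phi> y k - \<phi> x k"] .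
      moreover have "\<delta> \<le> d k" unfolding \<delta>_def using True by (intro Min_le) auto
      ultimately show ?thesis using y(2) by (intro d(2)) (simp add: dist_norm)
    next
      case False
      then have "\<phi> y k = \<phi> x k" using V_support[OF phi_in[OF y(1)], of k] V_support[OF phi_in[OF assms(3)], of k] by simp
      then show ?thesis using Y(1) by auto
    qed
    then show ?thesis using Y(4) by auto
  qed
  then have "\<phi> y \<in> V \<inter> N \<and> \<psi> (\<phi> y) = y" if "y \<in> U" "cdist n (\<phi> y) (\<phi> x) < \<delta>" for y
    using that phi_in psi_phi by blast
  then have "{y \<in> U. cdist n (\<phi> y) (\<phi> x) < \<delta>} \<subseteq> W"
    unfolding N(2)[symmetric] by fastforce
  then show ?thesis using \<delta> by blast
qed

end

lemma real_iso_chart: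
  assumes "function_sheaf X" "openin (zariski X) U" "gal X ` U = U" "real_affine_set n V"
    and iso: "real_iso (open_subspace X U) (affine_variety n V) \<phi>"
  shows "\<exists>\<psi>. chart X U n V \<phi> \<psi>"
proof -
  have ts: "topspace (zariski (open_subspace X U)) = U"
    using openin_subset[OF assms(2)] by (auto simp: open_subspace_def)
  from iso[unfolded real_iso_def ts affine_variety_topspace]
  obtain \<psi> where phi: "real_map (open_subspace X U) (affine_variety n V) \<phi>"
    and psi: "real_map (affine_variety n V) (open_subspace X U) \<psi>"
    and inv: "\<forall>x\<in>U. \<psi> (\<phi> x) = x" "\<forall>y\<in>V. \<phi> (\<psi> y) = y"
    by (elim exE conjE) (rule that; assumption)
  show "\<exists>\<psi>. chart X U n V \<phi> \<psi>"
    by (rule exI[of _ \<psi>]) (use assms(1-4) phi psi inv in \<open>simp add: chart_def\<close>)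
qed

lemma real_variety_charts:
  assumes "real_variety X"
  shows "\<exists>\<U>. finite \<U> \<and> \<Union>\<U> = topspace (zariski X) \<and> (\<forall>U\<in>\<U>. \<exists>n V \<phi> \<psi>. chart X U n V \<phi> \<psi>)"
proof -
  have sheaf: "function_sheaf X" using assms by (simp add: real_variety_def)
  from assms[unfolded real_variety_def] obtain \<U> where \<U>: "finite \<U>" "\<Union>\<U> = topspace (zariski X)"
    "\<forall>U\<in>\<U>. openin (zariski X) U \<and> gal X ` U = U \<and>
       (\<exists>n V \<phi>. real_affine_set n V \<and> real_iso (open_subspace X U) (affine_variety n V) \<phi>)"
    by (elim exE conjE) (rule that; assumption)
  have "\<forall>U\<in>\<U>. \<exists>n V \<phi> \<psi>. chart X U n V \<phi> \<psi>"
  proof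
    fix U assume U: "U \<in> \<U>"
    from \<U>(3)[THEN bspec, OF U] obtain n V \<phi> where *: "openin (zariski X) U" "gal X ` U = U"
      "real_affine_set n V" "real_iso (open_subspace X U) (affine_variety n V) \<phi>"
      by (elim exE conjE) (rule that; assumption)
    from real_iso_chart[OF sheaf *] show "\<exists>n V \<phi> \<psi>. chart X U n V \<phi> \<psi>" by blast
  qed
  with \<U>(1,2) show ?thesis by (intro exI[of _ \<U>] conjI)
qed

lemma real_variety_chart:
  assumes "real_variety X" "x \<in> topspace (zariski X)"
  shows "\<exists>U n V \<phi> \<psi>. chart X U n V \<phi> \<psi> \<and> x \<in> U"
  using real_variety_charts[OF assms(1)] assms(2) by blast

lemma topspace_strong:
  assumes "real_variety X"
  shows "topspace (strong_topology X) = topspace (zariski X)"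
proof
  show "topspace (zariski X) \<subseteq> topspace (strong_topology X)"
  proof
    fix x assume "x \<in> topspace (zariski X)"
    then obtain U n V \<phi> \<psi> where "chart X U n V \<phi> \<psi>" "x \<in> U" using real_variety_chart[OF assms] by blast
    then show "x \<in> topspace (strong_topology X)" using chart.U_strong openin_subset by blast
  qed
qed (rule topspace_strong_subset)

lemma zariski_open_is_strong_open:
  assumes "real_variety X" "openin (zariski X) W"
  shows "openin (strong_topology X) W"
proof (subst openin_subopen, intro ballI)
  fix x assume x: "x \<in> W"
  then have "x \<in> topspace (zariski X)" using assms(2) openin_subset by blast
  then obtain U n V \<phi> \<psi> where c: "chart X U n V \<phi> \<psi>" "x \<in> U" using real_variety_chart[OF assms(1)] by blast
  have "openin (strong_topology X) (W \<inter> U)"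
    using chart.strong_open_U[OF c(1)] chart.U_open[OF c(1)] assms(2) by blast
  then show "\<exists>T. openin (strong_topology X) T \<and> x \<in> T \<and> T \<subseteq> W" using x c by blast
qed

lemma reg_strong_continuous:
  assumes "real_variety X" "openin (zariski X) W" "f \<in> reg X W"
  shows "continuous_map (subtopology (strong_topology X) W) euclidean f"
proof -
  have W: "openin (strong_topology X) W" using zariski_open_is_strong_open assms by blast
  have ts: "topspace (subtopology (strong_topology X) W) = W" using openin_subset[OF W] by auto
  show ?thesis
    unfolding continuous_map_def ts
    using strong_generator[OF assms(2,3)] openin_open_subtopology[OF W] by auto
qed

subsection \<open>Products\<close>

text \<open>
  The Zariski topology of a product is finer than the product of the Zariski topologies. It is still coarser
  than the product of the strong topologies, because the tensor functions that generate it are continuous there.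
\<close>

lemma tensor_strong_continuous:
  assumes "real_variety X" "real_variety Y" and W: "openin (zariski X) U" "openin (zariski Y) V"
    and F: "F \<in> tensor_funs X Y U V"
  shows "continuous_map (subtopology (prod_topology (strong_topology X) (strong_topology Y)) (U \<times> V)) euclidean F"
proof -
  obtain m f g where fg: "\<And>k. k < m \<Longrightarrow> f k \<in> reg X U \<and> g k \<in> reg Y V"
    and F: "F = (\<lambda>(x, y). \<Sum>k<(m::nat). f k x * g k y)"
    using F unfolding tensor_funs_def by blast
  have "continuous_map (prod_topology (subtopology (strong_topology X) U) (subtopology (strong_topology Y) V)) euclidean
      (\<lambda>z. \<Sum>k<m. f k (fst z) * g k (snd z))"
  proof (intro continuous_map_sum_complex continuous_map_mult_complex)
    fix k assume k: "k < m"
    show "continuous_map (prod_topology (subtopology (strong_topology X) U) (subtopology (strong_topology Y) V)) euclidean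
        (\<lambda>z. f k (fst z))"
      using continuous_map_compose[OF continuous_map_fst reg_strong_continuous[OF assms(1) W(1)]] fg[OF k]
      by (auto simp: o_def)
    show "continuous_map (prod_topology (subtopology (strong_topology X) U) (subtopology (strong_topology Y) V)) euclidean
        (\<lambda>z. g k (snd z))"
      using continuous_map_compose[OF continuous_map_snd reg_strong_continuous[OF assms(2) W(2)]] fg[OF k]
      by (auto simp: o_def)
  qed
  then show ?thesis by (simp add: F subtopology_Times case_prod_unfold)
qed

lemma prod_zariski_generator_open:
  assumes "real_variety X" "real_variety Y" and W: "openin (zariski X) U" "openin (zariski Y) V"
    and F: "F \<in> tensor_funs X Y U V" and "open D"
  shows "openin (prod_topology (strong_topology X) (strong_topology Y)) {z \<in> U \<times> V. F z \<in> D}"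
proof -
  let ?P = "prod_topology (strong_topology X) (strong_topology Y)"
  have UV: "openin ?P (U \<times> V)"
    unfolding openin_prod_Times_iff
    using zariski_open_is_strong_open[OF assms(1) W(1)] zariski_open_is_strong_open[OF assms(2) W(2)] by blast
  then have "topspace (subtopology ?P (U \<times> V)) = U \<times> V" using openin_subset by fastforce
  then have "openin (subtopology ?P (U \<times> V)) {z \<in> U \<times> V. F z \<in> D}"
    using openin_continuous_map_preimage[OF tensor_strong_continuous[OF assms(1-5)], of D] assms(6) by simp
  then show ?thesis using UV openin_trans_full by blast
qed

lemma one_tensor:
  assumes "(\<lambda>_. 1) \<in> reg X U" "(\<lambda>_. 1) \<in> reg Y V"
  shows "(\<lambda>_. 1) \<in> tensor_funs X Y U V"
  unfolding tensor_funs_def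
  using assms by (intro CollectI exI[of _ "1::nat"] exI[of _ "\<lambda>_ _. 1"]) auto

lemma zero_tensor: "(\<lambda>_. 0) \<in> tensor_funs X Y U V"
  unfolding tensor_funs_def by (intro CollectI exI[of _ "0::nat"]) auto

definition prod_subbasis :: "'a rspace \<Rightarrow> 'b rspace \<Rightarrow> ('a \<times> 'b) set set" where
  "prod_subbasis X Y = {{z \<in> U \<times> V. F z \<noteq> 0} | U V F.
     openin (zariski X) U \<and> openin (zariski Y) V \<and> F \<in> tensor_funs X Y U V}"

lemma prod_subbasisI:
  "openin (zariski X) U \<Longrightarrow> openin (zariski Y) V \<Longrightarrow> F \<in> tensor_funs X Y U V \<Longrightarrow>
    {z \<in> U \<times> V. F z \<noteq> 0} \<in> prod_subbasis X Y"
  unfolding prod_subbasis_def by (rule CollectI, rule exI[of _ U], rule exI[of _ V], rule exI[of _ F]) simp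

lemma prod_subbasisD:
  "G \<in> prod_subbasis X Y \<Longrightarrow> \<exists>U V F. openin (zariski X) U \<and> openin (zariski Y) V \<and>
     F \<in> tensor_funs X Y U V \<and> G = {z \<in> U \<times> V. F z \<noteq> 0}"
  unfolding prod_subbasis_def by blast

lemma prod_rspace_zariski: "zariski (prod_rspace X Y) = topology_generated_by (prod_subbasis X Y)"
  by (simp add: prod_rspace_def prod_subbasis_def)

lemma prod_rspace_topspace_point:
  assumes "real_variety X" "real_variety Y" "x \<in> topspace (zariski X)" "y \<in> topspace (zariski Y)"
  shows "\<exists>U V. openin (zariski X) U \<and> openin (zariski Y) V \<and> x \<in> U \<and> y \<in> V \<and> (\<lambda>_. 1) \<in> tensor_funs X Y U V"
proof -
  obtain U n U' \<phi> \<psi> where c: "chart X U n U' \<phi> \<psi>" "x \<in> U" using real_variety_chart[OF assms(1,3)] by blast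
  obtain V m V' \<phi>' \<psi>' where d: "chart Y V m V' \<phi>' \<psi>'" "y \<in> V" using real_variety_chart[OF assms(2,4)] by blast
  have "(\<lambda>_. 1) \<in> tensor_funs X Y U V"
    by (rule one_tensor[OF chart.const_reg[OF c(1)] chart.const_reg[OF d(1)]])
  then show ?thesis
    using chart.U_open[OF c(1)] chart.U_open[OF d(1)] c(2) d(2) by (intro exI[of _ U] exI[of _ V] conjI)
qed

lemma topspace_prod_rspace:
  assumes "real_variety X" "real_variety Y"
  shows "topspace (zariski (prod_rspace X Y)) = topspace (zariski X) \<times> topspace (zariski Y)"
  unfolding prod_rspace_zariski topology_generated_by_topspace
proof (intro equalityI subsetI)
  fix z assume "z \<in> \<Union>(prod_subbasis X Y)"
  then obtain G where "G \<in> prod_subbasis X Y" "z \<in> G" by (rule UnionE)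
  then obtain U V where "openin (zariski X) U" "openin (zariski Y) V" "z \<in> U \<times> V"
    using prod_subbasisD[of G X Y] by auto
  then show "z \<in> topspace (zariski X) \<times> topspace (zariski Y)"
    using openin_subset[of "zariski X" U] openin_subset[of "zariski Y" V] by auto
next
  fix z assume "z \<in> topspace (zariski X) \<times> topspace (zariski Y)"
  then obtain x y where z: "z = (x, y)" "x \<in> topspace (zariski X)" "y \<in> topspace (zariski Y)" by (rule SigmaE)
  obtain U V where UV: "openin (zariski X) U" "openin (zariski Y) V" "x \<in> U" "y \<in> V"
    and one: "(\<lambda>_. 1) \<in> tensor_funs X Y U V"
    using prod_rspace_topspace_point[OF assms z(2,3)] by (elim exE conjE) (rule that; assumption)
  show "z \<in> \<Union>(prod_subbasis X Y)"
    by (rule UnionI[OF prod_subbasisI[OF UV(1,2) one]]) (simp add: z UV)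
qed

lemma prod_zariski_open_is_strong_open:
  assumes XY: "real_variety X" "real_variety Y" and W: "openin (zariski (prod_rspace X Y)) W"
  shows "openin (prod_topology (strong_topology X) (strong_topology Y)) W"
proof -
  let ?P = "prod_topology (strong_topology X) (strong_topology Y)"
  have ts: "topspace ?P = topspace (zariski (prod_rspace X Y))"
    by (simp add: topspace_prod_rspace[OF XY] topspace_strong XY)
  have "continuous_map ?P (zariski (prod_rspace X Y)) id"
    unfolding prod_rspace_zariski continuous_on_generated_topo_iff
  proof (intro conjI allI impI)
    fix G assume "G \<in> prod_subbasis X Y"
    from prod_subbasisD[OF this] obtain U V F where G: "openin (zariski X) U" "openin (zariski Y) V"
      "F \<in> tensor_funs X Y U V" "G = {z \<in> U \<times> V. F z \<noteq> 0}"
      by (elim exE conjE) (rule that; assumption)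
    have "openin ?P {z \<in> U \<times> V. F z \<in> - {0}}" by (rule prod_zariski_generator_open[OF XY G(1-3)]) auto
    then have "openin ?P G" by (simp add: G(4))
    moreover have "id -` G \<inter> topspace ?P = G" using openin_subset[OF \<open>openin ?P G\<close>] by auto
    ultimately show "openin ?P (id -` G \<inter> topspace ?P)" by simp
  next
    show "id ` topspace ?P \<subseteq> \<Union>(prod_subbasis X Y)"
      unfolding ts prod_rspace_zariski topology_generated_by_topspace by simp
  qed
  from openin_continuous_map_preimage[OF this W] have "openin ?P {x \<in> topspace ?P. x \<in> W}" by simp
  moreover have "{x \<in> topspace ?P. x \<in> W} = W" using openin_subset[OF W] ts by auto
  ultimately show ?thesis by simp
qed

lemma prod_rspace_reg: "h \<in> reg (prod_rspace X Y) W \<longleftrightarrow>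
  (\<forall>z\<in>W. \<exists>U V. openin (zariski X) U \<and> openin (zariski Y) V \<and> z \<in> U \<times> V \<and>
               (\<exists>P\<in>tensor_funs X Y U V. \<exists>Q\<in>tensor_funs X Y U V.
                  Q z \<noteq> 0 \<and> (\<forall>w \<in> W \<inter> (U \<times> V). Q w \<noteq> 0 \<longrightarrow> h w = P w / Q w)))"
  by (simp add: prod_rspace_def)

text \<open>
  This turns the regular multiplication of an algebraic group into a continuous one.
\<close>

lemma strong_prod_continuous:
  assumes XY: "real_variety X" "real_variety Y"
  shows "continuous_map (prod_topology (strong_topology X) (strong_topology Y)) (strong_topology (prod_rspace X Y)) id"
proof (rule continuous_map_into_strong)
  let ?P = "prod_topology (strong_topology X) (strong_topology Y)"
  have ts: "topspace ?P = topspace (zariski (prod_rspace X Y))"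
    by (simp add: topspace_prod_rspace[OF XY] topspace_strong XY)
  have "(\<lambda>_. 0) \<in> reg (prod_rspace X Y) (topspace (zariski (prod_rspace X Y)))"
    unfolding prod_rspace_reg
  proof
    fix z assume "z \<in> topspace (zariski (prod_rspace X Y))"
    then have "fst z \<in> topspace (zariski X)" "snd z \<in> topspace (zariski Y)"
      unfolding topspace_prod_rspace[OF XY] by auto
    from prod_rspace_topspace_point[OF XY this] obtain U V where "openin (zariski X) U" "openin (zariski Y) V"
      "z \<in> U \<times> V" "(\<lambda>_. 1) \<in> tensor_funs X Y U V" by (metis mem_Times_iff)
    then show "\<exists>U V. openin (zariski X) U \<and> openin (zariski Y) V \<and> z \<in> U \<times> V \<and>
               (\<exists>P\<in>tensor_funs X Y U V. \<exists>Q\<in>tensor_funs X Y U V.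
                  Q z \<noteq> 0 \<and> (\<forall>w \<in> topspace (zariski (prod_rspace X Y)) \<inter> (U \<times> V). Q w \<noteq> 0 \<longrightarrow> 0 = P w / Q w))"
      using zero_tensor[of X Y U V]
      by (intro exI[of _ U] exI[of _ V] conjI bexI[of _ "\<lambda>_. 0"] bexI[of _ "\<lambda>_. 1"]) auto
  qed
  from strong_generator[OF openin_topspace this open_UNIV]
  have "openin (strong_topology (prod_rspace X Y)) (topspace (zariski (prod_rspace X Y)))" by simp
  then show "id \<in> topspace ?P \<rightarrow> topspace (strong_topology (prod_rspace X Y))"
    using ts openin_subset by fastforce
  fix W h D assume W: "openin (zariski (prod_rspace X Y)) W" "h \<in> reg (prod_rspace X Y) W" "open (D::complex set)"
  show "openin ?P {z \<in> topspace ?P. id z \<in> W \<and> h (id z) \<in> D}"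
  proof (subst openin_subopen, intro ballI)
    fix z assume z: "z \<in> {z \<in> topspace ?P. id z \<in> W \<and> h (id z) \<in> D}"
    then obtain U V P Q where UV: "openin (zariski X) U" "openin (zariski Y) V" "z \<in> U \<times> V"
      and PQ: "P \<in> tensor_funs X Y U V" "Q \<in> tensor_funs X Y U V" "Q z \<noteq> 0"
        "\<forall>w \<in> W \<inter> (U \<times> V). Q w \<noteq> 0 \<longrightarrow> h w = P w / Q w"
      using W(2) unfolding prod_rspace_reg by auto
    let ?S = "subtopology ?P {w \<in> U \<times> V. Q w \<in> - {0}}"
    have Qopen: "openin ?P {w \<in> U \<times> V. Q w \<in> - {0}}"
      by (rule prod_zariski_generator_open[OF XY UV(1,2) PQ(2)]) auto
    have tsS: "topspace ?S = {w \<in> U \<times> V. Q w \<in> - {0}}" using openin_subset[OF Qopen] by auto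
    have c: "continuous_map ?S euclidean P" "continuous_map ?S euclidean Q"
      using tensor_strong_continuous[OF XY UV(1,2)] PQ(1,2)
      by (auto intro: continuous_map_from_subtopology_mono)
    then have "continuous_map ?S euclidean (\<lambda>w. P w / Q w)"
      unfolding continuous_map_atin limitin_canonical_iff
      using tsS by (auto intro!: tendsto_divide)
    from openin_continuous_map_preimage[OF this, of D] W(3)
    have "openin ?S {w \<in> topspace ?S. P w / Q w \<in> D}" by simp
    then have "openin ?P {w \<in> topspace ?S. P w / Q w \<in> D}" using Qopen openin_trans_full by blast
    then have "openin ?P ({w \<in> topspace ?S. P w / Q w \<in> D} \<inter> W)"
      using prod_zariski_open_is_strong_open[OF XY W(1)] by blast
    moreover have "{w \<in> topspace ?S. P w / Q w \<in> D} \<inter> W \<subseteq> {z \<in> topspace ?P. id z \<in> W \<and> h (id z) \<in> D}"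
      using PQ(4) openin_subset[OF W(1)] ts unfolding tsS by auto
    moreover have "z \<in> {w \<in> topspace ?S. P w / Q w \<in> D} \<inter> W"
      using z UV PQ(3,4) unfolding tsS by auto
    ultimately show "\<exists>T. openin ?P T \<and> z \<in> T \<and> T \<subseteq> {z \<in> topspace ?P. id z \<in> W \<and> h (id z) \<in> D}" by blast
  qed
qed

subsection \<open>Separation and local compactness\<close>

text \<open>
  The diagonal is Zariski closed by separatedness, hence strongly closed.
\<close>

lemma Hausdorff_strong:
  assumes "real_variety X"
  shows "Hausdorff_space (strong_topology X)"
proof -
  let ?D = "{(x, x) | x. x \<in> topspace (zariski X)}"
  let ?T = "topspace (zariski (prod_rspace X X))"
  have "closedin (zariski (prod_rspace X X)) ?D" using assms by (simp add: real_variety_def)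
  then have "openin (zariski (prod_rspace X X)) (?T - ?D)" by blast
  then have "openin (prod_topology (strong_topology X) (strong_topology X)) (?T - ?D)"
    by (rule prod_zariski_open_is_strong_open[OF assms assms])
  moreover have "?T = topspace (prod_topology (strong_topology X) (strong_topology X))"
    by (simp add: topspace_prod_rspace[OF assms assms] topspace_strong[OF assms])
  ultimately have "closedin (prod_topology (strong_topology X) (strong_topology X)) ?D"
    by (auto simp: closedin_def topspace_strong[OF assms])
  moreover have "?D = (\<lambda>x. (x, x)) ` topspace (strong_topology X)"
    by (auto simp: topspace_strong[OF assms])
  ultimately show ?thesis by (simp add: Hausdorff_space_closedin_diagonal)
qed

lemma locally_compact_strong:
  assumes "real_variety X"
  shows "locally_compact_space (strong_topology X)"
  unfolding locally_compact_space_def topspace_strong[OF assms]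
proof
  fix x assume "x \<in> topspace (zariski X)"
  then obtain U n V \<phi> \<psi> where c: "chart X U n V \<phi> \<psi>" and x: "x \<in> U" using real_variety_chart[OF assms] by blast
  interpret chart X U n V \<phi> \<psi> by (rule c)
  show "\<exists>U K. openin (strong_topology X) U \<and> compactin (strong_topology X) K \<and> x \<in> U \<and> U \<subseteq> K"
    using open_ball_chart[of "\<phi> x" 1] compact_ball_chart[of "\<phi> x" 1] x
    by (intro exI[of _ "{y \<in> U. cdist n (\<phi> y) (\<phi> x) < 1}"] exI[of _ "{y \<in> U. cdist n (\<phi> y) (\<phi> x) \<le> 1}"]) auto
qed

text \<open>
  There are finitely many charts, each homeomorphic to a subspace of a second countable space.
\<close>

lemma strong_countable_subcover:
  assumes X: "real_variety X" and N: "\<And>x. x \<in> topspace (zariski X) \<Longrightarrow> openin (strong_topology X) (N x) \<and> x \<in> N x"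
  shows "\<exists>Q. countable Q \<and> Q \<subseteq> topspace (zariski X) \<and> topspace (zariski X) \<subseteq> (\<Union>x\<in>Q. N x)"
proof -
  obtain \<U> where \<U>: "finite \<U>" "\<Union>\<U> = topspace (zariski X)" "\<forall>U\<in>\<U>. \<exists>n V \<phi> \<psi>. chart X U n V \<phi> \<psi>"
    using real_variety_charts[OF X] by blast
  have "\<exists>Q. countable Q \<and> Q \<subseteq> U \<and> U \<subseteq> (\<Union>x\<in>Q. N x)" if U: "U \<in> \<U>" for U
  proof -
    obtain n V \<phi> \<psi> where c: "chart X U n V \<phi> \<psi>" using \<U>(3) U by blast
    interpret chart X U n V \<phi> \<psi> by (rule c)
    have "\<exists>O'. open O' \<and> {y \<in> V. \<psi> y \<in> N x} = V \<inter> O'" if "x \<in> U" for x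
      using openin_continuous_map_preimage[OF continuous_psi, of "N x"] N[of x] that U_subset
      unfolding openin_open by (simp add: subset_iff)
    then obtain O' where O': "\<And>x. x \<in> U \<Longrightarrow> open (O' x)" "\<And>x. x \<in> U \<Longrightarrow> {y \<in> V. \<psi> y \<in> N x} = V \<inter> O' x"
      by metis
    obtain \<F> where \<F>: "\<F> \<subseteq> O' ` U" "countable \<F>" "\<Union>\<F> = \<Union>(O' ` U)"
      using Lindelof[of "O' ` U"] O'(1) by (metis imageE)
    then obtain Q where Q: "countable Q" "Q \<subseteq> U" "\<F> = O' ` Q"
      using countable_subset_image[of \<F> O' U] by blast
    have "x \<in> (\<Union>x\<in>Q. N x)" if x: "x \<in> U" for x
    proof -
      have "x \<in> N x" using N[of x] x U_subset by blast
      then have "\<phi> x \<in> {y \<in> V. \<psi> y \<in> N x}" using phi_in[OF x] psi_phi[OF x] by simp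
      then have "\<phi> x \<in> O' x" unfolding O'(2)[OF x] by blast
      then obtain q where q: "q \<in> Q" "\<phi> x \<in> O' q" using \<F>(3) Q(3) x by auto
      then have "\<phi> x \<in> {y \<in> V. \<psi> y \<in> N q}" using O'(2)[of q] Q(2) phi_in[OF x] by blast
      then show ?thesis using q psi_phi[OF x] by auto
    qed
    then show ?thesis using Q by blast
  qed
  then obtain Q where Q: "\<And>U. U \<in> \<U> \<Longrightarrow> countable (Q U) \<and> Q U \<subseteq> U \<and> U \<subseteq> (\<Union>x\<in>Q U. N x)" by metis
  have "countable (\<Union>U\<in>\<U>. Q U)" using countable_finite[OF \<U>(1)] Q by (intro countable_UN) auto
  moreover have "(\<Union>U\<in>\<U>. Q U) \<subseteq> topspace (zariski X)"
    unfolding \<U>(2)[symmetric] by (intro UN_least) (rule subset_trans[OF conjunct1[OF conjunct2[OF Q]] Union_upper])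
  moreover have "topspace (zariski X) \<subseteq> (\<Union>x\<in>(\<Union>U\<in>\<U>. Q U). N x)"
  proof
    fix x assume x: "x \<in> topspace (zariski X)"
    have "x \<in> \<Union>\<U>" using x \<U>(2) by simp
    then obtain U where U: "U \<in> \<U>" "x \<in> U" by (rule UnionE)
    then have "x \<in> (\<Union>x\<in>Q U. N x)" using Q[OF U(1)] by (elim conjE) (rule subsetD)
    then obtain q where "q \<in> Q U" "x \<in> N q" by (rule UN_E)
    then show "x \<in> (\<Union>x\<in>(\<Union>U\<in>\<U>. Q U). N x)" using U(1) by (intro UN_I[of q]) auto
  qed
  ultimately show ?thesis by (intro exI[of _ "\<Union>U\<in>\<U>. Q U"] conjI)
qed

section \<open>Real algebraic groups as topological groups\<close>

locale alg_group =
  fixes G :: "'a ralg_group" (structure)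
  assumes alg: "real_algebraic_group G"
begin

abbreviation T :: "'a topology" where "T \<equiv> strong_topology (var G)"
abbreviation \<gamma> :: "'a \<Rightarrow> 'a" where "\<gamma> \<equiv> gal (var G)"
abbreviation R :: "'a set" where "R \<equiv> carrier (real_points G)"
abbreviation I :: "'a set" where "I \<equiv> identity_component G"
abbreviation near1 :: "'a filter" where "near1 \<equiv> nhdsin T \<one>"

lemma variety: "real_variety (var G)"
  using alg by (simp add: real_algebraic_group_def)

lemma topspace_T: "topspace T = carrier G"
  using alg topspace_strong[OF variety] by (simp add: real_algebraic_group_def)

lemma topspace_zariski: "topspace (zariski (var G)) = carrier G"
  using alg by (simp add: real_algebraic_group_def)

sublocale group G
  using alg by (simp add: real_algebraic_group_def)

lemma mult_real_map: "real_map (prod_rspace (var G) (var G)) (var G) (\<lambda>(x, y). x \<otimes> y)"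
  using alg by (simp add: real_algebraic_group_def)

lemma inv_real_map: "real_map (var G) (var G) (\<lambda>x. inv x)"
  using alg by (simp add: real_algebraic_group_def)

lemma continuous_mult: "continuous_map (prod_topology T T) T (\<lambda>(x, y). x \<otimes> y)"
  using continuous_map_compose[OF strong_prod_continuous[OF variety variety]
      real_map_strong_continuous[OF mult_real_map topspace_strong[OF variety]]] by simp

lemma continuous_inv: "continuous_map T T (\<lambda>x. inv x)"
  by (rule real_map_strong_continuous[OF inv_real_map topspace_strong[OF variety]])

lemma continuous_mult2:
  assumes "continuous_map Y T f" "continuous_map Y T g"
  shows "continuous_map Y T (\<lambda>x. f x \<otimes> g x)"
proof -
  have "continuous_map Y (prod_topology T T) (\<lambda>x. (f x, g x))"
    using assms by (simp add: continuous_map_pairwise o_def)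
  from continuous_map_compose[OF this continuous_mult] show ?thesis by (simp add: o_def)
qed

lemma continuous_left: "a \<in> carrier G \<Longrightarrow> continuous_map T T (\<lambda>x. a \<otimes> x)"
  by (rule continuous_mult2) (auto simp: topspace_T)

lemma continuous_right: "a \<in> carrier G \<Longrightarrow> continuous_map T T (\<lambda>x. x \<otimes> a)"
  by (rule continuous_mult2) (auto simp: topspace_T)

lemma gal_mult: "x \<in> carrier G \<Longrightarrow> y \<in> carrier G \<Longrightarrow> \<gamma> (x \<otimes> y) = \<gamma> x \<otimes> \<gamma> y"
proof -
  assume xy: "x \<in> carrier G" "y \<in> carrier G"
  have "(x, y) \<in> topspace (zariski (prod_rspace (var G) (var G)))"
    using xy by (simp add: topspace_prod_rspace[OF variety variety] topspace_zariski)
  moreover have "\<forall>z\<in>topspace (zariski (prod_rspace (var G) (var G))).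
      (\<lambda>(x, y). x \<otimes> y) (gal (prod_rspace (var G) (var G)) z) = \<gamma> ((\<lambda>(x, y). x \<otimes> y) z)"
    using mult_real_map unfolding real_map_def by (elim conjE)
  ultimately have "(\<lambda>(x, y). x \<otimes> y) (gal (prod_rspace (var G) (var G)) (x, y)) = \<gamma> ((\<lambda>(x, y). x \<otimes> y) (x, y))"
    by (rule bspec[rotated])
  then show ?thesis by (simp add: prod_rspace_def)
qed

lemma gal_closed: "x \<in> carrier G \<Longrightarrow> \<gamma> x \<in> carrier G"
  and gal_gal: "x \<in> carrier G \<Longrightarrow> \<gamma> (\<gamma> x) = x"
proof -
  assume "x \<in> carrier G"
  then obtain U n V \<phi> \<psi> where c: "chart (var G) U n V \<phi> \<psi>" "x \<in> U"
    using real_variety_chart[OF variety, of x] topspace_zariski by auto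
  show "\<gamma> x \<in> carrier G" using chart.gal_in[OF c] chart.U_subset[OF c(1)] topspace_zariski by auto
  show "\<gamma> (\<gamma> x) = x" using chart.gal_gal[OF c] .
qed

lemma gal_one: "\<gamma> \<one> = \<one>"
  using gal_mult[OF one_closed one_closed] gal_closed[OF one_closed] by (metis l_one one_closed r_cancel_one')

lemma gal_inv: "x \<in> carrier G \<Longrightarrow> \<gamma> (inv x) = inv (\<gamma> x)"
  by (metis gal_closed gal_mult gal_one inv_closed inv_equality l_inv)

lemma R_iff: "x \<in> R \<longleftrightarrow> x \<in> carrier G \<and> \<gamma> x = x"
  by (simp add: real_points_def)

lemma R_subgroup: "subgroup R G"
proof (rule subgroupI)
  have "\<one> \<in> R" by (simp add: R_iff gal_one)
  then show "R \<noteq> {}" by blast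
qed (auto simp: R_iff gal_mult gal_inv)

lemma R_one [simp]: "\<one> \<in> R" and R_mult: "x \<in> R \<Longrightarrow> y \<in> R \<Longrightarrow> x \<otimes> y \<in> R"
  and R_inv: "x \<in> R \<Longrightarrow> inv x \<in> R" and R_carrier: "x \<in> R \<Longrightarrow> x \<in> carrier G"
  using R_subgroup by (auto simp: subgroup.one_closed subgroup.m_closed subgroup.m_inv_closed subgroup.mem_carrier)

lemma real_points_simps [simp]:
  "mult (real_points G) = mult G" "one (real_points G) = one G"
  by (simp_all add: real_points_def)

lemma topspace_TR: "topspace (subtopology T R) = R"
  using R_carrier by (auto simp: topspace_T)

lemma I_eq: "I = connected_component_of_set (subtopology T R) \<one>"
  by (simp add: identity_component_def)

lemma one_in_I: "\<one> \<in> I"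
  unfolding I_eq by (simp add: connected_component_of_refl topspace_T R_carrier)

lemma I_connected: "connectedin (subtopology T R) I"
  unfolding I_eq by (rule connectedin_connected_component_of)

lemma I_closed: "closedin (subtopology T R) I"
  unfolding I_eq by (rule closedin_connected_component_of)

lemma I_subset: "I \<subseteq> R"
  using connectedin_subset_topspace[OF I_connected] topspace_TR by simp

lemma I_real: "x \<in> I \<Longrightarrow> x \<in> R" and I_carrier: "x \<in> I \<Longrightarrow> x \<in> carrier G"
  using I_subset R_carrier by auto

lemma connected_in_I: "connectedin (subtopology T R) S \<Longrightarrow> \<one> \<in> S \<Longrightarrow> S \<subseteq> I"
  unfolding I_eq by (rule connected_component_of_maximal)

text \<open>
  The image of the component is connected and contains \<open>1\<close>.
\<close>

lemma continuous_image_in_I: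
  assumes "continuous_map T T f" "f ` R \<subseteq> R" "x \<in> I" "f x = \<one>"
  shows "f ` I \<subseteq> I"
proof (rule connected_in_I)
  have "continuous_map (subtopology T R) (subtopology T R) f"
    using assms(1,2) topspace_TR by (auto simp: continuous_map_in_subtopology continuous_map_from_subtopology)
  then show "connectedin (subtopology T R) (f ` I)"
    using I_connected by (rule connectedin_continuous_map_image)
  show "\<one> \<in> f ` I" using assms(3,4) by force
qed

lemma I_inv_mult: "x \<in> I \<Longrightarrow> y \<in> I \<Longrightarrow> inv x \<otimes> y \<in> I"
proof -
  assume x: "x \<in> I" and y: "y \<in> I"
  have "(\<lambda>y. inv x \<otimes> y) ` I \<subseteq> I"
    using x I_carrier[OF x]
    by (intro continuous_image_in_I[OF continuous_left _ x]) (auto intro: I_real R_mult R_inv)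
  then show ?thesis using y by blast
qed

lemma I_inv: "x \<in> I \<Longrightarrow> inv x \<in> I"
  using I_inv_mult[of x \<one>] one_in_I I_carrier by simp

lemma I_mult: "x \<in> I \<Longrightarrow> y \<in> I \<Longrightarrow> x \<otimes> y \<in> I"
  using I_inv_mult[of "inv x" y] I_inv I_carrier by simp

lemma near1: "eventually P near1 \<longleftrightarrow> (\<exists>W. openin T W \<and> \<one> \<in> W \<and> (\<forall>x\<in>W. P x))"
  unfolding eventually_nhdsin by (simp add: topspace_T)

lemma near1_open: "openin T W \<Longrightarrow> \<one> \<in> W \<Longrightarrow> eventually (\<lambda>x. x \<in> W) near1"
  unfolding near1 by blast

lemma near1_pair_open:
  assumes "openin (prod_topology T T) W" "(\<one>, \<one>) \<in> W"
  shows "eventually (\<lambda>z. z \<in> W) (near1 \<times>\<^sub>F near1)"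
proof -
  from assms(1)[unfolded openin_prod_topology_alt, rule_format, OF assms(2)]
  obtain A B where AB: "openin T A" "openin T B" "\<one> \<in> A" "\<one> \<in> B" "A \<times> B \<subseteq> W"
    by (elim exE conjE) (rule that; assumption)
  have "eventually (\<lambda>z. fst z \<in> A \<and> snd z \<in> B) (near1 \<times>\<^sub>F near1)"
    by (rule eventually_prodI[OF near1_open[OF AB(1,3)] near1_open[OF AB(2,4)]])
  then show ?thesis by (rule eventually_mono) (use AB(5) in auto)
qed

lemma near1_inv_mult:
  assumes "eventually P near1"
  shows "eventually (\<lambda>z. P (inv (fst z) \<otimes> snd z)) (near1 \<times>\<^sub>F near1)"
proof -
  obtain W where W: "openin T W" "\<one> \<in> W" "\<forall>x\<in>W. P x" using assms unfolding near1 by blast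
  have c: "continuous_map (prod_topology T T) T (\<lambda>z. inv (fst z) \<otimes> snd z)"
    using continuous_map_compose[OF continuous_map_fst continuous_inv] continuous_map_snd
    by (intro continuous_mult2) (auto simp: o_def)
  have "eventually (\<lambda>z. z \<in> {z \<in> topspace (prod_topology T T). inv (fst z) \<otimes> snd z \<in> W}) (near1 \<times>\<^sub>F near1)"
    by (intro near1_pair_open openin_continuous_map_preimage[OF c W(1)]) (auto simp: topspace_T W(2))
  then show ?thesis by (rule eventually_mono) (use W(3) in auto)
qed

end

section \<open>Coordinates near the identity\<close>

lemma poly_funs_translate: "p \<in> poly_funs UNIV n \<Longrightarrow> (\<lambda>x. p (\<lambda>k. x k + a k)) \<in> poly_funs UNIV n"
proof (induction rule: poly_funs.induct)
  case (coord k)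
  then show ?case by (intro poly_funs.add[OF poly_funs.coord poly_funs.const]) auto
qed (auto intro: poly_funs.intros)

lemma rat_left_half: "rat n f \<Longrightarrow> rat (n + n) (\<lambda>z. f z)"
proof -
  assume f: "rat n f"
  show ?thesis
    by (rule eventually_near0_zero[OF rat_subst[OF f], rule_format, of "n + n" "\<lambda>z. z"])
       (auto intro: rat_coord)
qed

lemma rat_right_half: "rat n f \<Longrightarrow> rat (n + n) (\<lambda>z. f (\<lambda>k. z (n + k)))"
proof -
  assume f: "rat n f"
  show ?thesis
    by (rule eventually_near0_zero[OF rat_subst[OF f], rule_format, of "n + n" "\<lambda>z k. z (n + k)"])
       (auto intro: rat_coord)
qed

text \<open>
  A chart around the identity element, recentred by \<open>\<kappa>\<close> so that the identity becomes the
  origin.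
\<close>

locale group_chart = alg_group G + chart "var G" U n V \<phi> \<psi>
  for G :: "'a ralg_group" (structure) and U :: "'a set" and n :: nat and V :: "(nat \<Rightarrow> complex) set"
    and \<phi> :: "'a \<Rightarrow> nat \<Rightarrow> complex" and \<psi> :: "(nat \<Rightarrow> complex) \<Rightarrow> 'a" +
  assumes one_in_U: "\<one> \<in> U"
begin

definition \<kappa> :: "'a \<Rightarrow> nat \<Rightarrow> complex" where
  "\<kappa> x k = \<phi> x k - \<phi> \<one> k"

abbreviation sz :: "'a \<Rightarrow> real" where "sz x \<equiv> csize n (\<kappa> x)"

lemma sz_eq: "sz x = cdist n (\<phi> x) (\<phi> \<one>)"
  by (simp add: \<kappa>_def[abs_def])

lemma U_carrier: "x \<in> U \<Longrightarrow> x \<in> carrier G"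
  using U_subset topspace_zariski by auto

lemma kappa_one [simp]: "\<kappa> \<one> = (\<lambda>_. 0)"
  by (simp add: \<kappa>_def[abs_def])

lemma phi_one_real: "cnj (\<phi> \<one> k) = \<phi> \<one> k"
  using phi_gal[OF one_in_U] gal_one by (metis (no_types))

lemma kappa_gal: "x \<in> U \<Longrightarrow> \<kappa> (\<gamma> x) = (\<lambda>k. cnj (\<kappa> x k))"
  using phi_gal[of x] phi_one_real by (auto simp: \<kappa>_def)

lemma kappa_support: "x \<in> U \<Longrightarrow> k \<ge> n \<Longrightarrow> \<kappa> x k = 0"
  using V_support[OF phi_in, of x k] V_support[OF phi_in[OF one_in_U], of k] by (simp add: \<kappa>_def)

lemma kappa_inj:
  assumes "x \<in> U" "y \<in> U" "\<And>k. k < n \<Longrightarrow> \<kappa> x k = \<kappa> y k"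
  shows "x = y"
proof -
  have "\<kappa> x k = \<kappa> y k" for k
    using assms kappa_support[OF assms(1), of k] kappa_support[OF assms(2), of k] by (cases "k < n") auto
  then have "\<phi> x = \<phi> y" by (auto simp: \<kappa>_def fun_eq_iff)
  then show ?thesis using psi_phi assms by metis
qed

lemma sz_gal: "x \<in> U \<Longrightarrow> sz (\<gamma> x) = sz x"
  by (simp add: kappa_gal)

lemma sz_zero:
  assumes "x \<in> U" "sz x = 0"
  shows "x = \<one>"
proof (rule kappa_inj[OF assms(1) one_in_U])
  fix k assume "k < n"
  then show "\<kappa> x k = \<kappa> \<one> k" using cmod_le_csize[of k n "\<kappa> x"] assms(2) by simp
qed

lemma near1_chart: "eventually P near1 \<longleftrightarrow> (\<exists>d>0. \<forall>x\<in>U. sz x < d \<longrightarrow> P x)"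
proof
  assume "eventually P near1"
  then obtain W where W: "openin T W" "\<one> \<in> W" "\<forall>x\<in>W. P x" unfolding near1 by blast
  obtain d where "d > 0" "{y \<in> U. cdist n (\<phi> y) (\<phi> \<one>) < d} \<subseteq> W"
    using open_contains_ball[OF W(1,2) one_in_U] by blast
  then show "\<exists>d>0. \<forall>x\<in>U. sz x < d \<longrightarrow> P x" using W(3) unfolding sz_eq by auto
next
  assume "\<exists>d>0. \<forall>x\<in>U. sz x < d \<longrightarrow> P x"
  then obtain d where d: "d > 0" "\<forall>x\<in>U. sz x < d \<longrightarrow> P x" by blast
  show "eventually P near1"
    unfolding near1 using open_ball_chart[of "\<phi> \<one>" d] d one_in_U
    by (intro exI[of _ "{x \<in> U. cdist n (\<phi> x) (\<phi> \<one>) < d}"]) (auto simp: sz_eq)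
qed

lemma near1_chartE:
  assumes "eventually P near1"
  obtains d where "d > 0" "\<And>x. x \<in> U \<Longrightarrow> sz x < d \<Longrightarrow> P x"
  using assms unfolding near1_chart by auto

lemma near1_pair_chart:
  assumes "eventually P (near1 \<times>\<^sub>F near1)"
  shows "\<exists>d>0. \<forall>x\<in>U. \<forall>y\<in>U. sz x < d \<longrightarrow> sz y < d \<longrightarrow> P (x, y)"
proof -
  obtain Q Q' where Q: "eventually Q near1" "eventually Q' near1" "\<And>x y. Q x \<Longrightarrow> Q' y \<Longrightarrow> P (x, y)"
    using assms unfolding eventually_prod_filter by blast
  have "eventually (\<lambda>x. Q x \<and> Q' x) near1" using Q by (simp add: eventually_conj)
  then obtain d where "d > 0" "\<And>x. x \<in> U \<Longrightarrow> sz x < d \<Longrightarrow> Q x \<and> Q' x" by (rule near1_chartE) (rule that)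
  then show ?thesis using Q(3) by blast
qed

lemma near0_near1_pair:
  assumes "eventually P (near0 (n + n))"
  shows "eventually (\<lambda>z. P (join n (\<kappa> (fst z)) (\<kappa> (snd z)))) (near1 \<times>\<^sub>F near1)"
proof -
  obtain d where d: "d > 0" "\<And>x. csize (n + n) x < d \<Longrightarrow> P x" using assms by (rule near0E) (rule that)
  have small: "eventually (\<lambda>x. sz x < d / 2) near1" unfolding near1_chart using d(1) by (intro exI[of _ "d/2"]) auto
  have "eventually (\<lambda>z. sz (fst z) < d / 2 \<and> sz (snd z) < d / 2) (near1 \<times>\<^sub>F near1)"
    by (rule eventually_prodI[OF small small])
  then show ?thesis
    by (rule eventually_mono) (use d(2) in \<open>auto simp: csize_join\<close>)
qed

lemma regular_near_one:
  assumes "openin (zariski (var G)) W" "f \<in> reg (var G) W" "\<one> \<in> W"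
  shows "\<exists>p\<in>poly_funs UNIV n. \<exists>q\<in>poly_funs UNIV n. q (\<lambda>_. 0) \<noteq> 0 \<and>
    eventually (\<lambda>x. x \<in> W \<and> q (\<kappa> x) \<noteq> 0 \<and> f x = p (\<kappa> x) / q (\<kappa> x)) near1"
proof -
  from reg_local_rational[OF assms one_in_U]
  obtain p q N where p: "p \<in> poly_funs UNIV n" and q: "q \<in> poly_funs UNIV n" and N: "open N" "\<phi> \<one> \<in> N"
    and pq: "\<forall>y\<in>V \<inter> N. \<psi> y \<in> W \<and> q y \<noteq> 0 \<and> f (\<psi> y) = p y / q y"
    by (elim bexE exE conjE) (rule that; assumption)
  define p' where "p' = (\<lambda>x. p (\<lambda>k. x k + \<phi> \<one> k))"
  define q' where "q' = (\<lambda>x. q (\<lambda>k. x k + \<phi> \<one> k))"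
  have shift: "(\<lambda>k. \<kappa> x k + \<phi> \<one> k) = \<phi> x" for x by (simp add: \<kappa>_def)
  have "continuous_map (subtopology T U) (top_of_set V) \<phi>"
    using chart_homeomorphic by (simp add: homeomorphic_maps_def)
  then have "continuous_map (subtopology T U) euclidean \<phi>" by (simp add: continuous_map_in_subtopology)
  from openin_continuous_map_preimage[OF this, of N] N(1)
  have "openin (subtopology T U) {x \<in> U. \<phi> x \<in> N}"
    unfolding topspace_strong_U by simp
  then have "openin T {x \<in> U. \<phi> x \<in> N}" using U_strong openin_trans_full by blast
  then have "eventually (\<lambda>x. x \<in> {x \<in> U. \<phi> x \<in> N}) near1"
    using one_in_U N(2) by (intro near1_open) auto
  then have ev: "eventually (\<lambda>x. x \<in> W \<and> q' (\<kappa> x) \<noteq> 0 \<and> f x = p' (\<kappa> x) / q' (\<kappa> x)) near1"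
  proof eventually_elim
    case (elim x)
    then have "\<phi> x \<in> V \<inter> N" "\<psi> (\<phi> x) = x" using phi_in psi_phi by auto
    then show ?case using pq unfolding p'_def q'_def shift by force
  qed
  have "q (\<phi> \<one>) \<noteq> 0" using pq N(2) phi_in[OF one_in_U] by blast
  then have "q' (\<lambda>_. 0) \<noteq> 0" by (simp add: q'_def)
  moreover have "p' \<in> poly_funs UNIV n" "q' \<in> poly_funs UNIV n"
    unfolding p'_def q'_def using p q by (auto intro: poly_funs_translate)
  ultimately show ?thesis using ev by blast
qed

lemma regular_near_one_rat:
  assumes "openin (zariski (var G)) W" "f \<in> reg (var G) W" "\<one> \<in> W"
  shows "\<exists>h. rat n h \<and> eventually (\<lambda>x. x \<in> W \<and> f x = h (\<kappa> x)) near1"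
proof -
  from regular_near_one[OF assms] obtain p q where p: "p \<in> poly_funs UNIV n" and q: "q \<in> poly_funs UNIV n"
    and q0: "q (\<lambda>_. 0) \<noteq> 0" and ev: "eventually (\<lambda>x. x \<in> W \<and> q (\<kappa> x) \<noteq> 0 \<and> f x = p (\<kappa> x) / q (\<kappa> x)) near1"
    by (elim bexE conjE) (rule that; assumption)
  have "rat n (\<lambda>x. p x / q x)" by (intro rat_divide poly_funs_rat p q q0)
  moreover have "eventually (\<lambda>x. x \<in> W \<and> f x = p (\<kappa> x) / q (\<kappa> x)) near1"
    using ev by (rule eventually_mono) simp
  ultimately show ?thesis by (intro exI[of _ "\<lambda>x. p x / q x"] conjI)
qed

lemma tensor_near_one_rat:
  assumes "openin (zariski (var G)) A" "openin (zariski (var G)) B" "\<one> \<in> A" "\<one> \<in> B"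
    and "F \<in> tensor_funs (var G) (var G) A B"
  shows "\<exists>h. rat (n + n) h \<and> eventually (\<lambda>z. F z = h (join n (\<kappa> (fst z)) (\<kappa> (snd z)))) (near1 \<times>\<^sub>F near1)"
proof -
  from assms(5)[unfolded tensor_funs_def mem_Collect_eq]
  obtain m f g where fg: "\<forall>k<m. f k \<in> reg (var G) A \<and> g k \<in> reg (var G) B"
    and F: "F = (\<lambda>(x, y). \<Sum>k<(m::nat). f k x * g k y)"
    by (elim exE conjE) (rule that; assumption)
  have "\<exists>h. rat n h \<and> eventually (\<lambda>x. x \<in> A \<and> f k x = h (\<kappa> x)) near1" if "k < m" for k
    using regular_near_one_rat[OF assms(1) _ assms(3), of "f k"] fg that by simp
  then obtain f' where f': "\<And>k. k < m \<Longrightarrow> rat n (f' k)" "\<And>k. k < m \<Longrightarrow> eventually (\<lambda>x. x \<in> A \<and> f k x = f' k (\<kappa> x)) near1"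
    by metis
  have "\<exists>h. rat n h \<and> eventually (\<lambda>x. x \<in> B \<and> g k x = h (\<kappa> x)) near1" if "k < m" for k
    using regular_near_one_rat[OF assms(2) _ assms(4), of "g k"] fg that by simp
  then obtain g' where g': "\<And>k. k < m \<Longrightarrow> rat n (g' k)" "\<And>k. k < m \<Longrightarrow> eventually (\<lambda>x. x \<in> B \<and> g k x = g' k (\<kappa> x)) near1"
    by metis
  define h where "h = (\<lambda>z. \<Sum>k<m. f' k z * g' k (\<lambda>i. z (n + i)))"
  have "rat (n + n) h"
    unfolding h_def using f'(1) g'(1) by (intro rat_sum rat_mult rat_left_half rat_right_half) auto
  have ev_f: "eventually (\<lambda>x. \<forall>k\<in>{..<m}. f k x = f' k (\<kappa> x)) near1"
    by (rule eventually_ball_finite) (use eventually_mono[OF f'(2)] in auto)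
  have ev_g: "eventually (\<lambda>x. \<forall>k\<in>{..<m}. g k x = g' k (\<kappa> x)) near1"
    by (rule eventually_ball_finite) (use eventually_mono[OF g'(2)] in auto)
  have "eventually (\<lambda>z. (\<forall>k\<in>{..<m}. f k (fst z) = f' k (\<kappa> (fst z))) \<and>
      (\<forall>k\<in>{..<m}. g k (snd z) = g' k (\<kappa> (snd z)))) (near1 \<times>\<^sub>F near1)"
    by (rule eventually_prodI[OF ev_f ev_g])
  then have "eventually (\<lambda>z. F z = h (join n (\<kappa> (fst z)) (\<kappa> (snd z)))) (near1 \<times>\<^sub>F near1)"
  proof (rule eventually_mono)
    fix z assume z: "(\<forall>k\<in>{..<m}. f k (fst z) = f' k (\<kappa> (fst z))) \<and> (\<forall>k\<in>{..<m}. g k (snd z) = g' k (\<kappa> (snd z)))"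
    have 1: "f' k (join n (\<kappa> (fst z)) (\<kappa> (snd z))) = f' k (\<kappa> (fst z))" if "k < m" for k
      by (rule rat_local[OF f'(1)[OF that]]) (simp add: join_def)
    have 2: "(\<lambda>i. join n (\<kappa> (fst z)) (\<kappa> (snd z)) (n + i)) = \<kappa> (snd z)" by (simp add: join_def)
    show "F z = h (join n (\<kappa> (fst z)) (\<kappa> (snd z)))"
      unfolding F h_def 2 case_prod_unfold using z 1 by (intro sum.cong) auto
  qed
  with \<open>rat (n + n) h\<close> show ?thesis by blast
qed

lemma mult_coordinate_rat:
  "\<exists>h. rat (n + n) h \<and> eventually (\<lambda>z. fst z \<otimes> snd z \<in> U \<and>
     \<kappa> (fst z \<otimes> snd z) k = h (join n (\<kappa> (fst z)) (\<kappa> (snd z)))) (near1 \<times>\<^sub>F near1)"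
proof -
  let ?P = "prod_rspace (var G) (var G)"
  let ?m = "\<lambda>(x, y). x \<otimes> y"
  define W where "W = {z \<in> topspace (zariski ?P). ?m z \<in> U}"
  have W_open: "openin (zariski ?P) W"
    using mult_real_map openin_continuous_map_preimage[OF _ U_open] unfolding W_def real_map_def by blast
  have one_W: "(\<one>, \<one>) \<in> W"
    by (simp add: W_def topspace_prod_rspace[OF variety variety] topspace_zariski one_in_U)
  have "\<forall>V f. openin (zariski (var G)) V \<and> f \<in> reg (var G) V \<longrightarrow>
        (\<lambda>x. f (?m x)) \<in> reg ?P {x \<in> topspace (zariski ?P). ?m x \<in> V}"
    using mult_real_map unfolding real_map_def by (elim conjE)
  from this[rule_format, OF conjI, OF U_open coord_reg[of k]]
  have "(\<lambda>z. \<phi> (?m z) k) \<in> reg ?P W" unfolding W_def .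
  from this[unfolded prod_rspace_reg, THEN bspec, OF one_W]
  obtain A B P Q where AB: "openin (zariski (var G)) A" "openin (zariski (var G)) B" "(\<one>, \<one>) \<in> A \<times> B"
    and P: "P \<in> tensor_funs (var G) (var G) A B" and Q: "Q \<in> tensor_funs (var G) (var G) A B"
    and Q1: "Q (\<one>, \<one>) \<noteq> 0" and PQ: "\<forall>w \<in> W \<inter> (A \<times> B). Q w \<noteq> 0 \<longrightarrow> \<phi> (?m w) k = P w / Q w"
    by (elim exE conjE bexE) (rule that; assumption)
  have one: "\<one> \<in> A" "\<one> \<in> B" using AB(3) by auto
  obtain p where p: "rat (n + n) p" "eventually (\<lambda>z. P z = p (join n (\<kappa> (fst z)) (\<kappa> (snd z)))) (near1 \<times>\<^sub>F near1)"
    using tensor_near_one_rat[OF AB(1,2) one P] by blast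
  obtain q where q: "rat (n + n) q" "eventually (\<lambda>z. Q z = q (join n (\<kappa> (fst z)) (\<kappa> (snd z)))) (near1 \<times>\<^sub>F near1)"
    using tensor_near_one_rat[OF AB(1,2) one Q] by blast
  obtain d where d: "d > 0" "\<forall>x\<in>U. \<forall>y\<in>U. sz x < d \<longrightarrow> sz y < d \<longrightarrow> Q (x, y) = q (join n (\<kappa> x) (\<kappa> y))"
    using near1_pair_chart[OF q(2)] by auto
  have "Q (\<one>, \<one>) = q (\<lambda>_. 0)" using d(2)[rule_format, OF one_in_U one_in_U] d(1) by simp
  then have q0: "q (\<lambda>_. 0) \<noteq> 0" using Q1 by simp
  have "rat (n + n) (\<lambda>z. p z / q z - \<phi> \<one> k)"
    by (intro rat_diff rat_divide p q q0 rat_const)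
  moreover have "eventually (\<lambda>z. z \<in> W \<inter> (A \<times> B)) (near1 \<times>\<^sub>F near1)"
    using prod_zariski_open_is_strong_open[OF variety variety W_open] one_W one
      zariski_open_is_strong_open[OF variety AB(1)] zariski_open_is_strong_open[OF variety AB(2)]
    by (intro near1_pair_open openin_Int) (auto simp: openin_prod_Times_iff)
  with near0_near1_pair[OF rat_eventually_nonzero[OF q(1) q0]] p(2) q(2)
  have "eventually (\<lambda>z. fst z \<otimes> snd z \<in> U \<and> \<kappa> (fst z \<otimes> snd z) k =
      (\<lambda>z. p z / q z - \<phi> \<one> k) (join n (\<kappa> (fst z)) (\<kappa> (snd z)))) (near1 \<times>\<^sub>F near1)"
  proof eventually_elim
    case (elim z)
    then have "\<phi> (?m z) k = P z / Q z" "?m z \<in> U" using PQ by (auto simp: W_def)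
    with elim show ?case by (simp add: \<kappa>_def case_prod_unfold)
  qed
  ultimately show ?thesis by (intro exI[of _ "\<lambda>z. p z / q z - \<phi> \<one> k"] conjI)
qed

text \<open>
  The multiplication is regular, so in coordinates it is locally a quotient of sums of products of regular
  functions of the two factors.
\<close>

lemma mult_coordinates_rat:
  "\<exists>M \<rho>. \<rho> > 0 \<and> (\<forall>k<n. rat (n + n) (M k) \<and> (\<forall>z. M k (\<lambda>l. cnj (z l)) = cnj (M k z))) \<and>
    (\<forall>x\<in>U. \<forall>y\<in>U. sz x < \<rho> \<longrightarrow> sz y < \<rho> \<longrightarrow> x \<otimes> y \<in> U \<and>
      (\<forall>k<n. \<kappa> (x \<otimes> y) k = M k (join n (\<kappa> x) (\<kappa> y))))"
proof -
  have "\<forall>k. \<exists>h. rat (n + n) h \<and> eventually (\<lambda>z. fst z \<otimes> snd z \<in> U \<and>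
     \<kappa> (fst z \<otimes> snd z) k = h (join n (\<kappa> (fst z)) (\<kappa> (snd z)))) (near1 \<times>\<^sub>F near1)"
    by (rule allI) (rule mult_coordinate_rat)
  from choice[OF this] obtain H where H: "\<forall>k. rat (n + n) (H k) \<and> eventually (\<lambda>z. fst z \<otimes> snd z \<in> U \<and>
     \<kappa> (fst z \<otimes> snd z) k = H k (join n (\<kappa> (fst z)) (\<kappa> (snd z)))) (near1 \<times>\<^sub>F near1)"
    by (rule exE)
  then have H_rat: "rat (n + n) (H k)" for k by simp
  have "eventually (\<lambda>z. \<forall>k\<in>{..n}. fst z \<otimes> snd z \<in> U \<and>
     \<kappa> (fst z \<otimes> snd z) k = H k (join n (\<kappa> (fst z)) (\<kappa> (snd z)))) (near1 \<times>\<^sub>F near1)"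
    using H by (intro eventually_ball_finite) auto
  from near1_pair_chart[OF this] obtain \<rho> where \<rho>_pos: "\<rho> > 0"
    and \<rho>: "\<forall>x\<in>U. \<forall>y\<in>U. sz x < \<rho> \<longrightarrow> sz y < \<rho> \<longrightarrow> (\<forall>k\<in>{..n}. fst (x, y) \<otimes> snd (x, y) \<in> U \<and>
     \<kappa> (fst (x, y) \<otimes> snd (x, y)) k = H k (join n (\<kappa> (fst (x, y))) (\<kappa> (snd (x, y)))))"
    by (elim exE conjE) (rule that; assumption)
  have \<rho>': "x \<otimes> y \<in> U \<and> (\<forall>k<n. \<kappa> (x \<otimes> y) k = H k (join n (\<kappa> x) (\<kappa> y)))"
    if "x \<in> U" "y \<in> U" "sz x < \<rho>" "sz y < \<rho>" for x y
    using \<rho>[rule_format, OF that, of 0] \<rho>[rule_format, OF that] by simp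
  \<comment> \<open>\<open>H\<close> represents a real map, but only on the group; averaging it with its conjugate keeps
      the values there and makes it real on the whole ambient space\<close>
  define M where "M = (\<lambda>k z. (1/2) * (H k z + cnj (H k (\<lambda>l. cnj (z l)))))"
  have "rat (n + n) (M k)" for k
    unfolding M_def by (intro rat_mult rat_add rat_const rat_cnj H_rat)
  moreover have "M k (\<lambda>l. cnj (z l)) = cnj (M k z)" for k z
    by (simp add: M_def add.commute)
  moreover have "x \<otimes> y \<in> U \<and> (\<forall>k<n. \<kappa> (x \<otimes> y) k = M k (join n (\<kappa> x) (\<kappa> y)))"
    if xy: "x \<in> U" "y \<in> U" "sz x < \<rho>" "sz y < \<rho>" for x y
  proof -
    have 1: "x \<otimes> y \<in> U" "\<forall>k<n. \<kappa> (x \<otimes> y) k = H k (join n (\<kappa> x) (\<kappa> y))"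
      using \<rho>'[OF xy] by auto
    have 2: "\<forall>k<n. \<kappa> (\<gamma> x \<otimes> \<gamma> y) k = H k (join n (\<kappa> (\<gamma> x)) (\<kappa> (\<gamma> y)))"
      using \<rho>'[of "\<gamma> x" "\<gamma> y"] xy gal_in sz_gal by auto
    have "\<kappa> (\<gamma> x \<otimes> \<gamma> y) = (\<lambda>k. cnj (\<kappa> (x \<otimes> y) k))"
      using kappa_gal[OF 1(1)] gal_mult xy U_carrier by simp
    then have "\<forall>k<n. cnj (\<kappa> (x \<otimes> y) k) = H k (\<lambda>l. cnj (join n (\<kappa> x) (\<kappa> y) l))"
      using 2 xy by (simp add: kappa_gal join_cnj)
    then have "\<forall>k<n. \<kappa> (x \<otimes> y) k = cnj (H k (\<lambda>l. cnj (join n (\<kappa> x) (\<kappa> y) l)))"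
      by (metis complex_cnj_cnj)
    then show ?thesis using 1 by (simp add: M_def)
  qed
  ultimately show ?thesis using \<rho>_pos by (intro exI[of _ M] exI[of _ \<rho>]) simp
qed

end

section \<open>Real points near the identity\<close>

context group_chart
begin

definition locally_algebraic :: "'a set \<Rightarrow> bool" where
  "locally_algebraic H \<longleftrightarrow> (\<exists>S\<subseteq>poly_funs UNIV n. \<exists>\<rho>>0. \<forall>x\<in>U. sz x < \<rho> \<longrightarrow>
     (x \<in> H \<longleftrightarrow> (\<forall>p\<in>S. p (\<kappa> x) = 0)))"

lemma locally_algebraic_carrier: "locally_algebraic (carrier G)"
  unfolding locally_algebraic_def
  by (rule exI[of _ "{}"], intro conjI, simp, rule exI[of _ 1]) (simp add: U_carrier)

lemma kappa_image: "(\<lambda>k. u k + \<phi> \<one> k) \<in> V \<Longrightarrow> \<psi> (\<lambda>k. u k + \<phi> \<one> k) \<in> U \<and> \<kappa> (\<psi> (\<lambda>k. u k + \<phi> \<one> k)) = u"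
  using psi_in phi_psi by (simp add: \<kappa>_def[abs_def])

lemma chart_zeros:
  "\<exists>S\<subseteq>poly_funs UNIV n. \<forall>u. (\<forall>k\<ge>n. u k = 0) \<longrightarrow> (u \<in> \<kappa> ` U \<longleftrightarrow> (\<forall>p\<in>S. p u = 0))"
proof -
  from V_affine[unfolded real_affine_set_def] obtain S0 where S0: "S0 \<subseteq> poly_funs \<real> n"
    and V: "V = {x \<in> affine_space n. \<forall>p\<in>S0. p x = 0}"
    by (elim exE conjE) (rule that; assumption)
  define S where "S = (\<lambda>p u. p (\<lambda>k. u k + \<phi> \<one> k)) ` S0"
  have "S \<subseteq> poly_funs UNIV n"
    unfolding S_def
    by (rule image_subsetI, rule poly_funs_translate, rule poly_funs_mono[OF _ subset_UNIV], rule subsetD[OF S0])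
  moreover have "u \<in> \<kappa> ` U \<longleftrightarrow> (\<forall>p\<in>S. p u = 0)" if u: "\<forall>k\<ge>n. u k = 0" for u
  proof -
    have "u \<in> \<kappa> ` U \<longleftrightarrow> (\<lambda>k. u k + \<phi> \<one> k) \<in> V"
    proof
      assume "u \<in> \<kappa> ` U"
      then obtain x where "x \<in> U" "u = \<kappa> x" by blast
      then show "(\<lambda>k. u k + \<phi> \<one> k) \<in> V" using phi_in[of x] by (simp add: \<kappa>_def)
    next
      assume "(\<lambda>k. u k + \<phi> \<one> k) \<in> V"
      from kappa_image[OF this] show "u \<in> \<kappa> ` U" by (metis imageI)
    qed
    also have "(\<lambda>k. u k + \<phi> \<one> k) \<in> affine_space n"
      using u V_support[OF phi_in[OF one_in_U]] by (simp add: affine_space_def)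
    then have "(\<lambda>k. u k + \<phi> \<one> k) \<in> V \<longleftrightarrow> (\<forall>p\<in>S. p u = 0)"
      unfolding V S_def by simp
    finally show ?thesis .
  qed
  ultimately show ?thesis by (intro exI[of _ S] conjI allI impI)
qed

lemma subgroup_local_group:
  assumes H: "\<one> \<in> H" "\<And>x y. x \<in> H \<Longrightarrow> y \<in> H \<Longrightarrow> x \<otimes> y \<in> H" "locally_algebraic H"
  shows "\<exists>M S \<rho>. local_group n (\<kappa> ` (U \<inter> H)) M S \<rho> \<and> (\<forall>x\<in>U. \<forall>y\<in>U. sz x < \<rho> \<longrightarrow> sz y < \<rho> \<longrightarrow>
    x \<otimes> y \<in> U \<and> \<kappa> (x \<otimes> y) = (\<lambda>k. if k < n then M k (join n (\<kappa> x) (\<kappa> y)) else 0))"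
proof -
  obtain M \<rho>1 where \<rho>1: "\<rho>1 > 0"
    and M: "\<forall>k<n. rat (n + n) (M k) \<and> (\<forall>z. M k (\<lambda>l. cnj (z l)) = cnj (M k z))"
    and mult: "\<forall>x\<in>U. \<forall>y\<in>U. sz x < \<rho>1 \<longrightarrow> sz y < \<rho>1 \<longrightarrow> x \<otimes> y \<in> U \<and>
      (\<forall>k<n. \<kappa> (x \<otimes> y) k = M k (join n (\<kappa> x) (\<kappa> y)))"
    using mult_coordinates_rat by (elim exE conjE) (rule that; assumption)
  obtain S1 where S1: "S1 \<subseteq> poly_funs UNIV n"
    "\<forall>u. (\<forall>k\<ge>n. u k = 0) \<longrightarrow> (u \<in> \<kappa> ` U \<longleftrightarrow> (\<forall>p\<in>S1. p u = 0))"
    using chart_zeros by (elim exE conjE) (rule that; assumption)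
  obtain S2 \<rho>2 where S2: "S2 \<subseteq> poly_funs UNIV n" "\<rho>2 > 0"
    "\<forall>x\<in>U. sz x < \<rho>2 \<longrightarrow> (x \<in> H \<longleftrightarrow> (\<forall>p\<in>S2. p (\<kappa> x) = 0))"
    using H(3) unfolding locally_algebraic_def by (elim exE conjE) (rule that; assumption)
  define \<rho> where "\<rho> = min \<rho>1 \<rho>2"
  have \<rho>: "\<rho> > 0" "\<rho> \<le> \<rho>1" "\<rho> \<le> \<rho>2" using \<rho>1 S2(2) by (auto simp: \<rho>_def)
  have kmult: "x \<otimes> y \<in> U \<and> \<kappa> (x \<otimes> y) = (\<lambda>k. if k < n then M k (join n (\<kappa> x) (\<kappa> y)) else 0)"
    if "x \<in> U" "y \<in> U" "sz x < \<rho>" "sz y < \<rho>" for x y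
  proof -
    have *: "x \<otimes> y \<in> U" "\<forall>k<n. \<kappa> (x \<otimes> y) k = M k (join n (\<kappa> x) (\<kappa> y))"
      using mult that \<rho>(2) by auto
    then show ?thesis using kappa_support[OF *(1)] by auto
  qed
  have zeros: "u \<in> \<kappa> ` (U \<inter> H) \<longleftrightarrow> (\<forall>p\<in>S1 \<union> S2. p u = 0)"
    if u: "\<forall>k\<ge>n. u k = 0" "csize n u < \<rho>" for u
  proof
    assume "u \<in> \<kappa> ` (U \<inter> H)"
    then obtain x where x: "x \<in> U" "x \<in> H" "u = \<kappa> x" by blast
    then have "\<forall>p\<in>S2. p u = 0" using S2(3) u(2) \<rho>(3) by auto
    moreover have "\<forall>p\<in>S1. p u = 0" using S1(2) u(1) x by blast
    ultimately show "\<forall>p\<in>S1 \<union> S2. p u = 0" by blast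
  next
    assume p: "\<forall>p\<in>S1 \<union> S2. p u = 0"
    then have "u \<in> \<kappa> ` U" using S1(2) u(1) by blast
    then obtain x where x: "x \<in> U" "u = \<kappa> x" by blast
    then have "x \<in> H" using S2(3) p u(2) \<rho>(3) by auto
    then show "u \<in> \<kappa> ` (U \<inter> H)" using x by blast
  qed
  have "local_group n (\<kappa> ` (U \<inter> H)) M (S1 \<union> S2) \<rho>"
  proof
    show "\<rho> > 0" by (rule \<rho>(1))
    show "rat (n + n) (M k)" if "k < n" for k using M that by blast
    show "M k (\<lambda>l. cnj (z l)) = cnj (M k z)" if "k < n" for k z using M that by blast
    show "S1 \<union> S2 \<subseteq> poly_funs UNIV n" using S1(1) S2(1) by blast
    show "x k = 0" if "x \<in> \<kappa> ` (U \<inter> H)" "k \<ge> n" for x k using that kappa_support by blast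
    show "(\<lambda>_. 0) \<in> \<kappa> ` (U \<inter> H)" using one_in_U H(1) kappa_one by (metis IntI imageI)
    show "x \<in> \<kappa> ` (U \<inter> H) \<longleftrightarrow> (\<forall>p\<in>S1 \<union> S2. p x = 0)" if "\<forall>k\<ge>n. x k = 0" "csize n x < \<rho>" for x
      by (rule zeros[OF that])
    show "(\<lambda>k. if k < n then M k (join n x y) else 0) \<in> \<kappa> ` (U \<inter> H)"
      if xy: "x \<in> \<kappa> ` (U \<inter> H)" "y \<in> \<kappa> ` (U \<inter> H)" "csize n x < \<rho>" "csize n y < \<rho>" for x y
    proof -
      from xy obtain a b where ab: "a \<in> U" "a \<in> H" "x = \<kappa> a" "b \<in> U" "b \<in> H" "y = \<kappa> b" by blast
      have *: "a \<otimes> b \<in> U" "\<kappa> (a \<otimes> b) = (\<lambda>k. if k < n then M k (join n x y) else 0)"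
        using kmult[of a b] ab xy by auto
      have "\<kappa> (a \<otimes> b) \<in> \<kappa> ` (U \<inter> H)" using *(1) H(2) ab by blast
      then show ?thesis unfolding *(2) .
    qed
    show "M k (join n x (\<lambda>_. 0)) = x k" "M k (join n (\<lambda>_. 0) x) = x k"
      if xk: "x \<in> \<kappa> ` (U \<inter> H)" "csize n x < \<rho>" "k < n" for x k
    proof -
      from xk obtain a where a: "a \<in> U" "x = \<kappa> a" by blast
      have small: "sz a < \<rho>" "sz \<one> < \<rho>" using xk(2) a(2) \<rho>(1) by auto
      have e1: "\<kappa> (a \<otimes> \<one>) k = M k (join n (\<kappa> a) (\<kappa> \<one>))"
        using fun_cong[OF conjunct2[OF kmult[OF a(1) one_in_U small]], of k] xk(3) by presburger
      have e2: "\<kappa> (\<one> \<otimes> a) k = M k (join n (\<kappa> \<one>) (\<kappa> a))"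
        using fun_cong[OF conjunct2[OF kmult[OF one_in_U a(1) small(2,1)]], of k] xk(3) by presburger
      show "M k (join n x (\<lambda>_. 0)) = x k"
        using e1 unfolding a(2) kappa_one r_one[OF U_carrier[OF a(1)]] by (rule sym)
      show "M k (join n (\<lambda>_. 0) x) = x k"
        using e2 unfolding a(2) kappa_one l_one[OF U_carrier[OF a(1)]] by (rule sym)
    qed
  qed
  then show ?thesis using kmult by (intro exI[of _ M] exI[of _ "S1 \<union> S2"] exI[of _ \<rho>]) simp
qed

lemma mult_almost_additive:
  assumes "e > 0"
  shows "\<exists>d>0. \<forall>x\<in>U. \<forall>y\<in>U. sz x < d \<longrightarrow> sz y < d \<longrightarrow> x \<otimes> y \<in> U \<and>
    cdist n (\<kappa> (x \<otimes> y)) (\<lambda>k. \<kappa> x k + \<kappa> y k) \<le> e * sz y"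
proof -
  obtain M S \<rho> where lg: "local_group n (\<kappa> ` (U \<inter> carrier G)) M S \<rho>"
    and mult: "\<forall>x\<in>U. \<forall>y\<in>U. sz x < \<rho> \<longrightarrow> sz y < \<rho> \<longrightarrow>
    x \<otimes> y \<in> U \<and> \<kappa> (x \<otimes> y) = (\<lambda>k. if k < n then M k (join n (\<kappa> x) (\<kappa> y)) else 0)"
    using subgroup_local_group[of "carrier G"] locally_algebraic_carrier by auto
  interpret lg: local_group n "\<kappa> ` (U \<inter> carrier G)" M S \<rho> by (rule lg)
  obtain d where d: "d > 0" "\<forall>x\<in>\<kappa> ` (U \<inter> carrier G). \<forall>y\<in>\<kappa> ` (U \<inter> carrier G). csize n x < d \<longrightarrow> csize n y < d \<longrightarrow>
    cdist n (lg.mul x y) (\<lambda>k. x k + y k) \<le> e * csize n y"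
    using lg.mul_almost_additive[OF assms] by blast
  have "x \<otimes> y \<in> U \<and> cdist n (\<kappa> (x \<otimes> y)) (\<lambda>k. \<kappa> x k + \<kappa> y k) \<le> e * sz y"
    if xy: "x \<in> U" "y \<in> U" "sz x < min d \<rho>" "sz y < min d \<rho>" for x y
  proof -
    have "x \<otimes> y \<in> U" "\<kappa> (x \<otimes> y) = lg.mul (\<kappa> x) (\<kappa> y)"
      using mult xy by (auto simp: lg.mul_def[abs_def])
    then show ?thesis using d(2) xy U_carrier by auto
  qed
  moreover have "min d \<rho> > 0" using d(1) lg.rho_pos by simp
  ultimately show ?thesis by blast
qed

text \<open>
  The parameter is complex only because the curves are restrictions of holomorphic ones.
\<close>

definition curve_towards :: "'a set \<Rightarrow> real \<Rightarrow> 'a \<Rightarrow> (complex \<Rightarrow> 'a) \<Rightarrow> bool" where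
  "curve_towards H e h c \<longleftrightarrow> c 0 = \<one> \<and>
    continuous_map (top_of_set (closed_segment 0 1)) T c \<and>
    (\<forall>t\<in>closed_segment 0 1. c t \<in> U \<and> c t \<in> H \<and> cdist n (\<kappa> (c t)) (\<lambda>k. t * \<kappa> h k) \<le> e * sz h \<and>
      (\<gamma> h = h \<longrightarrow> \<gamma> (c t) = c t))"

lemma curve_in_subgroup:
  assumes H: "\<one> \<in> H" "\<And>x y. x \<in> H \<Longrightarrow> y \<in> H \<Longrightarrow> x \<otimes> y \<in> H" "locally_algebraic H" and "e > 0"
  shows "\<exists>d>0. \<forall>h\<in>U \<inter> H. sz h < d \<longrightarrow> (\<exists>c. curve_towards H e h c)"
proof -
  obtain M S \<rho> where lg: "local_group n (\<kappa> ` (U \<inter> H)) M S \<rho>"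
    using subgroup_local_group[OF H] by blast
  interpret lg: local_group n "\<kappa> ` (U \<inter> H)" M S \<rho> by (rule lg)
  obtain d where d: "d > 0" "\<And>r. csize n r < d \<Longrightarrow> r \<in> \<kappa> ` (U \<inter> H) \<longrightarrow> (\<exists>c::complex \<Rightarrow> nat \<Rightarrow> complex. c 0 = (\<lambda>_. 0) \<and>
    (\<forall>t\<in>closed_segment 0 1. c t \<in> \<kappa> ` (U \<inter> H) \<and> cdist n (c t) (\<lambda>k. t * r k) \<le> e * csize n r \<and>
      (\<forall>k. isCont (\<lambda>z. c z k) t) \<and> ((\<forall>k. r k \<in> \<real>) \<longrightarrow> (\<forall>k. c t k \<in> \<real>))))"
    using lg.curve_through[OF \<open>e > 0\<close>] by (rule near0E) (rule that)
  have "\<exists>c. curve_towards H e h c" if h: "h \<in> U \<inter> H" "sz h < d" for h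
  proof -
    have "\<kappa> h \<in> \<kappa> ` (U \<inter> H)" using h(1) by blast
    from d(2)[OF h(2), rule_format, OF this] obtain c :: "complex \<Rightarrow> nat \<Rightarrow> complex"
      where c0: "c 0 = (\<lambda>_. 0)" and c: "\<forall>t\<in>closed_segment 0 1. c t \<in> \<kappa> ` (U \<inter> H) \<and>
        cdist n (c t) (\<lambda>k. t * \<kappa> h k) \<le> e * sz h \<and>
        (\<forall>k. isCont (\<lambda>z. c z k) t) \<and> ((\<forall>k. \<kappa> h k \<in> \<real>) \<longrightarrow> (\<forall>k. c t k \<in> \<real>))"
      by (elim exE conjE) (rule that; assumption)
    define c' where "c' = (\<lambda>t k. c t k + \<phi> \<one> k)"
    have ct: "c' t \<in> V \<and> \<psi> (c' t) \<in> U \<and> \<psi> (c' t) \<in> H \<and> \<kappa> (\<psi> (c' t)) = c t" if t: "t \<in> closed_segment 0 1" for t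
    proof -
      obtain x where x: "x \<in> U" "x \<in> H" "c t = \<kappa> x" using c t by blast
      have "c' t = \<phi> x" by (simp add: c'_def x(3) \<kappa>_def)
      then show ?thesis using x phi_in psi_phi by simp
    qed
    show ?thesis
      unfolding curve_towards_def
    proof (intro exI[of _ "\<lambda>t. \<psi> (c' t)"] conjI ballI)
      show "\<psi> (c' 0) = \<one>" using psi_phi[OF one_in_U] by (simp add: c'_def c0)
      have "continuous_on (closed_segment 0 1) c'"
        using c unfolding c'_def
        by (intro continuous_on_coordinatewise_then_product continuous_intros continuous_at_imp_continuous_on) blast
      then have "continuous_map (top_of_set (closed_segment 0 1)) (top_of_set V) c'"
        using ct by (auto simp: continuous_map_in_subtopology)
      from continuous_map_compose[OF this continuous_psi]
      show "continuous_map (top_of_set (closed_segment 0 1)) T (\<lambda>t. \<psi> (c' t))" by (simp add: o_def)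
      fix t :: complex assume t: "t \<in> closed_segment 0 1"
      show inU: "\<psi> (c' t) \<in> U" and "\<psi> (c' t) \<in> H" using ct[OF t] by auto
      show "cdist n (\<kappa> (\<psi> (c' t))) (\<lambda>k. t * \<kappa> h k) \<le> e * sz h" using ct[OF t] c t by simp
      show "\<gamma> h = h \<longrightarrow> \<gamma> (\<psi> (c' t)) = \<psi> (c' t)"
      proof
        assume "\<gamma> h = h"
        then have "\<forall>k. \<kappa> h k \<in> \<real>" using kappa_gal[of h] h(1) by (metis IntD1 Reals_cnj_iff)
        then have "\<forall>k. c t k \<in> \<real>" using c t by blast
        then have "\<kappa> (\<gamma> (\<psi> (c' t))) = \<kappa> (\<psi> (c' t))"
          using kappa_gal[OF inU] ct[OF t] by (auto simp: Reals_cnj_iff)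
        then show "\<gamma> (\<psi> (c' t)) = \<psi> (c' t)" using kappa_inj[OF gal_in[OF inU] inU] by simp
      qed
    qed
  qed
  then show ?thesis using d(1) by blast
qed

text \<open>
  With \<open>z = x\<^sup>-\<^sup>1 y\<close>, almost additivity of \<open>y = x z\<close> bounds
  \<open>|\<kappa> z|\<close> by \<open>|\<kappa> y - \<kappa> x| + |\<kappa> z| / 2\<close>.
\<close>

lemma quotient_estimate:
  "\<exists>d>0. \<forall>x\<in>U. \<forall>y\<in>U. sz x < d \<longrightarrow> sz y < d \<longrightarrow> inv x \<otimes> y \<in> U \<and>
    sz (inv x \<otimes> y) \<le> 2 * cdist n (\<kappa> y) (\<kappa> x)"
proof -
  obtain d1 where d1: "d1 > 0" "\<forall>x\<in>U. \<forall>y\<in>U. sz x < d1 \<longrightarrow> sz y < d1 \<longrightarrow> x \<otimes> y \<in> U \<and>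
    cdist n (\<kappa> (x \<otimes> y)) (\<lambda>k. \<kappa> x k + \<kappa> y k) \<le> 1/2 * sz y"
    using mult_almost_additive[of "1/2"] by auto
  have "eventually (\<lambda>x. x \<in> U \<and> sz x < d1) near1"
    unfolding near1_chart using d1(1) by blast
  from near1_pair_chart[OF near1_inv_mult[OF this]]
  obtain d2 where d2: "d2 > 0" "\<forall>x\<in>U. \<forall>y\<in>U. sz x < d2 \<longrightarrow> sz y < d2 \<longrightarrow>
      inv x \<otimes> y \<in> U \<and> sz (inv x \<otimes> y) < d1" by auto
  have "inv x \<otimes> y \<in> U \<and> sz (inv x \<otimes> y) \<le> 2 * cdist n (\<kappa> y) (\<kappa> x)"
    if xy: "x \<in> U" "y \<in> U" "sz x < min d1 d2" "sz y < min d1 d2" for x y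
  proof -
    define z where "z = inv x \<otimes> y"
    have z: "z \<in> U" "sz z < d1" using d2(2) xy by (auto simp: z_def)
    have "x \<otimes> z = y" using xy U_carrier by (simp add: z_def m_assoc[symmetric])
    have "sz x < d1" using xy(3) by simp
    from d1(2)[rule_format, OF xy(1) z(1) this z(2)]
    have "cdist n (\<kappa> y) (\<lambda>k. \<kappa> x k + \<kappa> z k) \<le> 1/2 * sz z"
      unfolding \<open>x \<otimes> z = y\<close> by (rule conjunct2)
    moreover have "sz z \<le> cdist n (\<kappa> z) (\<lambda>k. \<kappa> y k - \<kappa> x k) + cdist n (\<kappa> y) (\<kappa> x)"
      by (rule csize_le_cdist)
    moreover have "cdist n (\<kappa> z) (\<lambda>k. \<kappa> y k - \<kappa> x k) = cdist n (\<kappa> y) (\<lambda>k. \<kappa> x k + \<kappa> z k)"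
      by (subst cdist_commute) (simp add: algebra_simps)
    ultimately show ?thesis using z(1) by (simp add: z_def)
  qed
  moreover have "min d1 d2 > 0" using d1(1) d2(1) by simp
  ultimately show ?thesis by blast
qed

lemma compact_chart_part:
  assumes "closed C"
  shows "compactin T {x \<in> U. sz x \<le> d \<and> \<kappa> x \<in> C}"
proof -
  have "continuous_on UNIV (\<lambda>y::nat \<Rightarrow> complex. (\<lambda>k. y k - \<phi> \<one> k))"
    by (intro continuous_on_coordinatewise_then_product continuous_intros) (rule continuous_on_product_coordinates)
  then have "closed {y. (\<lambda>k. y k - \<phi> \<one> k) \<in> C}"
    using continuous_closed_preimage[of UNIV _ C] assms by (simp add: vimage_def)
  then have "compact ({y \<in> V. cdist n y (\<phi> \<one>) \<le> d} \<inter> {y. (\<lambda>k. y k - \<phi> \<one> k) \<in> C})"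
    by (rule compact_Int_closed[OF compact_ball_V])
  then have "compactin (top_of_set V) ({y \<in> V. cdist n y (\<phi> \<one>) \<le> d} \<inter> {y. (\<lambda>k. y k - \<phi> \<one> k) \<in> C})"
    by (auto simp: compactin_subtopology)
  from image_compactin[OF this continuous_psi]
  have "compactin T (\<psi> ` ({y \<in> V. cdist n y (\<phi> \<one>) \<le> d} \<inter> {y. (\<lambda>k. y k - \<phi> \<one> k) \<in> C}))" .
  also have "\<psi> ` ({y \<in> V. cdist n y (\<phi> \<one>) \<le> d} \<inter> {y. (\<lambda>k. y k - \<phi> \<one> k) \<in> C}) = {x \<in> U. sz x \<le> d \<and> \<kappa> x \<in> C}"
  proof (intro equalityI subsetI)
    fix x assume "x \<in> \<psi> ` ({y \<in> V. cdist n y (\<phi> \<one>) \<le> d} \<inter> {y. (\<lambda>k. y k - \<phi> \<one> k) \<in> C})"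
    then obtain y where y: "y \<in> V" "cdist n y (\<phi> \<one>) \<le> d" "(\<lambda>k. y k - \<phi> \<one> k) \<in> C" "x = \<psi> y" by blast
    have "x \<in> U" "\<kappa> x = (\<lambda>k. y k - \<phi> \<one> k)" using psi_in[OF y(1)] phi_psi[OF y(1)] y(4) by (auto simp: \<kappa>_def)
    then show "x \<in> {x \<in> U. sz x \<le> d \<and> \<kappa> x \<in> C}" using y by simp
  next
    fix x assume x: "x \<in> {x \<in> U. sz x \<le> d \<and> \<kappa> x \<in> C}"
    then have 1: "\<phi> x \<in> {y \<in> V. cdist n y (\<phi> \<one>) \<le> d} \<inter> {y. (\<lambda>k. y k - \<phi> \<one> k) \<in> C}"
      using phi_in by (auto simp: \<kappa>_def[abs_def])
    have 2: "x = \<psi> (\<phi> x)" using x psi_phi by auto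
    show "x \<in> \<psi> ` ({y \<in> V. cdist n y (\<phi> \<one>) \<le> d} \<inter> {y. (\<lambda>k. y k - \<phi> \<one> k) \<in> C})" by (rule image_eqI[of x \<psi> "\<phi> x", OF 2 1])
  qed
  finally show ?thesis .
qed

lemma minimum_on_compact:
  fixes f :: "'a \<Rightarrow> real"
  assumes "compactin T Z" "Z \<noteq> {}" "Z \<subseteq> U" "continuous_map (subtopology T U) euclidean f"
  shows "\<exists>r\<in>Z. \<forall>x\<in>Z. f r \<le> f x"
proof -
  have "compactin (subtopology T U) Z" using assms by (simp add: compactin_subtopology)
  from image_compactin[OF this assms(4)] have "compact (f ` Z)" by simp
  then show ?thesis using compact_attains_inf[of "f ` Z"] assms(2) by auto
qed

lemma real_iff_kappa: "x \<in> U \<Longrightarrow> x \<in> R \<longleftrightarrow> (\<forall>k. \<kappa> x k \<in> \<real>)"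
proof -
  assume x: "x \<in> U"
  have "\<gamma> x = x \<longleftrightarrow> \<kappa> (\<gamma> x) = \<kappa> x" using kappa_inj[OF gal_in[OF x] x] by auto
  then show ?thesis using x U_carrier by (auto simp: R_iff kappa_gal fun_eq_iff Reals_cnj_iff)
qed

text \<open>
  Among the points of the coset \<open>I b\<close> that are at most as far from \<open>1\<close> as
  \<open>b\<close>, take one, \<open>r\<close>, of least distance to \<open>1\<close>. If
  \<open>r \<noteq> 1\<close>, a real curve from \<open>1\<close> ends at a point \<open>e \<in> I\<close> so
  close to \<open>r\<close> that \<open>e\<^sup>-\<^sup>1 r\<close>, which is in the same coset, is at most half
  as far from \<open>1\<close>.
\<close>

lemma real_near_one_in_I: "eventually (\<lambda>b. b \<in> R \<longrightarrow> b \<in> I) near1"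
proof -
  obtain d1 where d1: "d1 > 0" "\<forall>h\<in>U \<inter> carrier G. sz h < d1 \<longrightarrow> (\<exists>c. curve_towards (carrier G) (1/4) h c)"
    using curve_in_subgroup[OF one_closed m_closed locally_algebraic_carrier, of "1/4"] by auto
  obtain d2 where d2: "d2 > 0" "\<forall>x\<in>U. \<forall>y\<in>U. sz x < d2 \<longrightarrow> sz y < d2 \<longrightarrow> inv x \<otimes> y \<in> U \<and>
    sz (inv x \<otimes> y) \<le> 2 * cdist n (\<kappa> y) (\<kappa> x)"
    using quotient_estimate by blast
  define d where "d = min d1 (d2 / 2)"
  have d: "d > 0" "d \<le> d1" "2 * d \<le> d2" using d1(1) d2(1) by (auto simp: d_def)
  \<comment> \<open>\<open>e\<close> is the end point of a real curve through an approximation of \<open>h\<close>\<close>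
  have step: "\<exists>e\<in>I. inv e \<otimes> h \<in> U \<and> sz (inv e \<otimes> h) \<le> 1/2 * sz h" if h: "h \<in> U" "h \<in> R" "sz h < d" for h
  proof -
    have "h \<in> U \<inter> carrier G" "sz h < d1" using h d R_carrier by auto
    from d1(2)[rule_format, OF this, unfolded curve_towards_def] obtain c :: "complex \<Rightarrow> 'a" where c0: "c 0 = \<one>"
      and cont: "continuous_map (top_of_set (closed_segment 0 1)) T c"
      and c: "\<forall>t\<in>closed_segment 0 1. c t \<in> U \<and> c t \<in> carrier G \<and> cdist n (\<kappa> (c t)) (\<lambda>k. t * \<kappa> h k) \<le> 1/4 * sz h \<and>
        (\<gamma> h = h \<longrightarrow> \<gamma> (c t) = c t)"
      by (elim exE conjE) (rule that; assumption)
    have 1: "(1::complex) \<in> closed_segment 0 1" "(0::complex) \<in> closed_segment 0 1" by auto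
    have cR: "c t \<in> R" if "t \<in> closed_segment 0 1" for t using c that h(2) by (auto simp: R_iff)
    have "c ` closed_segment 0 1 \<subseteq> I"
    proof (rule connected_in_I)
      have "connectedin (top_of_set (closed_segment 0 1)) (closed_segment (0::complex) 1)"
        by (simp add: connectedin_subtopology connected_segment)
      from connectedin_continuous_map_image[OF cont this]
      show "connectedin (subtopology T R) (c ` closed_segment 0 1)"
        using cR by (auto simp: connectedin_subtopology)
      show "\<one> \<in> c ` closed_segment 0 1" using c0 1 by (metis imageI)
    qed
    then have "c 1 \<in> I" using 1 by blast
    moreover have c1: "c 1 \<in> U" "cdist n (\<kappa> (c 1)) (\<kappa> h) \<le> 1/4 * sz h" using c 1 by force+
    then have "sz (c 1) \<le> 2 * sz h"
      using csize_le_cdist[of n "\<kappa> (c 1)" "\<kappa> h"] csize_nonneg[of n "\<kappa> h"] by linarith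
    then have "sz (c 1) < d2" "sz h < d2" using h(3) d by auto
    then have "inv (c 1) \<otimes> h \<in> U" "sz (inv (c 1) \<otimes> h) \<le> 2 * cdist n (\<kappa> h) (\<kappa> (c 1))"
      using d2(2) c1(1) h(1) by auto
    ultimately show ?thesis using c1(2) cdist_commute[of n "\<kappa> h" "\<kappa> (c 1)"] by (intro bexI[of _ "c 1"]) auto
  qed
  have "b \<in> I" if b: "b \<in> U" "b \<in> R" "sz b < d" for b
  proof -
    define K where "K = {x \<in> U. sz x \<le> sz b \<and> \<kappa> x \<in> {u. \<forall>k. u k \<in> \<real>}}"
    have K: "compactin T K" unfolding K_def by (rule compact_chart_part[OF closed_real_vectors])
    have KR: "K \<subseteq> R" unfolding K_def using real_iff_kappa by blast
    define Z where "Z = K \<inter> {r \<in> R. r \<otimes> inv b \<in> I}"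
    have "continuous_map (subtopology T R) (subtopology T R) (\<lambda>r. r \<otimes> inv b)"
      using continuous_right[of "inv b"] b(2) R_carrier R_mult R_inv topspace_TR
      by (auto simp: continuous_map_in_subtopology continuous_map_from_subtopology)
    from closedin_continuous_map_preimage[OF this I_closed]
    have "closedin (subtopology T R) {r \<in> R. r \<otimes> inv b \<in> I}" unfolding topspace_TR .
    moreover have "compactin (subtopology T R) K" using K KR by (simp add: compactin_subtopology)
    ultimately have "compactin (subtopology T R) Z" unfolding Z_def using compact_Int_closedin by blast
    then have Z: "compactin T Z" by (simp add: compactin_subtopology)
    have bZ: "b \<in> Z"
      unfolding Z_def K_def using b real_iff_kappa one_in_I R_carrier by auto
    have "continuous_map (subtopology T U) euclidean sz"
      unfolding sz_eq by (rule continuous_dist)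
    moreover have "Z \<subseteq> U" unfolding Z_def K_def by blast
    ultimately obtain r where r: "r \<in> Z" "\<And>x. x \<in> Z \<Longrightarrow> sz r \<le> sz x"
      using minimum_on_compact[OF Z] bZ by blast
    have rK: "r \<in> U" "r \<in> R" "sz r \<le> sz b" "r \<otimes> inv b \<in> I" using r(1) KR unfolding Z_def K_def by auto
    obtain e where e: "e \<in> I" "inv e \<otimes> r \<in> U" "sz (inv e \<otimes> r) \<le> 1/2 * sz r"
      using step[OF rK(1,2)] rK(3) b(3) by auto
    have eR: "inv e \<otimes> r \<in> R" using e(1) rK(2) I_real R_mult R_inv by blast
    have "inv e \<otimes> r \<otimes> inv b = inv e \<otimes> (r \<otimes> inv b)"
      using e(1) rK(2) b(2) R_carrier I_carrier by (simp add: m_assoc)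
    then have "inv e \<otimes> r \<otimes> inv b \<in> I" using I_inv_mult[OF e(1) rK(4)] by simp
    moreover have "sz (inv e \<otimes> r) \<le> sz b" using e(3) rK(3) csize_nonneg[of n "\<kappa> r"] by linarith
    ultimately have "inv e \<otimes> r \<in> Z"
      unfolding Z_def K_def using e(2) eR real_iff_kappa[OF e(2)] by simp
    then have "sz r \<le> 1/2 * sz r" using r(2) e(3) by force
    then have "sz r = 0" using csize_nonneg[of n "\<kappa> r"] by linarith
    then have "r = \<one>" by (rule sz_zero[OF rK(1)])
    then have "inv b \<in> I" using rK(4) b(2) R_carrier R_inv by simp
    then show "b \<in> I" using I_inv[of "inv b"] b(2) R_carrier by simp
  qed
  then show ?thesis unfolding near1_chart using d(1) by blast
qed

text \<open>
  Among the elements of \<open>b H\<close> near \<open>1\<close>, take one, \<open>r\<close>, with the least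
  imaginary part, which is measured by \<open>E\<close>. Its defect
  \<open>h = r\<^sup>-\<^sup>1 \<gamma>(r)\<close> is an element of \<open>H\<close> with
  \<open>h \<gamma>(h) = 1\<close>. If \<open>s \<in> H\<close> is close to \<open>h/2\<close>, then
  \<open>\<gamma>(r s) = r (h \<gamma>(s))\<close>, and \<open>h \<gamma>(s)\<close> is
  \<open>h - h/2 = h/2\<close> to first order, as is \<open>s\<close>. So \<open>E(r s)\<close> is at most half
  of \<open>E r\<close>, which is impossible unless \<open>E r = 0\<close>.
  
  The step from \<open>r\<close> to \<open>r s\<close> increases \<open>|\<kappa> r|\<close> by at most
  \<open>4 E(r)\<close> and lowers \<open>8 E\<close> by at least as much. Minimising over the compact set where
  \<open>|\<kappa> x| + 8 E(x)\<close> does not exceed its value at \<open>b\<close> therefore keeps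
  \<open>r s\<close> in the competition.
\<close>

lemma real_lift_near_one:
  assumes H: "subgroup H G" "\<And>x. x \<in> H \<Longrightarrow> \<gamma> x \<in> H" "locally_algebraic H" "closedin T H" and "D > 0"
  shows "eventually (\<lambda>b. inv b \<otimes> \<gamma> b \<in> H \<longrightarrow> (\<exists>r\<in>R. r \<in> U \<and> sz r < D \<and> inv b \<otimes> r \<in> H)) near1"
proof -
  have H1: "\<one> \<in> H" and Hm: "\<And>x y. x \<in> H \<Longrightarrow> y \<in> H \<Longrightarrow> x \<otimes> y \<in> H"
    and Hi: "\<And>x. x \<in> H \<Longrightarrow> inv x \<in> H" and Hc: "\<And>x. x \<in> H \<Longrightarrow> x \<in> carrier G"
    using H(1) by (auto simp: subgroup.one_closed subgroup.m_closed subgroup.m_inv_closed subgroup.mem_carrier)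
  obtain d1 where d1: "d1 > 0" "\<forall>h\<in>U \<inter> H. sz h < d1 \<longrightarrow> (\<exists>c. curve_towards H (1/32) h c)"
    using curve_in_subgroup[OF H1 Hm H(3), of "1/32"] by auto
  obtain d2 where d2: "d2 > 0" "\<forall>x\<in>U. \<forall>y\<in>U. sz x < d2 \<longrightarrow> sz y < d2 \<longrightarrow> inv x \<otimes> y \<in> U \<and>
    sz (inv x \<otimes> y) \<le> 2 * cdist n (\<kappa> y) (\<kappa> x)"
    using quotient_estimate by blast
  obtain d3 where d3: "d3 > 0" "\<forall>x\<in>U. \<forall>y\<in>U. sz x < d3 \<longrightarrow> sz y < d3 \<longrightarrow> x \<otimes> y \<in> U \<and>
    cdist n (\<kappa> (x \<otimes> y)) (\<lambda>k. \<kappa> x k + \<kappa> y k) \<le> 1/32 * sz y"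
    using mult_almost_additive[of "1/32"] by auto
  \<comment> \<open>the tolerances \<open>1/32\<close> add up to \<open>15/64 \<le> 1/4\<close> in \<open>bound\<close> below, which with \<open>|h| \<le> 2 E r\<close> gives
      the factor \<open>1/2\<close>\<close>
  define d where "d = min D (Min {d1, d2, d3})"
  have d: "d > 0" "d \<le> D" "d \<le> d1" "d \<le> d2" "d \<le> d3"
    using d1(1) d2(1) d3(1) \<open>D > 0\<close> by (auto simp: d_def)
  define E where "E = (\<lambda>x. csize n (\<lambda>k. cnj (\<kappa> x k) - \<kappa> x k))"
  have E_gal: "E x = cdist n (\<kappa> (\<gamma> x)) (\<kappa> x)" if "x \<in> U" for x
    using that by (simp add: E_def kappa_gal)
  have E_le: "E x \<le> 2 * sz x" for x
    unfolding E_def using csize_triangle_diff[of n "\<lambda>k. cnj (\<kappa> x k)" "\<kappa> x"] by simp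
  have add: "x \<otimes> y \<in> U \<and> cdist n (\<kappa> (x \<otimes> y)) (\<lambda>k. \<kappa> x k + \<kappa> y k) \<le> 1/32 * sz y"
    if "x \<in> U" "y \<in> U" "sz x < d" "sz y < d" for x y
    using d3(2) that d(5) by (meson order_less_le_trans)
  have step: "\<exists>s\<in>H. s \<in> U \<and> r \<otimes> s \<in> U \<and> E (r \<otimes> s) \<le> 1/2 * E r \<and> sz (r \<otimes> s) \<le> sz r + 4 * E r"
    if r: "r \<in> U" "sz r < d / 16" and rH: "inv r \<otimes> \<gamma> r \<in> H" for r
  proof -
    define h where "h = inv r \<otimes> \<gamma> r"
    have rc: "r \<in> carrier G" "\<gamma> r \<in> carrier G" using r U_carrier gal_closed by auto
    have hc: "h \<in> carrier G" using rc by (simp add: h_def)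
    have h: "h \<in> U" "sz h \<le> 2 * E r"
      using d2(2) r gal_in[OF r(1)] sz_gal[OF r(1)] d E_gal[OF r(1)] by (auto simp: h_def)
    have h_small: "sz h < d / 4" using h(2) E_le[of r] r(2) by linarith
    have rh: "r \<otimes> h = \<gamma> r" using rc by (simp add: h_def m_assoc[symmetric])
    have "\<gamma> h = inv (\<gamma> r) \<otimes> r"
      using rc gal_gal[OF r(1)] by (simp add: h_def gal_mult gal_inv)
    then have "h \<otimes> \<gamma> h = inv r \<otimes> ((\<gamma> r \<otimes> inv (\<gamma> r)) \<otimes> r)"
      using rc by (simp only: h_def m_assoc inv_closed m_closed)
    also have "\<dots> = \<one>" using rc by simp
    finally have "h \<otimes> \<gamma> h = \<one>" .
    moreover have "cdist n (\<kappa> (h \<otimes> \<gamma> h)) (\<lambda>k. \<kappa> h k + \<kappa> (\<gamma> h) k) \<le> 1/32 * sz (\<gamma> h)"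
      using add[OF h(1) gal_in[OF h(1)]] sz_gal[OF h(1)] h_small d(1) by simp
    ultimately have anti: "csize n (\<lambda>k. \<kappa> h k + cnj (\<kappa> h k)) \<le> 1/32 * sz h"
      using sz_gal[OF h(1)] kappa_gal[OF h(1)] cdist_commute[of n "\<lambda>_. 0" "\<lambda>k. \<kappa> h k + cnj (\<kappa> h k)"] by simp
    have "h \<in> U \<inter> H" "sz h < d1" using h(1) rH h_small d by (auto simp: h_def)
    from d1(2)[rule_format, OF this, unfolded curve_towards_def] obtain c :: "complex \<Rightarrow> 'a" where
      c: "\<forall>t\<in>closed_segment 0 1. c t \<in> U \<and> c t \<in> H \<and> cdist n (\<kappa> (c t)) (\<lambda>k. t * \<kappa> h k) \<le> 1/32 * sz h \<and>
        (\<gamma> h = h \<longrightarrow> \<gamma> (c t) = c t)"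
      by (elim exE conjE) (rule that; assumption)
    define s where "s = c (1/2)"
    have "(1/2::complex) \<in> closed_segment 0 1"
      unfolding closed_segment_def by (auto simp: scaleR_conv_of_real intro!: exI[of _ "1/2"])
    then have s: "s \<in> U" "s \<in> H" "cdist n (\<kappa> s) (\<lambda>k. 1/2 * \<kappa> h k) \<le> 1/32 * sz h"
      using c unfolding s_def by blast+
    have sc: "s \<in> carrier G" "\<gamma> s \<in> carrier G" using s U_carrier gal_closed by auto
    have half: "csize n (\<lambda>k. 1/2 * \<kappa> h k) = 1/2 * sz h"
      using csize_scale[of n "1/2" "\<kappa> h"] by simp
    have s_size: "sz s \<le> sz h"
      using csize_le_cdist[of n "\<kappa> s" "\<lambda>k. 1/2 * \<kappa> h k"] s(3) half csize_nonneg[of n "\<kappa> h"] by linarith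
    have gs: "\<gamma> s \<in> U" "sz (\<gamma> s) = sz s" using gal_in[OF s(1)] sz_gal[OF s(1)] by auto
    define g where "g = h \<otimes> \<gamma> s"
    have g: "g \<in> U" "cdist n (\<kappa> g) (\<lambda>k. \<kappa> h k + \<kappa> (\<gamma> s) k) \<le> 1/32 * sz s"
      using add[OF h(1) gs(1)] gs h_small s_size d(1) by (auto simp: g_def)
    have g_size: "sz g \<le> 3 * sz h"
    proof -
      have "sz g \<le> cdist n (\<kappa> g) (\<lambda>k. \<kappa> h k + \<kappa> (\<gamma> s) k) + csize n (\<lambda>k. \<kappa> h k + \<kappa> (\<gamma> s) k)"
        by (rule csize_le_cdist)
      moreover have "csize n (\<lambda>k. \<kappa> h k + \<kappa> (\<gamma> s) k) \<le> sz h + sz s"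
        using csize_triangle[of n "\<kappa> h" "\<kappa> (\<gamma> s)"] gs(2) by simp
      ultimately show ?thesis using g(2) s_size csize_nonneg[of n "\<kappa> h"] by linarith
    qed
    have rs: "r \<otimes> s \<in> U" "cdist n (\<kappa> (r \<otimes> s)) (\<lambda>k. \<kappa> r k + \<kappa> s k) \<le> 1/32 * sz s"
      using add[OF r(1) s(1)] r(2) s_size h_small d(1) by auto
    have rg: "cdist n (\<kappa> (r \<otimes> g)) (\<lambda>k. \<kappa> r k + \<kappa> g k) \<le> 1/32 * sz g"
      using add[OF r(1) g(1)] r(2) g_size h_small d(1) by auto
    have gal_rs: "\<gamma> (r \<otimes> s) = r \<otimes> g"
      using rc sc hc rh by (simp add: gal_mult g_def m_assoc[symmetric])
    have E_rs: "E (r \<otimes> s) = cdist n (\<kappa> (r \<otimes> g)) (\<kappa> (r \<otimes> s))"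
      using E_gal[OF rs(1)] gal_rs by simp
    \<comment> \<open>\<open>h + cnj h\<close> is small by \<open>anti\<close>, so \<open>h + cnj s\<close> and \<open>s\<close> are both close to \<open>h/2\<close>\<close>
    have gs_diff: "cdist n (\<kappa> g) (\<kappa> s) \<le> (1/32 + 1/32 + 1/64 + 1/32) * sz h"
    proof -
      have "cdist n (\<lambda>k. \<kappa> h k + \<kappa> (\<gamma> s) k) (\<kappa> s) \<le>
          csize n (\<lambda>k. 1/2 * (\<kappa> h k + cnj (\<kappa> h k))) + (cdist n (\<kappa> (\<gamma> s)) (\<lambda>k. 1/2 * cnj (\<kappa> h k)) + cdist n (\<lambda>k. 1/2 * \<kappa> h k) (\<kappa> s))"
      proof -
        have eq: "(\<lambda>k. \<kappa> h k + \<kappa> (\<gamma> s) k - \<kappa> s k) = (\<lambda>k. 1/2 * (\<kappa> h k + cnj (\<kappa> h k)) +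
            ((\<kappa> (\<gamma> s) k - 1/2 * cnj (\<kappa> h k)) + (1/2 * \<kappa> h k - \<kappa> s k)))"
          by (auto simp: field_simps)
        show ?thesis
          unfolding eq by (intro order_trans[OF csize_triangle] add_left_mono csize_triangle)
      qed
      moreover have "csize n (\<lambda>k. 1/2 * (\<kappa> h k + cnj (\<kappa> h k))) \<le> 1/64 * sz h"
        using csize_scale[of n "1/2" "\<lambda>k. \<kappa> h k + cnj (\<kappa> h k)"] anti by simp
      moreover have "cdist n (\<kappa> (\<gamma> s)) (\<lambda>k. 1/2 * cnj (\<kappa> h k)) \<le> 1/32 * sz h"
      proof -
        have "(\<lambda>k. \<kappa> (\<gamma> s) k - 1/2 * cnj (\<kappa> h k)) = (\<lambda>k. cnj (\<kappa> s k - 1/2 * \<kappa> h k))"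
          by (simp add: kappa_gal[OF s(1)])
        then have "cdist n (\<kappa> (\<gamma> s)) (\<lambda>k. 1/2 * cnj (\<kappa> h k)) = cdist n (\<kappa> s) (\<lambda>k. 1/2 * \<kappa> h k)"
          using csize_cnj[of n "\<lambda>k. \<kappa> s k - 1/2 * \<kappa> h k"] by presburger
        then show ?thesis using s(3) by simp
      qed
      moreover have "cdist n (\<lambda>k. 1/2 * \<kappa> h k) (\<kappa> s) \<le> 1/32 * sz h"
        using s(3) cdist_commute[of n "\<kappa> s" "\<lambda>k. 1/2 * \<kappa> h k"] by simp
      moreover have "cdist n (\<kappa> g) (\<kappa> s) \<le> cdist n (\<kappa> g) (\<lambda>k. \<kappa> h k + \<kappa> (\<gamma> s) k) + cdist n (\<lambda>k. \<kappa> h k + \<kappa> (\<gamma> s) k) (\<kappa> s)"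
        by (rule cdist_triangle)
      moreover have "1/32 * sz s \<le> 1/32 * sz h" using s_size by simp
      ultimately show ?thesis using g(2) by (simp add: field_simps)
    qed
    have "E (r \<otimes> s) \<le> cdist n (\<kappa> (r \<otimes> g)) (\<lambda>k. \<kappa> r k + \<kappa> g k) +
        (cdist n (\<lambda>k. \<kappa> r k + \<kappa> g k) (\<lambda>k. \<kappa> r k + \<kappa> s k) + cdist n (\<lambda>k. \<kappa> r k + \<kappa> s k) (\<kappa> (r \<otimes> s)))"
      unfolding E_rs
      by (rule order_trans[OF cdist_triangle[where y = "\<lambda>k. \<kappa> r k + \<kappa> g k"]], rule add_left_mono, rule cdist_triangle)
    also have "cdist n (\<lambda>k. \<kappa> r k + \<kappa> g k) (\<lambda>k. \<kappa> r k + \<kappa> s k) = cdist n (\<kappa> g) (\<kappa> s)"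
      by simp
    also have "cdist n (\<lambda>k. \<kappa> r k + \<kappa> s k) (\<kappa> (r \<otimes> s)) = cdist n (\<kappa> (r \<otimes> s)) (\<lambda>k. \<kappa> r k + \<kappa> s k)"
      by (rule cdist_commute)
    finally have E_sum: "E (r \<otimes> s) \<le> cdist n (\<kappa> (r \<otimes> g)) (\<lambda>k. \<kappa> r k + \<kappa> g k) +
        (cdist n (\<kappa> g) (\<kappa> s) + cdist n (\<kappa> (r \<otimes> s)) (\<lambda>k. \<kappa> r k + \<kappa> s k))" .
    have bound: "e \<le> 1/4 * h'" if "e \<le> a + (b + c)" "a \<le> 1/32 * g'" "b \<le> (1/32 + 1/32 + 1/64 + 1/32) * h'"
      "c \<le> 1/32 * s'" "g' \<le> 3 * h'" "s' \<le> h'" "0 \<le> h'" for e a b c g' s' h' :: real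
      using that by (simp add: field_simps)
    have "E (r \<otimes> s) \<le> 1/4 * sz h"
      by (rule bound[OF E_sum rg gs_diff rs(2) g_size s_size csize_nonneg])
    then have "E (r \<otimes> s) \<le> 1/2 * E r" using h(2) by linarith
    moreover have "sz (r \<otimes> s) \<le> sz r + 4 * E r"
    proof -
      have "sz (r \<otimes> s) \<le> cdist n (\<kappa> (r \<otimes> s)) (\<lambda>k. \<kappa> r k + \<kappa> s k) + csize n (\<lambda>k. \<kappa> r k + \<kappa> s k)"
        by (rule csize_le_cdist)
      moreover have "csize n (\<lambda>k. \<kappa> r k + \<kappa> s k) \<le> sz r + sz s" by (rule csize_triangle)
      ultimately show ?thesis using rs(2) s_size h(2) csize_nonneg[of n "\<kappa> s"] by linarith
    qed
    ultimately show ?thesis using s rs(1) by blast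
  qed
  have E_cont: "continuous_map (subtopology T U) euclidean E"
    unfolding E_def csize_def \<kappa>_def using continuous_coord
    by (simp add: continuous_map_atin tendsto_sum tendsto_norm tendsto_diff tendsto_cnj)
  have "\<exists>r\<in>R. r \<in> U \<and> sz r < D \<and> inv b \<otimes> r \<in> H"
    if b: "b \<in> U" "sz b < d / 300" and bH: "inv b \<otimes> \<gamma> b \<in> H" for b
  proof -
    have bc: "b \<in> carrier G" "\<gamma> b \<in> carrier G" using b U_carrier gal_closed by auto
    define B where "B = sz b + 8 * E b"
    have B: "B < d / 16" using b(2) E_le[of b] d(1) unfolding B_def by linarith
    define C where "C = {u::nat \<Rightarrow> complex. csize n u + 8 * csize n (\<lambda>k. cnj (u k) - u k) \<le> B}"
    have "continuous_on UNIV (\<lambda>u::nat \<Rightarrow> complex. csize n u + 8 * csize n (\<lambda>k. cnj (u k) - u k))"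
      unfolding csize_def by (intro continuous_intros continuous_on_cnj) (rule continuous_on_product_coordinates)+
    then have "closed C"
      using continuous_closed_preimage[of UNIV "\<lambda>u::nat \<Rightarrow> complex. csize n u + 8 * csize n (\<lambda>k. cnj (u k) - u k)" "{..B}"]
      by (simp add: C_def vimage_def)
    then have "compactin T {x \<in> U. sz x \<le> B \<and> \<kappa> x \<in> C}" by (rule compact_chart_part)
    moreover have "closedin T {x \<in> topspace T. inv b \<otimes> x \<in> H}"
      by (rule closedin_continuous_map_preimage[OF continuous_left H(4)]) (use bc in simp)
    ultimately have "compactin T ({x \<in> U. sz x \<le> B \<and> \<kappa> x \<in> C} \<inter> {x \<in> topspace T. inv b \<otimes> x \<in> H})"
      by (rule compact_Int_closedin)
    also have "{x \<in> U. sz x \<le> B \<and> \<kappa> x \<in> C} \<inter> {x \<in> topspace T. inv b \<otimes> x \<in> H} =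
        {x \<in> U. sz x + 8 * E x \<le> B \<and> inv b \<otimes> x \<in> H}" (is "_ = ?Z")
    proof -
      have "sz x \<le> B" if "sz x + 8 * E x \<le> B" for x
        using that csize_nonneg[of n "\<lambda>k. cnj (\<kappa> x k) - \<kappa> x k"] unfolding E_def by linarith
      then show ?thesis using U_carrier by (auto simp: C_def E_def topspace_T)
    qed
    finally have Z: "compactin T ?Z" .
    have bZ: "b \<in> ?Z" using b bc H1 by (simp add: B_def)
    obtain r where r: "r \<in> ?Z" "\<And>x. x \<in> ?Z \<Longrightarrow> E r \<le> E x"
      using minimum_on_compact[OF Z _ _ E_cont] bZ by blast
    have E0: "E x \<ge> 0" for x by (simp add: E_def)
    have rU: "r \<in> U" "sz r + 8 * E r \<le> B" "inv b \<otimes> r \<in> H" using r(1) by auto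
    have rc: "r \<in> carrier G" using rU U_carrier by auto
    have r_small: "sz r < d / 16" using rU(2) B E0[of r] by linarith
    have "inv r \<otimes> \<gamma> r = inv (inv b \<otimes> r) \<otimes> (inv b \<otimes> \<gamma> b) \<otimes> \<gamma> (inv b \<otimes> r)"
    proof -
      have "\<gamma> b \<otimes> \<gamma> (inv b \<otimes> r) = \<gamma> r"
        using bc rc gal_closed by (simp add: gal_mult gal_inv m_assoc[symmetric])
      then show ?thesis
        using bc rc gal_closed by (simp add: inv_mult_group m_assoc) (simp add: m_assoc[symmetric])
    qed
    then have "inv r \<otimes> \<gamma> r \<in> H" using Hm Hi H(2) bH rU(3) by simp
    from step[OF rU(1) r_small this] obtain s where s: "s \<in> H" "r \<otimes> s \<in> U" "E (r \<otimes> s) \<le> 1/2 * E r"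
      "sz (r \<otimes> s) \<le> sz r + 4 * E r" by blast
    have "inv b \<otimes> (r \<otimes> s) = (inv b \<otimes> r) \<otimes> s" using bc rc s(1) Hc by (simp add: m_assoc)
    then have "inv b \<otimes> (r \<otimes> s) \<in> H" using Hm rU(3) s(1) by simp
    moreover have "sz (r \<otimes> s) + 8 * E (r \<otimes> s) \<le> B" using s(3,4) rU(2) by linarith
    ultimately have "r \<otimes> s \<in> ?Z" using s(2) by simp
    then have "E r \<le> 1/2 * E r" using r(2) s(3) by force
    then have "E r = 0" using E0[of r] by linarith
    then have "\<kappa> (\<gamma> r) k = \<kappa> r k" if "k < n" for k
      using cmod_le_csize[OF that, of "\<lambda>k. \<kappa> (\<gamma> r) k - \<kappa> r k"] E_gal[OF rU(1)] by simp
    then have "\<gamma> r = r" using kappa_inj[OF gal_in[OF rU(1)] rU(1)] by blast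
    moreover have "sz r < D" using r_small d by linarith
    ultimately show ?thesis using rU rc by (intro bexI[of _ r]) (auto simp: R_iff)
  qed
  moreover have "d / 300 > 0" using d(1) by simp
  ultimately show ?thesis unfolding near1_chart by blast
qed

end

section \<open>Homomorphisms\<close>

locale alg_hom = G: alg_group G + H: alg_group H
  for G :: "'a ralg_group" and H :: "'b ralg_group" +
  fixes f :: "'a \<Rightarrow> 'b"
  assumes hom: "f \<in> real_alg_hom G H"
begin

lemma real_map: "real_map (var G) (var H) f"
  using hom by (simp add: real_alg_hom_def)

sublocale group_hom G H f
  using hom by unfold_locales (simp add: real_alg_hom_def)

lemma continuous: "continuous_map G.T H.T f"
  by (rule real_map_strong_continuous[OF real_map topspace_strong[OF H.variety]])

lemma gal: "x \<in> carrier G \<Longrightarrow> f (G.\<gamma> x) = H.\<gamma> (f x)"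
  using real_map G.topspace_zariski unfolding real_map_def by simp

lemma real: "x \<in> G.R \<Longrightarrow> f x \<in> H.R"
  using gal[of x] by (simp add: G.R_iff H.R_iff)

lemma identity_component: "x \<in> G.I \<Longrightarrow> f x \<in> H.I"
proof -
  assume x: "x \<in> G.I"
  have "f ` G.I \<subseteq> H.I"
  proof (rule H.connected_in_I)
    have "continuous_map (subtopology G.T G.R) (subtopology H.T H.R) f"
      using continuous real G.topspace_TR
      by (auto simp: continuous_map_in_subtopology continuous_map_from_subtopology)
    then show "connectedin (subtopology H.T H.R) (f ` G.I)"
      using G.I_connected by (rule connectedin_continuous_map_image)
    show "\<one>\<^bsub>H\<^esub> \<in> f ` G.I" using G.one_in_I hom_one by (metis imageI)
  qed
  then show ?thesis using x by blast
qed

abbreviation ker :: "'a set" where "ker \<equiv> kernel G H f"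

lemma ker_iff: "x \<in> ker \<longleftrightarrow> x \<in> carrier G \<and> f x = \<one>\<^bsub>H\<^esub>"
  by (simp add: kernel_def)

lemma ker_closed: "closedin G.T ker"
proof -
  have "closedin H.T {\<one>\<^bsub>H\<^esub>}"
    using Hausdorff_strong[OF H.variety] H.topspace_T by (simp add: closedin_Hausdorff_singleton)
  from closedin_continuous_map_preimage[OF continuous this]
  show ?thesis by (simp add: kernel_def G.topspace_T)
qed

lemma ker_gal: "x \<in> ker \<Longrightarrow> G.\<gamma> x \<in> ker"
  using gal G.gal_closed H.gal_one by (auto simp: ker_iff)

text \<open>
  The equations are the coordinates of \<open>f x\<close> around the identity of \<open>H\<close>, with
  denominators cleared.
\<close>

lemma ker_locally_algebraic:
  assumes "group_chart G U n V \<phi> \<psi>"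
  shows "group_chart.locally_algebraic G U n \<phi> ker"
proof -
  interpret group_chart G U n V \<phi> \<psi> by (rule assms)
  obtain U' m V' \<phi>' \<psi>' where c: "chart (var H) U' m V' \<phi>' \<psi>'" and one': "\<one>\<^bsub>H\<^esub> \<in> U'"
    using real_variety_chart[OF H.variety, of "\<one>\<^bsub>H\<^esub>"] H.topspace_zariski
    by auto
  interpret C: chart "var H" U' m V' \<phi>' \<psi>' by (rule c)
  define D where "D = {x \<in> topspace (zariski (var G)). f x \<in> U'}"
  have D_open: "openin (zariski (var G)) D"
    unfolding D_def by (rule openin_continuous_map_preimage[OF _ C.U_open]) (use real_map in \<open>simp add: real_map_def\<close>)
  have one_D: "\<one>\<^bsub>G\<^esub> \<in> D" using one' by (simp add: D_def G.topspace_zariski)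
  have "\<forall>V h. openin (zariski (var H)) V \<and> h \<in> reg (var H) V \<longrightarrow>
        (\<lambda>x. h (f x)) \<in> reg (var G) {x \<in> topspace (zariski (var G)). f x \<in> V}"
    using real_map unfolding real_map_def by (elim conjE)
  then have reg: "(\<lambda>x. \<phi>' (f x) l) \<in> reg (var G) D" for l
    unfolding D_def using C.U_open C.coord_reg[of l] by (elim allE impE) (rule conjI)
  have "\<forall>l. \<exists>p q. p \<in> poly_funs UNIV n \<and> q \<in> poly_funs UNIV n \<and>
      eventually (\<lambda>x. x \<in> D \<and> q (\<kappa> x) \<noteq> 0 \<and> \<phi>' (f x) l = p (\<kappa> x) / q (\<kappa> x)) G.near1"
  proof
    fix l
    from regular_near_one[OF D_open reg[of l] one_D] obtain p q where "p \<in> poly_funs UNIV n" "q \<in> poly_funs UNIV n"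
      "eventually (\<lambda>x. x \<in> D \<and> q (\<kappa> x) \<noteq> 0 \<and> \<phi>' (f x) l = p (\<kappa> x) / q (\<kappa> x)) G.near1"
      by (elim bexE conjE) (rule that; assumption)
    then show "\<exists>p q. p \<in> poly_funs UNIV n \<and> q \<in> poly_funs UNIV n \<and>
      eventually (\<lambda>x. x \<in> D \<and> q (\<kappa> x) \<noteq> 0 \<and> \<phi>' (f x) l = p (\<kappa> x) / q (\<kappa> x)) G.near1"
      by (intro exI conjI)
  qed
  from choice[OF this] obtain p where p': "\<forall>l. \<exists>q. p l \<in> poly_funs UNIV n \<and> q \<in> poly_funs UNIV n \<and>
      eventually (\<lambda>x. x \<in> D \<and> q (\<kappa> x) \<noteq> 0 \<and> \<phi>' (f x) l = p l (\<kappa> x) / q (\<kappa> x)) G.near1"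
    by (rule exE)
  from choice[OF p'] obtain q where pq: "\<forall>l. p l \<in> poly_funs UNIV n \<and> q l \<in> poly_funs UNIV n \<and>
      eventually (\<lambda>x. x \<in> D \<and> q l (\<kappa> x) \<noteq> 0 \<and> \<phi>' (f x) l = p l (\<kappa> x) / q l (\<kappa> x)) G.near1"
    by (rule exE)
  \<comment> \<open>zero exactly where \<open>p l / q l\<close> equals the coordinate of the identity of \<open>H\<close>\<close>
  define s where "s = (\<lambda>l u. p l u + (- \<phi>' \<one>\<^bsub>H\<^esub> l) * q l u)"
  have s_poly: "s l \<in> poly_funs UNIV n" for l
    unfolding s_def using pq by (intro poly_funs.add poly_funs.mult poly_funs.const) auto
  have "eventually (\<lambda>x. \<forall>l\<in>{..m}. x \<in> D \<and> q l (\<kappa> x) \<noteq> 0 \<and> \<phi>' (f x) l = p l (\<kappa> x) / q l (\<kappa> x)) G.near1"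
    using pq by (intro eventually_ball_finite) auto
  then obtain d where d: "d > 0" "\<And>x. x \<in> U \<Longrightarrow> sz x < d \<Longrightarrow>
      \<forall>l\<in>{..m}. x \<in> D \<and> q l (\<kappa> x) \<noteq> 0 \<and> \<phi>' (f x) l = p l (\<kappa> x) / q l (\<kappa> x)"
    by (rule near1_chartE) (rule that)
  have "x \<in> ker \<longleftrightarrow> (\<forall>r\<in>s ` {..m}. r (\<kappa> x) = 0)" if x: "x \<in> U" "sz x < d" for x
  proof -
    have xc: "x \<in> carrier G" using x U_carrier by blast
    have *: "f x \<in> U'" "\<And>l. l \<le> m \<Longrightarrow> q l (\<kappa> x) \<noteq> 0 \<and> \<phi>' (f x) l = p l (\<kappa> x) / q l (\<kappa> x)"
      using d(2)[OF x] by (auto simp: D_def)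
    have s_iff: "s l (\<kappa> x) = 0 \<longleftrightarrow> \<phi>' (f x) l = \<phi>' \<one>\<^bsub>H\<^esub> l" if "l \<le> m" for l
      using *(2)[OF that] by (simp add: s_def field_simps)
    have "f x = \<one>\<^bsub>H\<^esub> \<longleftrightarrow> (\<forall>l\<le>m. \<phi>' (f x) l = \<phi>' \<one>\<^bsub>H\<^esub> l)"
    proof
      assume eq: "\<forall>l\<le>m. \<phi>' (f x) l = \<phi>' \<one>\<^bsub>H\<^esub> l"
      have "\<phi>' (f x) l = \<phi>' \<one>\<^bsub>H\<^esub> l" for l
        using eq C.V_support[OF C.phi_in[OF *(1)], of l] C.V_support[OF C.phi_in[OF one'], of l]
        by (cases "l \<le> m") auto
      then have "\<phi>' (f x) = \<phi>' \<one>\<^bsub>H\<^esub>" by (rule ext)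
      then have "\<psi>' (\<phi>' (f x)) = \<psi>' (\<phi>' \<one>\<^bsub>H\<^esub>)" by (rule arg_cong)
      then show "f x = \<one>\<^bsub>H\<^esub>" unfolding C.psi_phi[OF *(1)] C.psi_phi[OF one'] .
    qed simp
    then show ?thesis using s_iff xc by (auto simp: ker_iff)
  qed
  moreover have "s ` {..m} \<subseteq> poly_funs UNIV n" using s_poly by blast
  ultimately show ?thesis
    unfolding locally_algebraic_def using d(1) by (intro exI[of _ "s ` {..m}"] conjI exI[of _ d]) auto
qed

end

section \<open>Surjective homomorphisms\<close>

lemma (in alg_group) small_compact_neighbourhood:
  assumes "openin T N" "\<one> \<in> N"
  shows "\<exists>O' K. openin T O' \<and> \<one> \<in> O' \<and> O' \<subseteq> K \<and> compactin T K \<and> (\<forall>x\<in>K. \<forall>y\<in>K. inv x \<otimes> y \<in> N)"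
proof -
  from near1_inv_mult[OF near1_open[OF assms], unfolded eventually_prod_filter]
  obtain P Q where PQ: "eventually P near1" "eventually Q near1"
    "\<forall>x y. P x \<longrightarrow> Q y \<longrightarrow> inv (fst (x, y)) \<otimes> snd (x, y) \<in> N"
    by (elim exE conjE) (rule that; assumption)
  have "eventually (\<lambda>x. P x \<and> Q x) near1" by (intro eventually_conj PQ(1,2))
  then obtain W where W: "openin T W" "\<one> \<in> W" "\<forall>x\<in>W. P x \<and> Q x" unfolding near1 by blast
  have "locally_compact_space T" "regular_space T"
    using locally_compact_strong[OF variety] Hausdorff_strong[OF variety] locally_compact_Hausdorff_imp_regular_space by blast+
  then have "neighbourhood_base_of (\<lambda>C. compactin T C \<and> closedin T C) T"
    using locally_compact_regular_space_neighbourhood_base by blast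
  from this[unfolded neighbourhood_base_of, rule_format, OF conjI, OF W(1,2)]
  obtain O' K where "openin T O'" "compactin T K" "\<one> \<in> O'" "O' \<subseteq> K" "K \<subseteq> W"
    by (elim exE conjE) (rule that; assumption)
  moreover have "\<forall>x\<in>K. \<forall>y\<in>K. inv x \<otimes> y \<in> N" using PQ(3) W(3) \<open>K \<subseteq> W\<close> by auto
  ultimately show ?thesis by (intro exI[of _ O'] exI[of _ K] conjI)
qed

lemma (in alg_group) countable_translates:
  assumes "openin T W" "\<one> \<in> W"
  shows "\<exists>Q. countable Q \<and> Q \<subseteq> carrier G \<and> (\<forall>x\<in>carrier G. \<exists>q\<in>Q. inv q \<otimes> x \<in> W)"
proof -
  have nbh: "openin T {x \<in> topspace T. inv q \<otimes> x \<in> W} \<and> q \<in> {x \<in> topspace T. inv q \<otimes> x \<in> W}"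
    if "q \<in> topspace (zariski (var G))" for q
    using that assms openin_continuous_map_preimage[OF continuous_left[of "inv q"] assms(1)]
    by (simp add: topspace_T topspace_zariski)
  have "\<exists>Q. countable Q \<and> Q \<subseteq> topspace (zariski (var G)) \<and>
      topspace (zariski (var G)) \<subseteq> (\<Union>q\<in>Q. {x \<in> topspace T. inv q \<otimes> x \<in> W})"
    by (rule strong_countable_subcover[OF variety]) (rule nbh)
  from this[unfolded topspace_zariski] obtain Q where Q: "countable Q" "Q \<subseteq> carrier G"
    "carrier G \<subseteq> (\<Union>q\<in>Q. {x \<in> topspace T. inv q \<otimes> x \<in> W})"
    by (elim exE conjE) (rule that; assumption)
  have "\<exists>q\<in>Q. inv q \<otimes> x \<in> W" if "x \<in> carrier G" for x
    using Q(3) that by auto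
  then show ?thesis using Q(1,2) by (intro exI[of _ Q]) simp
qed

locale alg_epi = alg_hom G H f
  for G :: "'a ralg_group" and H :: "'b ralg_group" and f :: "'a \<Rightarrow> 'b" +
  assumes surj: "f ` carrier G = carrier H"
begin

text \<open>
  The open mapping theorem for locally compact groups. Choose a compact neighbourhood \<open>K\<close> of
  \<open>1\<close> with \<open>K\<^sup>-\<^sup>1 K \<subseteq> N\<close>. Countably many translates of
  \<open>K\<close> cover the source, so by Baire's theorem some translate of the closed set \<open>f(K)\<close>
  has an interior point; dividing by it gives a neighbourhood of \<open>1\<close> inside
  \<open>f(K\<^sup>-\<^sup>1 K)\<close>.
\<close>

lemma open_at_one:
  assumes "openin G.T N" "\<one>\<^bsub>G\<^esub> \<in> N"
  shows "\<exists>W. openin H.T W \<and> \<one>\<^bsub>H\<^esub> \<in> W \<and> W \<subseteq> f ` N"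
proof -
  obtain O' K where O': "openin G.T O'" "\<one>\<^bsub>G\<^esub> \<in> O'" "O' \<subseteq> K" and K: "compactin G.T K"
    and KN: "\<forall>x\<in>K. \<forall>y\<in>K. inv\<^bsub>G\<^esub> x \<otimes>\<^bsub>G\<^esub> y \<in> N"
    using G.small_compact_neighbourhood[OF assms] by (elim exE conjE) (rule that; assumption)
  have Kc: "x \<in> carrier G" if "x \<in> K" for x
    using compactin_subset_topspace[OF K] that G.topspace_T by auto
  obtain Q where Q: "countable Q" "Q \<subseteq> carrier G" "\<forall>x\<in>carrier G. \<exists>q\<in>Q. inv\<^bsub>G\<^esub> q \<otimes>\<^bsub>G\<^esub> x \<in> O'"
    using G.countable_translates[OF O'(1,2)] by (elim exE conjE) (rule that; assumption)
  define F where "F = (\<lambda>q. {y \<in> topspace H.T. inv\<^bsub>H\<^esub> (f q) \<otimes>\<^bsub>H\<^esub> y \<in> f ` K})"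
  have "compactin H.T (f ` K)" by (rule image_compactin[OF K continuous])
  then have "closedin H.T (f ` K)"
    using Hausdorff_strong[OF H.variety] compactin_imp_closedin by blast
  then have F_closed: "closedin H.T (F q)" if "q \<in> Q" for q
    unfolding F_def using that Q(2) by (intro closedin_continuous_map_preimage[OF H.continuous_left]) auto
  have cover: "\<Union>(F ` Q) = topspace H.T"
  proof
    show "topspace H.T \<subseteq> \<Union>(F ` Q)"
    proof
      fix y assume y: "y \<in> topspace H.T"
      then obtain x where x: "x \<in> carrier G" "y = f x" using surj H.topspace_T by blast
      then obtain q where q: "q \<in> Q" "inv\<^bsub>G\<^esub> q \<otimes>\<^bsub>G\<^esub> x \<in> O'" using Q(3) by blast
      then have "f (inv\<^bsub>G\<^esub> q \<otimes>\<^bsub>G\<^esub> x) \<in> f ` K" using O'(3) by blast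
      then have "y \<in> F q" using q(1) Q(2) x y by (auto simp: F_def hom_inv subset_iff)
      then show "y \<in> \<Union>(F ` Q)" using q(1) by blast
    qed
  qed (auto simp: F_def)
  have "\<exists>q\<in>Q. H.T interior_of F q \<noteq> {}"
  proof (rule ccontr)
    assume "\<not> (\<exists>q\<in>Q. H.T interior_of F q \<noteq> {})"
    then have "H.T interior_of \<Union>(F ` Q) = {}"
      using locally_compact_strong[OF H.variety] Hausdorff_strong[OF H.variety]
        locally_compact_Hausdorff_imp_regular_space F_closed Q(1)
      by (intro Baire_category_alt) auto
    then have "topspace H.T = {}" unfolding cover by simp
    then show False using H.topspace_T by auto
  qed
  then obtain q y where q: "q \<in> Q" "y \<in> H.T interior_of F q" by blast
  then obtain O'' where O'': "openin H.T O''" "y \<in> O''" "O'' \<subseteq> F q"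
    unfolding interior_of_def by blast
  have qc: "q \<in> carrier G" using q(1) Q(2) by blast
  have yF: "y \<in> F q" using O'' by blast
  then obtain k where k: "k \<in> K" "inv\<^bsub>H\<^esub> (f q) \<otimes>\<^bsub>H\<^esub> y = f k" unfolding F_def by blast
  have yc: "y \<in> carrier H" using yF by (simp add: F_def H.topspace_T)
  define W where "W = {z \<in> topspace H.T. y \<otimes>\<^bsub>H\<^esub> z \<in> O''}"
  have "openin H.T W"
    unfolding W_def by (rule openin_continuous_map_preimage[OF H.continuous_left[OF yc] O''(1)])
  moreover have "\<one>\<^bsub>H\<^esub> \<in> W" using O''(2) yc by (simp add: W_def H.topspace_T)
  moreover have "z \<in> f ` N" if z: "z \<in> W" for z
  proof -
    have zc: "z \<in> carrier H" using z by (simp add: W_def H.topspace_T)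
    have "y \<otimes>\<^bsub>H\<^esub> z \<in> F q" using z O''(3) unfolding W_def by blast
    then obtain k' where k': "k' \<in> K" "inv\<^bsub>H\<^esub> (f q) \<otimes>\<^bsub>H\<^esub> (y \<otimes>\<^bsub>H\<^esub> z) = f k'" unfolding F_def by blast
    have "f k \<otimes>\<^bsub>H\<^esub> z = f k'"
      using k(2) k'(2) qc yc zc by (simp add: H.m_assoc[symmetric])
    then have "z = inv\<^bsub>H\<^esub> (f k) \<otimes>\<^bsub>H\<^esub> f k'"
      using Kc[OF k(1)] Kc[OF k'(1)] zc by (metis H.inv_solve_left hom_closed)
    also have "\<dots> = f (inv\<^bsub>G\<^esub> k \<otimes>\<^bsub>G\<^esub> k')" using Kc[OF k(1)] Kc[OF k'(1)] by simp
    finally show ?thesis using KN k(1) k'(1) by blast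
  qed
  ultimately show ?thesis by blast
qed

text \<open>
  A complex lift of \<open>c\<close> near \<open>1\<close> is first made real within its coset of the kernel,
  while it stays so close to \<open>1\<close> that it is in the identity component afterwards.
\<close>

lemma real_near_one_lift:
  "\<exists>W. openin H.T W \<and> \<one>\<^bsub>H\<^esub> \<in> W \<and> (\<forall>c\<in>W \<inter> H.R. \<exists>r\<in>G.I. f r = c)"
proof -
  obtain U n V \<phi> \<psi> where c: "chart (var G) U n V \<phi> \<psi>" "\<one>\<^bsub>G\<^esub> \<in> U"
    using real_variety_chart[OF G.variety, of "\<one>\<^bsub>G\<^esub>"] G.topspace_zariski by auto
  have gc: "group_chart G U n V \<phi> \<psi>"
    using c G.alg_group_axioms by (simp add: group_chart_def group_chart_axioms_def)
  interpret ch: group_chart G U n V \<phi> \<psi> by (rule gc)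
  obtain D where D: "D > 0" "\<And>b. b \<in> U \<Longrightarrow> ch.sz b < D \<Longrightarrow> b \<in> G.R \<longrightarrow> b \<in> G.I"
    using ch.real_near_one_in_I by (rule ch.near1_chartE) (rule that)
  have "eventually (\<lambda>b. inv\<^bsub>G\<^esub> b \<otimes>\<^bsub>G\<^esub> G.\<gamma> b \<in> ker \<longrightarrow>
      (\<exists>r\<in>G.R. r \<in> U \<and> ch.sz r < D \<and> inv\<^bsub>G\<^esub> b \<otimes>\<^bsub>G\<^esub> r \<in> ker)) G.near1"
    by (rule ch.real_lift_near_one[OF subgroup_kernel ker_gal ker_locally_algebraic[OF gc] ker_closed D(1)])
  then obtain N where N: "openin G.T N" "\<one>\<^bsub>G\<^esub> \<in> N" "\<forall>b\<in>N. inv\<^bsub>G\<^esub> b \<otimes>\<^bsub>G\<^esub> G.\<gamma> b \<in> ker \<longrightarrow>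
      (\<exists>r\<in>G.R. r \<in> U \<and> ch.sz r < D \<and> inv\<^bsub>G\<^esub> b \<otimes>\<^bsub>G\<^esub> r \<in> ker)"
    unfolding G.near1 by (elim exE conjE) (rule that; assumption)
  obtain W where W: "openin H.T W" "\<one>\<^bsub>H\<^esub> \<in> W" "W \<subseteq> f ` N"
    using open_at_one[OF N(1,2)] by (elim exE conjE) (rule that; assumption)
  have "\<exists>r\<in>G.I. f r = c" if cW: "c \<in> W \<inter> H.R" for c
  proof -
    obtain b where b: "b \<in> N" "c = f b" using cW W(3) by blast
    have bc: "b \<in> carrier G" using openin_subset[OF N(1)] b(1) G.topspace_T by blast
    have "H.\<gamma> (f b) = f b" using cW b(2) by (simp add: H.R_iff)
    then have "inv\<^bsub>G\<^esub> b \<otimes>\<^bsub>G\<^esub> G.\<gamma> b \<in> ker"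
      using bc G.gal_closed by (simp add: ker_iff gal)
    then obtain r where r: "r \<in> G.R" "r \<in> U" "ch.sz r < D" "inv\<^bsub>G\<^esub> b \<otimes>\<^bsub>G\<^esub> r \<in> ker"
      using N(3) b(1) by blast
    have rc: "r \<in> carrier G" using r(1) G.R_carrier by blast
    have "inv\<^bsub>H\<^esub> (f b) \<otimes>\<^bsub>H\<^esub> f r = \<one>\<^bsub>H\<^esub>" using r(4) bc rc by (simp add: ker_iff)
    then have "f b \<otimes>\<^bsub>H\<^esub> (inv\<^bsub>H\<^esub> (f b) \<otimes>\<^bsub>H\<^esub> f r) = f b" using bc by simp
    then have "f r = f b" using bc rc by (simp add: H.m_assoc[symmetric])
    moreover have "r \<in> G.I" using D(2)[OF r(2,3)] r(1) by blast
    ultimately show ?thesis using b(2) by blast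
  qed
  then show ?thesis using W(1,2) by blast
qed

text \<open>
  The image \<open>J\<close> of the identity component is a subgroup of the real points and contains a
  neighbourhood of \<open>1\<close> there. By translation each real point has a neighbourhood inside or outside
  \<open>J\<close>, so \<open>J\<close> is clopen and contains the identity component.
\<close>

lemma identity_component_lift:
  assumes "c \<in> H.I"
  shows "\<exists>r\<in>G.I. f r = c"
proof -
  obtain W where W: "openin H.T W" "\<one>\<^bsub>H\<^esub> \<in> W" "\<forall>c\<in>W \<inter> H.R. \<exists>r\<in>G.I. f r = c"
    using real_near_one_lift by (elim exE conjE) (rule that; assumption)
  define J where "J = f ` G.I"
  have JR: "J \<subseteq> H.R" unfolding J_def using G.I_real real by blast
  have J_mult: "x \<otimes>\<^bsub>H\<^esub> y \<in> J" if xy: "x \<in> J" "y \<in> J" for x y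
  proof -
    obtain a b where ab: "a \<in> G.I" "b \<in> G.I" "x = f a" "y = f b" using xy unfolding J_def by blast
    have "x \<otimes>\<^bsub>H\<^esub> y = f (a \<otimes>\<^bsub>G\<^esub> b)" using ab G.I_carrier by simp
    then show ?thesis unfolding J_def using G.I_mult[OF ab(1,2)] by blast
  qed
  have J_inv: "inv\<^bsub>H\<^esub> x \<in> J" if x: "x \<in> J" for x
  proof -
    obtain a where a: "a \<in> G.I" "x = f a" using x unfolding J_def by blast
    have "inv\<^bsub>H\<^esub> x = f (inv\<^bsub>G\<^esub> a)" using a G.I_carrier by simp
    then show ?thesis unfolding J_def using G.I_inv[OF a(1)] by blast
  qed
  define N where "N = (\<lambda>x. {y \<in> topspace (subtopology H.T H.R). inv\<^bsub>H\<^esub> x \<otimes>\<^bsub>H\<^esub> y \<in> W})"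
  have N_open: "openin (subtopology H.T H.R) (N x)" and N_self: "x \<in> N x" if x: "x \<in> H.R" for x
  proof -
    have xc: "x \<in> carrier H" using x H.R_carrier by blast
    show "openin (subtopology H.T H.R) (N x)"
      unfolding N_def
      by (rule openin_continuous_map_preimage[OF continuous_map_from_subtopology[OF H.continuous_left] W(1)]) (simp add: xc)
    show "x \<in> N x" using x xc W(2) unfolding N_def H.topspace_TR by simp
  qed
  have N_J: "y \<in> J \<longleftrightarrow> x \<in> J" if x: "x \<in> H.R" and y: "y \<in> N x" for x y
  proof -
    have yR: "y \<in> H.R" using y unfolding N_def H.topspace_TR by blast
    have c: "x \<in> carrier H" "y \<in> carrier H" using x yR H.R_carrier by auto
    have "inv\<^bsub>H\<^esub> x \<otimes>\<^bsub>H\<^esub> y \<in> W \<inter> H.R" using y x yR H.R_mult H.R_inv unfolding N_def by blast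
    then obtain r where r: "r \<in> G.I" "f r = inv\<^bsub>H\<^esub> x \<otimes>\<^bsub>H\<^esub> y" using W(3) by blast
    have u: "inv\<^bsub>H\<^esub> x \<otimes>\<^bsub>H\<^esub> y \<in> J" unfolding J_def r(2)[symmetric] using r(1) by (rule imageI)
    have 1: "x \<otimes>\<^bsub>H\<^esub> (inv\<^bsub>H\<^esub> x \<otimes>\<^bsub>H\<^esub> y) = y" using c by (simp add: H.m_assoc[symmetric])
    have 2: "y \<otimes>\<^bsub>H\<^esub> inv\<^bsub>H\<^esub> (inv\<^bsub>H\<^esub> x \<otimes>\<^bsub>H\<^esub> y) = x" using c by (simp add: H.inv_mult_group H.m_assoc[symmetric])
    show ?thesis using J_mult[OF _ u, of x] J_mult[OF _ J_inv[OF u], of y] 1 2 by auto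
  qed
  have "openin (subtopology H.T H.R) J"
  proof (subst openin_subopen, intro ballI)
    fix x assume x: "x \<in> J"
    then have xR: "x \<in> H.R" using JR by blast
    have "N x \<subseteq> J" using N_J[OF xR] x by (intro subsetI) simp
    then show "\<exists>T. openin (subtopology H.T H.R) T \<and> x \<in> T \<and> T \<subseteq> J"
      using N_open[OF xR] N_self[OF xR] by (intro exI[of _ "N x"] conjI)
  qed
  moreover have "openin (subtopology H.T H.R) (H.R - J)"
  proof (subst openin_subopen, intro ballI)
    fix x assume x: "x \<in> H.R - J"
    then have xR: "x \<in> H.R" by simp
    have "N x \<subseteq> H.R" unfolding N_def H.topspace_TR by (rule Collect_restrict)
    then have "N x \<subseteq> H.R - J" using N_J[OF xR] x by (intro subsetI DiffI) (auto dest: subsetD)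
    then show "\<exists>T. openin (subtopology H.T H.R) T \<and> x \<in> T \<and> T \<subseteq> H.R - J"
      using N_open[OF xR] N_self[OF xR] by (intro exI[of _ "N x"] conjI)
  qed
  then have "closedin (subtopology H.T H.R) J"
    unfolding closedin_def H.topspace_TR using JR by blast
  ultimately have "H.I \<subseteq> J \<or> disjnt H.I J"
    using connectedin_clopen_cases[OF H.I_connected] by blast
  moreover have "\<one>\<^bsub>H\<^esub> \<in> J" unfolding J_def using G.one_in_I hom_one by (metis imageI)
  ultimately have "H.I \<subseteq> J" using H.one_in_I by (auto simp: disjnt_iff)
  then show ?thesis using assms unfolding J_def by blast
qed

end

section \<open>Component groups and cohomology\<close>

context alg_group
begin

lemma pi0_class_eq: "pi0_class G x = {h \<otimes> x | h. h \<in> I}"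
  by (auto simp: pi0_class_def r_coset_def)

lemma pi0_carrier: "carrier (pi0 G) = pi0_class G ` R"
  by (auto simp: pi0_def FactGroup_def RCOSETS_def pi0_class_def)

lemma pi0_one: "\<one>\<^bsub>pi0 G\<^esub> = I"
  by (simp add: pi0_def FactGroup_def)

lemma pi0_class_self: "x \<in> R \<Longrightarrow> x \<in> pi0_class G x"
  unfolding pi0_class_eq using one_in_I R_carrier by force

lemma pi0_class_cong:
  assumes "h \<in> I" "x \<in> R"
  shows "pi0_class G (h \<otimes> x) = pi0_class G x"
proof (intro equalityI subsetI)
  fix y assume "y \<in> pi0_class G (h \<otimes> x)"
  then obtain h' where h': "h' \<in> I" "y = h' \<otimes> (h \<otimes> x)" unfolding pi0_class_eq by blast
  then have "y = (h' \<otimes> h) \<otimes> x" using assms I_carrier R_carrier by (simp add: m_assoc)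
  then show "y \<in> pi0_class G x" unfolding pi0_class_eq using I_mult[OF h'(1) assms(1)] by blast
next
  fix y assume "y \<in> pi0_class G x"
  then obtain h' where h': "h' \<in> I" "y = h' \<otimes> x" unfolding pi0_class_eq by blast
  have "y = (h' \<otimes> inv h) \<otimes> (h \<otimes> x)"
    using h' assms I_carrier R_carrier by (simp add: m_assoc) (simp add: m_assoc[symmetric])
  then show "y \<in> pi0_class G (h \<otimes> x)"
    unfolding pi0_class_eq using I_mult[OF h'(1) I_inv[OF assms(1)]] by blast
qed

lemma pi0_class_one: "pi0_class G x = I \<longleftrightarrow> x \<in> I" if "x \<in> R"
proof
  assume "x \<in> I"
  then have "pi0_class G x = pi0_class G \<one>" using pi0_class_cong[OF _ R_one, of x] I_carrier by simp
  also have "\<dots> = I"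
  proof (intro equalityI subsetI)
    fix y assume "y \<in> pi0_class G \<one>"
    then show "y \<in> I" unfolding pi0_class_eq using I_carrier by auto
  next
    fix y assume y: "y \<in> I"
    then have "y = y \<otimes> \<one>" using I_carrier by simp
    then show "y \<in> pi0_class G \<one>" unfolding pi0_class_eq using y by blast
  qed
  finally show "pi0_class G x = I" .
qed (use pi0_class_self[OF that] in simp)

lemma pi0_one_class: "\<one>\<^bsub>pi0 G\<^esub> = pi0_class G \<one>"
  using pi0_class_one[OF R_one] one_in_I pi0_one by simp

text \<open>
  Induced maps are unions over all representatives; this evaluates them once independence of the representative
  is known.
\<close>

lemma UN_pi0_class:
  assumes x: "x \<in> R" and const: "\<And>h. h \<in> I \<Longrightarrow> F (h \<otimes> x) = F x"
  shows "(\<Union>y\<in>pi0_class G x. F y) = F x"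
proof -
  have "F y = F x" if "y \<in> pi0_class G x" for y using that const unfolding pi0_class_eq by auto
  then show ?thesis using pi0_class_self[OF x] by blast
qed

lemma cocycles_iff: "g \<in> cocycles G \<longleftrightarrow> g \<in> carrier G \<and> g \<otimes> \<gamma> g = \<one>"
  by (simp add: cocycles_def)

lemma one_cocycle: "\<one> \<in> cocycles G"
  by (simp add: cocycles_iff gal_one)

lemma cocycle_carrier: "g \<in> cocycles G \<Longrightarrow> g \<in> carrier G"
  by (simp add: cocycles_iff)

lemma twist_cocycle:
  assumes "g \<in> cocycles G" "x \<in> carrier G"
  shows "x \<otimes> g \<otimes> inv (\<gamma> x) \<in> cocycles G"
proof -
  have c: "g \<in> carrier G" "\<gamma> g \<in> carrier G" "\<gamma> x \<in> carrier G" "x \<in> carrier G" "g \<otimes> \<gamma> g = \<one>"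
    using assms gal_closed by (auto simp: cocycles_iff)
  have "x \<otimes> g \<otimes> inv (\<gamma> x) \<otimes> \<gamma> (x \<otimes> g \<otimes> inv (\<gamma> x)) = x \<otimes> g \<otimes> inv (\<gamma> x) \<otimes> (\<gamma> x \<otimes> \<gamma> g \<otimes> inv x)"
    using c by (simp add: gal_mult gal_inv gal_gal)
  also have "\<dots> = x \<otimes> (g \<otimes> (inv (\<gamma> x) \<otimes> \<gamma> x) \<otimes> \<gamma> g) \<otimes> inv x"
    using c by (simp only: m_assoc m_closed inv_closed)
  also have "\<dots> = \<one>" using c by simp
  finally show ?thesis using c by (simp add: cocycles_iff)
qed

lemma cohomologousI:
  assumes "g \<in> cocycles G" "x \<in> carrier G"
  shows "(g, x \<otimes> g \<otimes> inv (\<gamma> x)) \<in> cohomologous G"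
  unfolding cohomologous_def using assms twist_cocycle[OF assms] by blast

lemma cohomologousE:
  assumes "(g, h) \<in> cohomologous G"
  obtains x where "x \<in> carrier G" "h = x \<otimes> g \<otimes> inv (\<gamma> x)" "g \<in> cocycles G" "h \<in> cocycles G"
  using assms unfolding cohomologous_def by blast

lemma coboundary: "x \<in> carrier G \<Longrightarrow> (\<one>, inv x \<otimes> \<gamma> x) \<in> cohomologous G"
  using cohomologousI[OF one_cocycle, of "inv x"] gal_closed[of x] by (simp add: gal_inv)

lemma equiv_cohomologous: "equiv (cocycles G) (cohomologous G)"
proof (rule equivI)
  show "cohomologous G \<subseteq> cocycles G \<times> cocycles G" by (auto simp: cohomologous_def)
  show "refl_on (cocycles G) (cohomologous G)"
  proof (rule refl_onI)
    fix g assume g: "g \<in> cocycles G"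
    then show "(g, g) \<in> cohomologous G"
      using cohomologousI[OF g one_closed] cocycle_carrier[OF g] by (simp add: gal_one)
  qed
  show "sym (cohomologous G)"
  proof (rule symI)
    fix g h assume "(g, h) \<in> cohomologous G"
    then obtain x where x: "x \<in> carrier G" "h = x \<otimes> g \<otimes> inv (\<gamma> x)" "g \<in> cocycles G" "h \<in> cocycles G"
      by (rule cohomologousE)
    have c: "g \<in> carrier G" "\<gamma> x \<in> carrier G" using x cocycle_carrier gal_closed by auto
    have "inv x \<otimes> h \<otimes> inv (\<gamma> (inv x)) = (inv x \<otimes> x) \<otimes> g \<otimes> (inv (\<gamma> x) \<otimes> \<gamma> x)"
      using x(1) c unfolding x(2) gal_inv[OF x(1)] by (simp only: m_assoc m_closed inv_closed inv_inv)
    also have "\<dots> = g" using x(1) c by simp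
    finally show "(h, g) \<in> cohomologous G" using cohomologousI[OF x(4), of "inv x"] x(1) by simp
  qed
  show "trans (cohomologous G)"
  proof (rule transI)
    fix g h k assume "(g, h) \<in> cohomologous G" "(h, k) \<in> cohomologous G"
    then obtain x y where x: "x \<in> carrier G" "h = x \<otimes> g \<otimes> inv (\<gamma> x)" "g \<in> cocycles G"
      and y: "y \<in> carrier G" "k = y \<otimes> h \<otimes> inv (\<gamma> y)"
      by (elim cohomologousE) (rule that; assumption)
    have c: "g \<in> carrier G" "\<gamma> x \<in> carrier G" "\<gamma> y \<in> carrier G" using x y cocycle_carrier gal_closed by auto
    have "k = (y \<otimes> x) \<otimes> g \<otimes> inv (\<gamma> (y \<otimes> x))"
      using x(1) y(1) c unfolding y(2) x(2) gal_mult[OF y(1) x(1)]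
      by (simp only: m_assoc m_closed inv_closed inv_mult_group)
    then show "(g, k) \<in> cohomologous G" using cohomologousI[OF x(3), of "y \<otimes> x"] x(1) y(1) by simp
  qed
qed

lemma H1_eq: "H1 G = H1_class G ` cocycles G"
  by (auto simp: H1_def quotient_def H1_class_def)

lemma H1_class_in: "g \<in> cocycles G \<Longrightarrow> H1_class G g \<in> H1 G"
  by (simp add: H1_eq)

lemma H1_class_cong: "(g, h) \<in> cohomologous G \<Longrightarrow> H1_class G g = H1_class G h"
  unfolding H1_class_def by (rule equiv_class_eq[OF equiv_cohomologous])

lemma H1_class_eqD: "H1_class G g = H1_class G h \<Longrightarrow> h \<in> cocycles G \<Longrightarrow> (g, h) \<in> cohomologous G"
  unfolding H1_class_def by (rule eq_equiv_class[OF _ equiv_cohomologous])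

lemma UN_H1_class:
  assumes g: "g \<in> cocycles G" and const: "\<And>h. (g, h) \<in> cohomologous G \<Longrightarrow> F h = F g"
  shows "(\<Union>h\<in>H1_class G g. F h) = F g"
proof -
  have "g \<in> H1_class G g"
    unfolding H1_class_def using g equiv_class_self[OF equiv_cohomologous] by blast
  moreover have "F h = F g" if "h \<in> H1_class G g" for h using that const by (simp add: H1_class_def)
  ultimately show ?thesis by blast
qed

end

context alg_hom
begin

lemma pi0_map_class:
  assumes x: "x \<in> G.R"
  shows "pi0_map H f (pi0_class G x) = pi0_class H (f x)"
  unfolding pi0_map_def
proof (rule G.UN_pi0_class[OF x])
  fix h assume h: "h \<in> G.I"
  have "f (h \<otimes>\<^bsub>G\<^esub> x) = f h \<otimes>\<^bsub>H\<^esub> f x" using G.I_carrier[OF h] G.R_carrier[OF x] by simp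
  then show "pi0_class H (f (h \<otimes>\<^bsub>G\<^esub> x)) = pi0_class H (f x)"
    using H.pi0_class_cong[OF identity_component[OF h] real[OF x]] by simp
qed

lemma pi0_pointed_map: "pi0_map H f \<in> pointed_maps (pi0_pointed G) (pi0_pointed H)"
  using pi0_map_class real G.R_one
  by (auto simp: pointed_maps_def pi0_pointed_def G.pi0_carrier H.pi0_carrier G.pi0_one_class H.pi0_one_class)

lemma cocycle: "g \<in> cocycles G \<Longrightarrow> f g \<in> cocycles H"
proof -
  assume "g \<in> cocycles G"
  then have g: "g \<in> carrier G" "g \<otimes>\<^bsub>G\<^esub> G.\<gamma> g = \<one>\<^bsub>G\<^esub>" by (auto simp: G.cocycles_iff)
  have "f (g \<otimes>\<^bsub>G\<^esub> G.\<gamma> g) = f g \<otimes>\<^bsub>H\<^esub> H.\<gamma> (f g)"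
    using g(1) gal[OF g(1)] G.gal_closed[OF g(1)] by simp
  then show ?thesis using g by (simp add: H.cocycles_iff)
qed

lemma cohomologous:
  assumes "(g, h) \<in> cohomologous G"
  shows "(f g, f h) \<in> cohomologous H"
  using assms
proof (rule G.cohomologousE)
  fix x assume x: "x \<in> carrier G" "h = x \<otimes>\<^bsub>G\<^esub> g \<otimes>\<^bsub>G\<^esub> inv\<^bsub>G\<^esub> G.\<gamma> x" "g \<in> cocycles G"
  have "f h = f x \<otimes>\<^bsub>H\<^esub> f g \<otimes>\<^bsub>H\<^esub> inv\<^bsub>H\<^esub> H.\<gamma> (f x)"
    using x G.gal_closed[OF x(1)] G.cocycle_carrier[OF x(3)] gal[OF x(1)] by simp
  then show ?thesis using H.cohomologousI[OF cocycle[OF x(3)], of "f x"] x(1) by simp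
qed

lemma H1_map_class:
  assumes "g \<in> cocycles G"
  shows "H1_map H f (H1_class G g) = H1_class H (f g)"
  unfolding H1_map_def
  by (rule G.UN_H1_class[OF assms]) (rule H.H1_class_cong[OF cohomologous, symmetric])

lemma H1_pointed_map: "H1_map H f \<in> pointed_maps (H1_pointed G) (H1_pointed H)"
  using H1_map_class cocycle G.one_cocycle hom_one
  by (auto simp: pointed_maps_def H1_pointed_def G.H1_eq H.H1_eq)

end

section \<open>The exact sequence\<close>

locale exact_seq = i: alg_hom A B i + j: alg_epi B C j
  for A :: "'a ralg_group" and B :: "'b ralg_group" and C :: "'c ralg_group"
    and i :: "'a \<Rightarrow> 'b" and j :: "'b \<Rightarrow> 'c" +
  assumes inj: "inj_on i (carrier A)" and exact: "i ` carrier A = kernel B C j"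
begin

abbreviation \<delta> :: "'c \<Rightarrow> 'a set" where "\<delta> \<equiv> connecting_map A i B j"

lemma j_i: "a \<in> carrier A \<Longrightarrow> j (i a) = \<one>\<^bsub>C\<^esub>"
  using exact by (auto simp: kernel_def)

lemma lift_kernel: "b \<in> carrier B \<Longrightarrow> j b = \<one>\<^bsub>C\<^esub> \<Longrightarrow> \<exists>a\<in>carrier A. i a = b"
proof -
  assume "b \<in> carrier B" "j b = \<one>\<^bsub>C\<^esub>"
  then have "b \<in> i ` carrier A" by (simp add: exact kernel_def)
  then show ?thesis by (auto simp: image_iff)
qed

lemma i_inj: "a \<in> carrier A \<Longrightarrow> a' \<in> carrier A \<Longrightarrow> i a = i a' \<Longrightarrow> a = a'"
  using inj by (rule inj_onD)

lemma cocycle_of_image: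
  assumes "a \<in> carrier A" "i a \<in> cocycles B"
  shows "a \<in> cocycles A"
proof -
  have "i (a \<otimes>\<^bsub>A\<^esub> i.G.\<gamma> a) = i \<one>\<^bsub>A\<^esub>"
    using assms i.G.gal_closed by (simp add: i.gal i.H.cocycles_iff)
  then show ?thesis
    using assms(1) i.G.gal_closed i_inj[of "a \<otimes>\<^bsub>A\<^esub> i.G.\<gamma> a" "\<one>\<^bsub>A\<^esub>"] by (simp add: i.G.cocycles_iff)
qed

lemma difference_lift:
  assumes b: "b \<in> carrier B" "j b \<in> j.H.R"
  shows "\<exists>a\<in>cocycles A. i a = inv\<^bsub>B\<^esub> b \<otimes>\<^bsub>B\<^esub> i.H.\<gamma> b"
proof -
  have gb: "i.H.\<gamma> b \<in> carrier B" using b(1) by (rule i.H.gal_closed)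
  have "j (inv\<^bsub>B\<^esub> b \<otimes>\<^bsub>B\<^esub> i.H.\<gamma> b) = \<one>\<^bsub>C\<^esub>"
    using b gb by (simp add: j.gal j.H.R_iff)
  then obtain a where a: "a \<in> carrier A" "i a = inv\<^bsub>B\<^esub> b \<otimes>\<^bsub>B\<^esub> i.H.\<gamma> b"
    using lift_kernel[of "inv\<^bsub>B\<^esub> b \<otimes>\<^bsub>B\<^esub> i.H.\<gamma> b"] b(1) gb by auto
  have "i a \<in> cocycles B"
    using i.H.coboundary[OF b(1)] a(2) by (auto elim: i.H.cohomologousE)
  then show ?thesis using a cocycle_of_image by blast
qed

lemma same_fibre_cohomologous:
  assumes b: "b \<in> carrier B" "b' \<in> carrier B" "j b = j b'"
    and a: "a \<in> cocycles A" "a' \<in> carrier A"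
    "i a = inv\<^bsub>B\<^esub> b \<otimes>\<^bsub>B\<^esub> i.H.\<gamma> b" "i a' = inv\<^bsub>B\<^esub> b' \<otimes>\<^bsub>B\<^esub> i.H.\<gamma> b'"
  shows "(a, a') \<in> cohomologous A"
proof -
  have "j (inv\<^bsub>B\<^esub> b' \<otimes>\<^bsub>B\<^esub> b) = \<one>\<^bsub>C\<^esub>" using b by simp
  then obtain x where x: "x \<in> carrier A" "i x = inv\<^bsub>B\<^esub> b' \<otimes>\<^bsub>B\<^esub> b"
    using lift_kernel[of "inv\<^bsub>B\<^esub> b' \<otimes>\<^bsub>B\<^esub> b"] b by auto
  have gc: "i.H.\<gamma> b \<in> carrier B" "i.H.\<gamma> b' \<in> carrier B" using b i.H.gal_closed by auto
  have ac: "a \<in> carrier A" "i.G.\<gamma> x \<in> carrier A" using a(1) x(1) i.G.cocycle_carrier i.G.gal_closed by auto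
  have "i (x \<otimes>\<^bsub>A\<^esub> a \<otimes>\<^bsub>A\<^esub> inv\<^bsub>A\<^esub> (i.G.\<gamma> x)) = i x \<otimes>\<^bsub>B\<^esub> i a \<otimes>\<^bsub>B\<^esub> inv\<^bsub>B\<^esub> (i.H.\<gamma> (i x))"
    using x(1) ac i.gal[OF x(1)] by simp
  also have "\<dots> = inv\<^bsub>B\<^esub> b' \<otimes>\<^bsub>B\<^esub> (b \<otimes>\<^bsub>B\<^esub> inv\<^bsub>B\<^esub> b) \<otimes>\<^bsub>B\<^esub> (i.H.\<gamma> b \<otimes>\<^bsub>B\<^esub> inv\<^bsub>B\<^esub> (i.H.\<gamma> b)) \<otimes>\<^bsub>B\<^esub> i.H.\<gamma> b'"
    unfolding x(2) a(3) using b gc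
    by (simp only: i.H.gal_mult i.H.gal_inv i.H.inv_mult_group i.H.inv_inv i.H.m_assoc i.H.m_closed i.H.inv_closed)
  also have "\<dots> = i a'" using b gc a(4) by simp
  finally have "x \<otimes>\<^bsub>A\<^esub> a \<otimes>\<^bsub>A\<^esub> inv\<^bsub>A\<^esub> (i.G.\<gamma> x) = a'"
    using x(1) ac a(2) by (intro i_inj) auto
  then show ?thesis using i.G.cohomologousI[OF a(1) x(1)] by simp
qed

lemma connecting_map_eq:
  assumes b: "b \<in> carrier B" "j b \<in> j.H.R" and a: "a \<in> carrier A" "i a = inv\<^bsub>B\<^esub> b \<otimes>\<^bsub>B\<^esub> i.H.\<gamma> b"
  shows "\<delta> (j b) = H1_class A a"
proof -
  obtain a0 where a0: "a0 \<in> cocycles A" "i a0 = inv\<^bsub>B\<^esub> b \<otimes>\<^bsub>B\<^esub> i.H.\<gamma> b"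
    using difference_lift[OF b] by blast
  have "a0 = a" using a a0 i.G.cocycle_carrier by (intro i_inj) auto
  then have ac: "a \<in> cocycles A" using a0 by simp
  have "H1_class A a' = H1_class A a"
    if "a' \<in> carrier A" "b' \<in> carrier B" "j b' = j b" "i a' = inv\<^bsub>B\<^esub> b' \<otimes>\<^bsub>B\<^esub> i.H.\<gamma> b'" for a' b'
    using i.G.H1_class_cong[OF same_fibre_cohomologous[OF b(1) that(2) _ ac that(1) a(2) that(4)]] that(3) by simp
  then have "{H1_class A a' | a' b'. a' \<in> carrier A \<and> b' \<in> carrier B \<and> j b' = j b \<and>
          i a' = inv\<^bsub>B\<^esub> b' \<otimes>\<^bsub>B\<^esub> i.H.\<gamma> b'} = {H1_class A a}"
    using a b(1) by blast
  then show ?thesis unfolding connecting_map_def by simp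
qed

lemma connecting_map_lift:
  assumes c: "c \<in> j.H.R"
  shows "\<exists>b\<in>carrier B. \<exists>a\<in>cocycles A. j b = c \<and> i a = inv\<^bsub>B\<^esub> b \<otimes>\<^bsub>B\<^esub> i.H.\<gamma> b \<and> \<delta> c = H1_class A a"
proof -
  have "c \<in> j ` carrier B" using j.surj j.H.R_carrier[OF c] by simp
  then obtain b where b: "j b = c" "b \<in> carrier B" by (auto simp: image_iff)
  have jb: "j b \<in> j.H.R" using b(1) c by simp
  obtain a where a: "a \<in> cocycles A" "i a = inv\<^bsub>B\<^esub> b \<otimes>\<^bsub>B\<^esub> i.H.\<gamma> b"
    using difference_lift[OF b(2) jb] by (elim bexE) (rule that; assumption)
  have "\<delta> c = H1_class A a"
    using connecting_map_eq[OF b(2) jb i.G.cocycle_carrier[OF a(1)] a(2)] b(1) by simp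
  then show ?thesis
    by (intro bexI[OF _ b(2)] bexI[OF _ a(1)] conjI b(1) a(2))
qed

text \<open>
  The lift \<open>r b\<close> has the same defect as \<open>b\<close>, because \<open>r\<close> is real.
\<close>

lemma connecting_map_translate:
  assumes r: "r \<in> i.H.R" and c: "c \<in> j.H.R"
  shows "\<delta> (j r \<otimes>\<^bsub>C\<^esub> c) = \<delta> c"
proof -
  obtain b a where b: "b \<in> carrier B" "j b = c" and a: "a \<in> cocycles A" "i a = inv\<^bsub>B\<^esub> b \<otimes>\<^bsub>B\<^esub> i.H.\<gamma> b"
    and \<delta>: "\<delta> c = H1_class A a"
    using connecting_map_lift[OF c] by (elim bexE conjE) (rule that; assumption)
  have rc: "r \<in> carrier B" "i.H.\<gamma> r = r" using r by (auto simp: i.H.R_iff)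
  have gb: "i.H.\<gamma> b \<in> carrier B" using b(1) by (rule i.H.gal_closed)
  have jrb: "j (r \<otimes>\<^bsub>B\<^esub> b) = j r \<otimes>\<^bsub>C\<^esub> c" using rc b by simp
  have "inv\<^bsub>B\<^esub> (r \<otimes>\<^bsub>B\<^esub> b) \<otimes>\<^bsub>B\<^esub> i.H.\<gamma> (r \<otimes>\<^bsub>B\<^esub> b) = inv\<^bsub>B\<^esub> b \<otimes>\<^bsub>B\<^esub> (inv\<^bsub>B\<^esub> r \<otimes>\<^bsub>B\<^esub> r) \<otimes>\<^bsub>B\<^esub> i.H.\<gamma> b"
    using rc b gb by (simp only: i.H.gal_mult i.H.inv_mult_group i.H.m_assoc i.H.m_closed i.H.inv_closed)
  also have "\<dots> = i a" using rc b gb a by simp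
  finally have "i a = inv\<^bsub>B\<^esub> (r \<otimes>\<^bsub>B\<^esub> b) \<otimes>\<^bsub>B\<^esub> i.H.\<gamma> (r \<otimes>\<^bsub>B\<^esub> b)" by (rule sym)
  moreover have "j (r \<otimes>\<^bsub>B\<^esub> b) \<in> j.H.R" unfolding jrb using j.real[OF r] c by (rule j.H.R_mult)
  ultimately have "\<delta> (j (r \<otimes>\<^bsub>B\<^esub> b)) = H1_class A a"
    using rc b a(1) i.G.cocycle_carrier by (intro connecting_map_eq) auto
  then show ?thesis using jrb \<delta> by simp
qed

definition \<delta>0 :: "'c set \<Rightarrow> 'a set" where
  "\<delta>0 K = (\<Union>c\<in>K. \<delta> c)"

text \<open>
  By \<open>identity_component_lift\<close> two real points in the same component differ by a factor
  \<open>j r\<close> with \<open>r\<close> real.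
\<close>

lemma delta0_class:
  assumes c: "c \<in> j.H.R"
  shows "\<delta>0 (pi0_class C c) = \<delta> c"
  unfolding \<delta>0_def
proof (rule j.H.UN_pi0_class[OF c])
  fix h assume "h \<in> j.H.I"
  then obtain r where "r \<in> i.H.I" "j r = h" using j.identity_component_lift by blast
  then show "\<delta> (h \<otimes>\<^bsub>C\<^esub> c) = \<delta> c" using connecting_map_translate[OF _ c, of r] i.H.I_real by auto
qed

lemma delta_real_image: "b \<in> i.H.R \<Longrightarrow> \<delta> (j b) = H1_class A \<one>\<^bsub>A\<^esub>"
proof -
  assume b: "b \<in> i.H.R"
  then have bc: "b \<in> carrier B" "i.H.\<gamma> b = b" by (auto simp: i.H.R_iff)
  then show ?thesis by (intro connecting_map_eq j.real[OF b]) auto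
qed

lemma delta0_pointed_map: "\<delta>0 \<in> pointed_maps (pi0_pointed C) (H1_pointed A)"
proof -
  have "\<delta>0 (pi0_class C c) \<in> H1 A" if c: "c \<in> j.H.R" for c
    using connecting_map_lift[OF c] delta0_class[OF c] i.G.H1_class_in by auto
  moreover have "\<delta>0 (pi0_class C \<one>\<^bsub>C\<^esub>) = H1_class A \<one>\<^bsub>A\<^esub>"
    using delta0_class[OF j.H.R_one] delta_real_image[OF i.H.R_one] by simp
  ultimately show ?thesis
    by (auto simp: pointed_maps_def pi0_pointed_def H1_pointed_def j.H.pi0_carrier j.H.pi0_one_class)
qed

text \<open>
  If \<open>j b\<close> is in the identity component, lift it to \<open>r\<close> in the identity component.
  Then \<open>r\<^sup>-\<^sup>1 b\<close> is a real point of the kernel in the component of \<open>b\<close>.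
\<close>

lemma exact_pi0_B: "exact_at (pi0_pointed A) (pi0_map B i) (pi0_pointed B) (pi0_map C j) (pi0_pointed C)"
  unfolding exact_at_def
proof (intro conjI i.pi0_pointed_map j.pi0_pointed_map)
  show "pi0_map B i ` fst (pi0_pointed A) =
      {K \<in> fst (pi0_pointed B). pi0_map C j K = snd (pi0_pointed C)}"
    unfolding pi0_pointed_def fst_conv snd_conv
  proof (intro equalityI subsetI)
    fix K assume "K \<in> pi0_map B i ` carrier (pi0 A)"
    then obtain a where a: "a \<in> i.G.R" "K = pi0_class B (i a)"
      unfolding i.G.pi0_carrier using i.pi0_map_class by auto
    have "pi0_map C j K = pi0_class C \<one>\<^bsub>C\<^esub>"
      using j.pi0_map_class[OF i.real[OF a(1)]] j_i[OF i.G.R_carrier[OF a(1)]] a(2) by simp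
    then show "K \<in> {K \<in> carrier (pi0 B). pi0_map C j K = \<one>\<^bsub>pi0 C\<^esub>}"
      using a i.real[OF a(1)] by (simp add: i.H.pi0_carrier j.H.pi0_one_class)
  next
    fix K assume "K \<in> {K \<in> carrier (pi0 B). pi0_map C j K = \<one>\<^bsub>pi0 C\<^esub>}"
    then obtain b where b: "b \<in> i.H.R" "K = pi0_class B b" "pi0_map C j K = \<one>\<^bsub>pi0 C\<^esub>"
      unfolding i.H.pi0_carrier by blast
    then have "pi0_class C (j b) = j.H.I" using j.pi0_map_class[OF b(1)] j.H.pi0_one by simp
    then have "j b \<in> j.H.I" using j.H.pi0_class_one[OF j.real[OF b(1)]] by simp
    then obtain r where r: "r \<in> i.H.I" "j r = j b" using j.identity_component_lift by blast
    have c: "r \<in> carrier B" "b \<in> carrier B" "r \<in> i.H.R" using r b i.H.I_carrier i.H.R_carrier i.H.I_real by auto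
    define b' where "b' = inv\<^bsub>B\<^esub> r \<otimes>\<^bsub>B\<^esub> b"
    have b': "b' \<in> i.H.R" using b(1) c(3) i.H.R_mult i.H.R_inv by (simp add: b'_def)
    have "j b' = \<one>\<^bsub>C\<^esub>" using c r(2) by (simp add: b'_def)
    then obtain a where a: "a \<in> carrier A" "i a = b'" using lift_kernel[of b'] i.H.R_carrier[OF b'] by blast
    have "i (i.G.\<gamma> a) = i a" using i.gal[OF a(1)] a(2) b' by (simp add: i.H.R_iff)
    then have "i.G.\<gamma> a = a" using a(1) i.G.gal_closed by (intro i_inj) auto
    then have aR: "a \<in> i.G.R" using a(1) by (simp add: i.G.R_iff)
    have "r \<otimes>\<^bsub>B\<^esub> b' = b" using c by (simp add: b'_def i.H.m_assoc[symmetric])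
    then have "K = pi0_class B b'" using i.H.pi0_class_cong[OF r(1) b'] b(2) by simp
    then have "K = pi0_map B i (pi0_class A a)" using i.pi0_map_class[OF aR] a(2) by simp
    then show "K \<in> pi0_map B i ` carrier (pi0 A)" unfolding i.G.pi0_carrier using aR by blast
  qed
qed

text \<open>
  If the defect \<open>a\<close> of a lift \<open>b\<close> is the coboundary
  \<open>x\<^sup>-\<^sup>1 \<gamma>(x)\<close>, then \<open>b i(x)\<^sup>-\<^sup>1\<close> is a real lift.
\<close>

lemma exact_pi0_C: "exact_at (pi0_pointed B) (pi0_map C j) (pi0_pointed C) \<delta>0 (H1_pointed A)"
  unfolding exact_at_def
proof (intro conjI j.pi0_pointed_map delta0_pointed_map)
  show "pi0_map C j ` fst (pi0_pointed B) = {K \<in> fst (pi0_pointed C). \<delta>0 K = snd (H1_pointed A)}"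
    unfolding pi0_pointed_def H1_pointed_def fst_conv snd_conv
  proof (intro equalityI subsetI)
    fix K assume "K \<in> pi0_map C j ` carrier (pi0 B)"
    then obtain b where b: "b \<in> i.H.R" "K = pi0_class C (j b)"
      unfolding i.H.pi0_carrier using j.pi0_map_class by auto
    then show "K \<in> {K \<in> carrier (pi0 C). \<delta>0 K = H1_class A \<one>\<^bsub>A\<^esub>}"
      using j.real[OF b(1)] delta0_class delta_real_image by (simp add: j.H.pi0_carrier)
  next
    fix K assume "K \<in> {K \<in> carrier (pi0 C). \<delta>0 K = H1_class A \<one>\<^bsub>A\<^esub>}"
    then obtain c where c: "c \<in> j.H.R" "K = pi0_class C c" "\<delta> c = H1_class A \<one>\<^bsub>A\<^esub>"
      unfolding j.H.pi0_carrier using delta0_class by auto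
    obtain b a where b: "b \<in> carrier B" "j b = c" and a: "a \<in> cocycles A" "i a = inv\<^bsub>B\<^esub> b \<otimes>\<^bsub>B\<^esub> i.H.\<gamma> b"
      and \<delta>: "\<delta> c = H1_class A a"
      using connecting_map_lift[OF c(1)] by (elim bexE conjE) (rule that; assumption)
    have "(a, \<one>\<^bsub>A\<^esub>) \<in> cohomologous A" using c(3) \<delta> by (intro i.G.H1_class_eqD i.G.one_cocycle) simp
    then obtain x where x: "x \<in> carrier A" "\<one>\<^bsub>A\<^esub> = x \<otimes>\<^bsub>A\<^esub> a \<otimes>\<^bsub>A\<^esub> inv\<^bsub>A\<^esub> (i.G.\<gamma> x)"
      by (rule i.G.cohomologousE)
    have ac: "a \<in> carrier A" "i.G.\<gamma> x \<in> carrier A" using a(1) x(1) i.G.cocycle_carrier i.G.gal_closed by auto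
    have "i.G.\<gamma> x = (x \<otimes>\<^bsub>A\<^esub> a \<otimes>\<^bsub>A\<^esub> inv\<^bsub>A\<^esub> (i.G.\<gamma> x)) \<otimes>\<^bsub>A\<^esub> i.G.\<gamma> x"
      using x(2)[symmetric] ac by simp
    also have "\<dots> = x \<otimes>\<^bsub>A\<^esub> a" using x(1) ac by (simp add: i.G.m_assoc)
    finally have gx: "i.G.\<gamma> x = x \<otimes>\<^bsub>A\<^esub> a" .
    define r where "r = b \<otimes>\<^bsub>B\<^esub> inv\<^bsub>B\<^esub> (i x)"
    have ix: "i x \<in> carrier B" using x(1) by simp
    have gb: "i.H.\<gamma> b \<in> carrier B" using b(1) by (rule i.H.gal_closed)
    have "i.H.\<gamma> (i x) = i x \<otimes>\<^bsub>B\<^esub> (inv\<^bsub>B\<^esub> b \<otimes>\<^bsub>B\<^esub> i.H.\<gamma> b)"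
      using i.gal[OF x(1)] gx x(1) ac a(2) by simp
    then have "i.H.\<gamma> r = i.H.\<gamma> b \<otimes>\<^bsub>B\<^esub> (inv\<^bsub>B\<^esub> (i.H.\<gamma> b) \<otimes>\<^bsub>B\<^esub> b \<otimes>\<^bsub>B\<^esub> inv\<^bsub>B\<^esub> (i x))"
      using b(1) ix gb by (simp add: r_def i.H.gal_mult i.H.gal_inv i.H.inv_mult_group i.H.m_assoc)
    also have "\<dots> = r" using b(1) ix gb by (simp add: r_def i.H.m_assoc[symmetric])
    finally have rR: "r \<in> i.H.R" using b(1) ix by (simp add: i.H.R_iff r_def)
    have "j r = c" using b ix j_i[OF x(1)] j.H.R_carrier[OF c(1)] by (simp add: r_def)
    then have "K = pi0_map C j (pi0_class B r)" using j.pi0_map_class[OF rR] c(2) by simp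
    then show "K \<in> pi0_map C j ` carrier (pi0 B)" unfolding i.H.pi0_carrier using rR by blast
  qed
qed

text \<open>
  If \<open>i a\<close> is the coboundary \<open>b\<^sup>-\<^sup>1 \<gamma>(b)\<close>, then \<open>j b\<close>
  is real because \<open>j (i a) = 1\<close>.
\<close>

lemma exact_H1_A: "exact_at (pi0_pointed C) \<delta>0 (H1_pointed A) (H1_map B i) (H1_pointed B)"
  unfolding exact_at_def
proof (intro conjI i.H1_pointed_map delta0_pointed_map)
  show "\<delta>0 ` fst (pi0_pointed C) = {\<xi> \<in> fst (H1_pointed A). H1_map B i \<xi> = snd (H1_pointed B)}"
    unfolding pi0_pointed_def H1_pointed_def fst_conv snd_conv
  proof (intro equalityI subsetI)
    fix \<xi> assume "\<xi> \<in> \<delta>0 ` carrier (pi0 C)"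
    then obtain c where c: "c \<in> j.H.R" "\<xi> = \<delta> c"
      unfolding j.H.pi0_carrier using delta0_class by auto
    obtain b a where b: "b \<in> carrier B" and a: "a \<in> cocycles A" "i a = inv\<^bsub>B\<^esub> b \<otimes>\<^bsub>B\<^esub> i.H.\<gamma> b"
      and \<delta>: "\<delta> c = H1_class A a"
      using connecting_map_lift[OF c(1)] by (elim bexE conjE) (rule that; assumption)
    have "H1_map B i \<xi> = H1_class B (i a)" using i.H1_map_class[OF a(1)] c(2) \<delta> by simp
    also have "\<dots> = H1_class B \<one>\<^bsub>B\<^esub>"
      using i.H.H1_class_cong[OF i.H.coboundary[OF b]] a(2) by simp
    finally show "\<xi> \<in> {\<xi> \<in> H1 A. H1_map B i \<xi> = H1_class B \<one>\<^bsub>B\<^esub>}"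
      using i.G.H1_class_in[OF a(1)] c(2) \<delta> by simp
  next
    fix \<xi> assume "\<xi> \<in> {\<xi> \<in> H1 A. H1_map B i \<xi> = H1_class B \<one>\<^bsub>B\<^esub>}"
    then obtain a where a: "a \<in> cocycles A" "\<xi> = H1_class A a" "H1_class B (i a) = H1_class B \<one>\<^bsub>B\<^esub>"
      unfolding i.G.H1_eq using i.H1_map_class by auto
    have ac: "a \<in> carrier A" using i.G.cocycle_carrier[OF a(1)] .
    have "(\<one>\<^bsub>B\<^esub>, i a) \<in> cohomologous B"
      using a(3) by (intro i.H.H1_class_eqD i.cocycle[OF a(1)]) simp
    then obtain y where y: "y \<in> carrier B" "i a = y \<otimes>\<^bsub>B\<^esub> \<one>\<^bsub>B\<^esub> \<otimes>\<^bsub>B\<^esub> inv\<^bsub>B\<^esub> (i.H.\<gamma> y)"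
      by (rule i.H.cohomologousE)
    define b where "b = inv\<^bsub>B\<^esub> y"
    have b: "b \<in> carrier B" "i.H.\<gamma> b \<in> carrier B" using y(1) i.H.gal_closed by (auto simp: b_def)
    have ia: "i a = inv\<^bsub>B\<^esub> b \<otimes>\<^bsub>B\<^esub> i.H.\<gamma> b"
      using y i.H.gal_inv[OF y(1)] by (simp add: b_def)
    have "i.H.\<gamma> b = b \<otimes>\<^bsub>B\<^esub> i a" unfolding ia using b by (simp add: i.H.m_assoc[symmetric])
    then have "j.H.\<gamma> (j b) = j b" using j.gal[OF b(1)] b(1) ac j_i[OF ac] by simp
    then have jb: "j b \<in> j.H.R" using b(1) by (simp add: j.H.R_iff)
    have "\<xi> = \<delta>0 (pi0_class C (j b))"
      using delta0_class[OF jb] connecting_map_eq[OF b(1) jb ac ia] a(2) by simp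
    then show "\<xi> \<in> \<delta>0 ` carrier (pi0 C)" unfolding j.H.pi0_carrier using jb by blast
  qed
qed

text \<open>
  If \<open>j g\<close> is a coboundary of \<open>x\<close>, twisting \<open>g\<close> by a lift of
  \<open>x\<close> moves it into the kernel.
\<close>

lemma exact_H1_B: "exact_at (H1_pointed A) (H1_map B i) (H1_pointed B) (H1_map C j) (H1_pointed C)"
  unfolding exact_at_def
proof (intro conjI i.H1_pointed_map j.H1_pointed_map)
  show "H1_map B i ` fst (H1_pointed A) = {\<xi> \<in> fst (H1_pointed B). H1_map C j \<xi> = snd (H1_pointed C)}"
    unfolding H1_pointed_def fst_conv snd_conv
  proof (intro equalityI subsetI)
    fix \<xi> assume "\<xi> \<in> H1_map B i ` H1 A"
    then obtain a where a: "a \<in> cocycles A" "\<xi> = H1_class B (i a)"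
      unfolding i.G.H1_eq using i.H1_map_class by auto
    then show "\<xi> \<in> {\<xi> \<in> H1 B. H1_map C j \<xi> = H1_class C \<one>\<^bsub>C\<^esub>}"
      using j.H1_map_class[OF i.cocycle[OF a(1)]] j_i[OF i.G.cocycle_carrier[OF a(1)]]
        i.H.H1_class_in[OF i.cocycle[OF a(1)]] by simp
  next
    fix \<xi> assume "\<xi> \<in> {\<xi> \<in> H1 B. H1_map C j \<xi> = H1_class C \<one>\<^bsub>C\<^esub>}"
    then obtain g where g: "g \<in> cocycles B" "\<xi> = H1_class B g" "H1_class C (j g) = H1_class C \<one>\<^bsub>C\<^esub>"
      unfolding i.H.H1_eq using j.H1_map_class by auto
    have "(j g, \<one>\<^bsub>C\<^esub>) \<in> cohomologous C"
      using g(3) by (intro j.H.H1_class_eqD j.H.one_cocycle) simp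
    then obtain x where x: "x \<in> carrier C" "\<one>\<^bsub>C\<^esub> = x \<otimes>\<^bsub>C\<^esub> j g \<otimes>\<^bsub>C\<^esub> inv\<^bsub>C\<^esub> (j.H.\<gamma> x)"
      by (rule j.H.cohomologousE)
    obtain y where y: "y \<in> carrier B" "x = j y" using x(1) j.surj by blast
    define g' where "g' = y \<otimes>\<^bsub>B\<^esub> g \<otimes>\<^bsub>B\<^esub> inv\<^bsub>B\<^esub> (i.H.\<gamma> y)"
    have gg': "(g, g') \<in> cohomologous B" unfolding g'_def by (rule i.H.cohomologousI[OF g(1) y(1)])
    have g': "g' \<in> cocycles B" unfolding g'_def by (rule i.H.twist_cocycle[OF g(1) y(1)])
    have "j g' = \<one>\<^bsub>C\<^esub>"
      using y x(2) i.H.cocycle_carrier[OF g(1)] i.H.gal_closed[OF y(1)] j.gal[OF y(1)] by (simp add: g'_def)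
    then obtain a where a: "a \<in> carrier A" "i a = g'"
      using lift_kernel[of g'] i.H.cocycle_carrier[OF g'] by blast
    have ac: "a \<in> cocycles A" using cocycle_of_image[OF a(1)] a(2) g' by simp
    have "\<xi> = H1_map B i (H1_class A a)"
      using i.H1_map_class[OF ac] a(2) i.H.H1_class_cong[OF gg'] g(2) by simp
    then show "\<xi> \<in> H1_map B i ` H1 A" using i.G.H1_class_in[OF ac] by blast
  qed
qed

end

theorem proposition5p4:
  fixes A :: "'a ralg_group" and B :: "'b ralg_group" and C :: "'c ralg_group"
    and i :: "'a \<Rightarrow> 'b" and j :: "'b \<Rightarrow> 'c"
  assumes "real_algebraic_group A" and "real_algebraic_group B" and "real_algebraic_group C"
    and "short_exact A i B j C"
  shows "\<exists>\<delta>0 :: 'c set \<Rightarrow> 'a set.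
    (\<forall>c \<in> carrier (real_points C). \<delta>0 (pi0_class C c) = connecting_map A i B j c) \<and>
    exact_at (pi0_pointed A) (pi0_map B i) (pi0_pointed B) (pi0_map C j) (pi0_pointed C) \<and>
    exact_at (pi0_pointed B) (pi0_map C j) (pi0_pointed C) \<delta>0 (H1_pointed A) \<and>
    exact_at (pi0_pointed C) \<delta>0 (H1_pointed A) (H1_map B i) (H1_pointed B) \<and>
    exact_at (H1_pointed A) (H1_map B i) (H1_pointed B) (H1_map C j) (H1_pointed C)"
proof -
  interpret exact_seq A B C i j
    using assms unfolding short_exact_def
    by (simp add: exact_seq_def exact_seq_axioms_def alg_hom_def alg_hom_axioms_def alg_epi_def
        alg_epi_axioms_def alg_group_def)
  show ?thesis
    by (intro exI[of _ \<delta>0] conjI ballI delta0_class exact_pi0_B exact_pi0_C exact_H1_A exact_H1_B)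
qed

end
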